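(* Let $X$ be a finite dimensional real normed linear space which is generic and has dimension at least $2$, let $X\oplus_\infty\mathbb{R}$ be the associated cylindrical normed space, and let $G=(V,E)$ be a graph. The following statements are equivalent. (i) $G$ is rigid (respectively, minimally rigid, independent) in $X\oplus_\infty\mathbb{R}$. (ii) $G$ is an edge-disjoint union of spanning subgraphs $H$ and $T$, where $H$ is rigid (respectively, minimally rigid, independent) in $X$ and $T$ is connected (respectively, a tree, a forest).
   Context: All graphs are finite, simple and undirected. For a normed space $X$ with norm $\|\cdot\|_X$, $X\oplus_\infty\mathbb{R}$ is the direct sum with norm $\|(x,y)\|=\max\{\|x\|_X,|y|\}$ (a cylindrical normed space). Let $Y$ be a finite dimensional real normed space. A framework in $Y$ is a pair $(G,p)$ with $G=(V,E)$ a graph and $p=(p_v)_{v\in V}\in Y^V$ (a placement of $G$) with $p_v\neq p_w$ for every $vw\in E$. The rigidity map is $f_G:Y^V\to\mathbb{R}^E$, $(x_v)_{v}\mapsto(\|x_v-x_w\|_Y)_{vw\in E}$. The framework is well-positioned if $f_G$ is differentiable at $p$; it is regular (and $p$ is a regular placement) if it is well-positioned and $\operatorname{rank} df_G(p)$ is maximal among all well-positioned placements; a well-positioned framework is independent if $df_G(p):Y^V\to\mathbb{R}^E$ is surjective. A rigid motion of $Y$ is a family of continuous paths $\alpha_x:[-1,1]\to Y$ ($x\in Y$) such that $\alpha_x(0)=x$, $\alpha_x$ is differentiable at $0$, and $\|\alpha_x(t)-\alpha_y(t)\|_Y=\|x-y\|_Y$ for all $x,y\in Y$, $t\in[-1,1]$.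 Maps $\eta:Y\to Y$ of the form $\eta(x)=\alpha_x'(0)$ are infinitesimal rigid motions; they form a linear space $\mathcal{T}(Y)$. Put $\mathcal{T}(G,p)=\{(\eta(p_v))_{v\in V}:\eta\in\mathcal{T}(Y)\}\subseteq\ker df_G(p)$. A well-positioned framework $(G,p)$ is infinitesimally rigid if $\ker df_G(p)=\mathcal{T}(G,p)$, and minimally infinitesimally rigid if it is both infinitesimally rigid and independent. A graph $G$ is rigid (respectively, minimally rigid, independent) in $Y$ if there is a well-positioned placement $p\in Y^V$ such that $(G,p)$ is infinitesimally rigid (respectively, minimally infinitesimally rigid, independent). $Y$ is generic if for every finite simple graph $G=(V,E)$ the set of regular placements of $G$ in $Y$ is dense in $Y^V$. *)

theory Defs
  imports "HOL-Analysis.Analysis" "HOL-Analysis.Finite_Function_Topology"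
begin

section \<open>Cylindrical normed spaces\<close>

text \<open>
  The library norm on the product type is the Euclidean combination of the two norms, so the
  direct sum of a normed space with the real line under the maximum norm is a type of its own.
\<close>

datatype 'a cylinder = Cyl (base: 'a) (height: real)

instantiation cylinder :: (real_vector) real_vector
begin

definition zero_cylinder :: "'a cylinder" where
  "0 = Cyl 0 0"

definition plus_cylinder :: "'a cylinder \<Rightarrow> 'a cylinder \<Rightarrow> 'a cylinder" where
  "a + b = Cyl (base a + base b) (height a + height b)"

definition minus_cylinder :: "'a cylinder \<Rightarrow> 'a cylinder \<Rightarrow> 'a cylinder" where
  "a - b = Cyl (base a - base b) (height a - height b)"

definition uminus_cylinder :: "'a cylinder \<Rightarrow> 'a cylinder" where
  "- a = Cyl (- base a) (- height a)"

definition scaleR_cylinder :: "real \<Rightarrow> 'a cylinder \<Rightarrow> 'a cylinder" where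
  "r *\<^sub>R a = Cyl (r *\<^sub>R base a) (r * height a)"

instance
  by standard (simp_all add: zero_cylinder_def plus_cylinder_def minus_cylinder_def
    uminus_cylinder_def scaleR_cylinder_def scaleR_add_left scaleR_add_right algebra_simps)

end

instantiation cylinder :: (real_normed_vector) real_normed_vector
begin

definition norm_cylinder :: "'a cylinder \<Rightarrow> real" where
  "norm a = max (norm (base a)) \<bar>height a\<bar>"

definition sgn_cylinder :: "'a cylinder \<Rightarrow> 'a cylinder" where
  "sgn_cylinder a = a /\<^sub>R norm a"

definition dist_cylinder :: "'a cylinder \<Rightarrow> 'a cylinder \<Rightarrow> real" where
  "dist_cylinder a b = norm (a - b)"

definition uniformity_cylinder :: "('a cylinder \<times> 'a cylinder) filter" where
  "uniformity_cylinder = (INF e\<in>{0<..}. principal {(a, b). dist a b < e})"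

definition open_cylinder :: "'a cylinder set \<Rightarrow> bool" where
  "open_cylinder U \<longleftrightarrow> (\<forall>a\<in>U. eventually (\<lambda>(a', b). a' = a \<longrightarrow> b \<in> U) uniformity)"

instance
proof
  fix a b :: "'a cylinder" and r :: real
  show "norm (a + b) \<le> norm a + norm b"
    unfolding norm_cylinder_def plus_cylinder_def
    using norm_triangle_ineq[of "base a" "base b"] abs_triangle_ineq[of "height a" "height b"]
    by (auto simp: max_def)
  show "norm (r *\<^sub>R a) = \<bar>r\<bar> * norm a"
    by (simp add: norm_cylinder_def scaleR_cylinder_def abs_mult max_mult_distrib_left)
  show "(norm a = 0) = (a = 0)"
    by (cases a) (auto simp: norm_cylinder_def zero_cylinder_def max_def)
qed (simp_all add: sgn_cylinder_def dist_cylinder_def uniformity_cylinder_def open_cylinder_def)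

end

section \<open>Graphs\<close>

text \<open>
  A graph has vertex set \<open>V\<close> and edge set \<open>E\<close>, where an edge is a two-element subset of \<open>V\<close>.
  The empty graph is allowed, and counts as connected.
\<close>

definition simple_graph :: "'v set \<Rightarrow> 'v set set \<Rightarrow> bool" where
  "simple_graph V E \<longleftrightarrow> finite V \<and> (\<forall>e\<in>E. e \<subseteq> V \<and> card e = 2)"

definition graph_connected :: "'v set \<Rightarrow> 'v set set \<Rightarrow> bool" where
  "graph_connected V E \<longleftrightarrow> (\<forall>u\<in>V. \<forall>v\<in>V. (u, v) \<in> {(a, b). {a, b} \<in> E}\<^sup>*)"

definition graph_cycle :: "'v set set \<Rightarrow> 'v list \<Rightarrow> bool" where
  "graph_cycle E vs \<longleftrightarrow> distinct vs \<and> length vs \<ge> 3 \<and>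
     (\<forall>i<length vs. {vs ! i, vs ! (Suc i mod length vs)} \<in> E)"

definition graph_forest :: "'v set set \<Rightarrow> bool" where
  "graph_forest E \<longleftrightarrow> (\<nexists>vs. graph_cycle E vs)"

definition graph_tree :: "'v set \<Rightarrow> 'v set set \<Rightarrow> bool" where
  "graph_tree V E \<longleftrightarrow> graph_connected V E \<and> graph_forest E"

section \<open>Frameworks\<close>

text \<open>
  For finite \<open>S\<close>, the space \<open>Y\<^sup>S\<close> of \<open>S\<close>-indexed families in \<open>Y\<close> is the subspace of the normed
  space of finitely supported functions consisting of the functions supported in \<open>S\<close>. The
  library norm there is the sum of the norms of the coordinates. For finite-dimensional \<open>Y\<close> the
  choice of norm on \<open>Y\<^sup>S\<close> affects neither differentiability nor density.
\<close>

definition families :: "'i set \<Rightarrow> ('i \<Rightarrow>\<^sub>0 'b::zero) set" where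
  "families S = {x. Poly_Mapping.keys x \<subseteq> S}"

definition edge_length :: "('v \<Rightarrow>\<^sub>0 'y::real_normed_vector) \<Rightarrow> 'v set \<Rightarrow> real" where
  "edge_length x e = (THE l. \<exists>v w. e = {v, w} \<and>
     l = norm (Poly_Mapping.lookup x v - Poly_Mapping.lookup x w))"

lemma edge_length_doubleton [simp]:
  "edge_length x {v, w} = norm (Poly_Mapping.lookup x v - Poly_Mapping.lookup x w)"
  unfolding edge_length_def
  by (rule the_equality) (auto simp: doubleton_eq_iff norm_minus_commute)

definition rigidity_map ::
    "'v set set \<Rightarrow> ('v \<Rightarrow>\<^sub>0 'y::real_normed_vector) \<Rightarrow> ('v set \<Rightarrow>\<^sub>0 real)" where
  "rigidity_map E x = Abs_poly_mapping (\<lambda>e. if e \<in> E then edge_length x e else 0)"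

lemma lookup_rigidity_map:
  assumes "finite E"
  shows "Poly_Mapping.lookup (rigidity_map E x) e = (if e \<in> E then edge_length x e else 0)"
  unfolding rigidity_map_def
  by (subst Abs_poly_mapping_inverse) (auto intro: finite_subset[OF _ assms])

definition framework :: "'v set \<Rightarrow> 'v set set \<Rightarrow> ('v \<Rightarrow>\<^sub>0 'y::real_normed_vector) \<Rightarrow> bool" where
  "framework V E p \<longleftrightarrow> p \<in> families V \<and>
     (\<forall>v w. {v, w} \<in> E \<longrightarrow> Poly_Mapping.lookup p v \<noteq> Poly_Mapping.lookup p w)"

definition well_positioned ::
    "'v set \<Rightarrow> 'v set set \<Rightarrow> ('v \<Rightarrow>\<^sub>0 'y::real_normed_vector) \<Rightarrow> bool" where
  "well_positioned V E p \<longleftrightarrow>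
     framework V E p \<and> rigidity_map E differentiable (at p within families V)"

text \<open>
  Only the restriction of the following map to \<open>families V\<close> is meaningful (and, at a
  well-positioned placement, uniquely determined); it is applied to elements of \<open>families V\<close> only.
\<close>

definition rigidity_deriv ::
    "'v set \<Rightarrow> 'v set set \<Rightarrow> ('v \<Rightarrow>\<^sub>0 'y::real_normed_vector) \<Rightarrow>
      ('v \<Rightarrow>\<^sub>0 'y) \<Rightarrow> ('v set \<Rightarrow>\<^sub>0 real)" where
  "rigidity_deriv V E p = frechet_derivative (rigidity_map E) (at p within families V)"

definition rigidity_rank ::
    "'v set \<Rightarrow> 'v set set \<Rightarrow> ('v \<Rightarrow>\<^sub>0 'y::real_normed_vector) \<Rightarrow> nat" where
  "rigidity_rank V E p = dim (rigidity_deriv V E p ` families V)"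

definition regular_framework ::
    "'v set \<Rightarrow> 'v set set \<Rightarrow> ('v \<Rightarrow>\<^sub>0 'y::real_normed_vector) \<Rightarrow> bool" where
  "regular_framework V E p \<longleftrightarrow> well_positioned V E p \<and>
     (\<forall>q :: 'v \<Rightarrow>\<^sub>0 'y. well_positioned V E q \<longrightarrow> rigidity_rank V E q \<le> rigidity_rank V E p)"

definition independent_framework ::
    "'v set \<Rightarrow> 'v set set \<Rightarrow> ('v \<Rightarrow>\<^sub>0 'y::real_normed_vector) \<Rightarrow> bool" where
  "independent_framework V E p \<longleftrightarrow>
     well_positioned V E p \<and> rigidity_deriv V E p ` families V = families E"

section \<open>Infinitesimal rigidity\<close>

definition rigid_motion :: "('y::real_normed_vector \<Rightarrow> real \<Rightarrow> 'y) \<Rightarrow> bool" where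
  "rigid_motion \<alpha> \<longleftrightarrow>
     (\<forall>x. continuous_on {-1..1} (\<alpha> x) \<and> \<alpha> x 0 = x \<and>
          \<alpha> x differentiable (at 0 within {-1..1})) \<and>
     (\<forall>x y. \<forall>t\<in>{-1..1}. norm (\<alpha> x t - \<alpha> y t) = norm (x - y))"

definition infinitesimal_rigid_motions :: "('y::real_normed_vector \<Rightarrow> 'y) set" where
  "infinitesimal_rigid_motions =
     {\<eta>. \<exists>\<alpha>. rigid_motion \<alpha> \<and>
        (\<forall>x. (\<alpha> x has_vector_derivative \<eta> x) (at 0 within {-1..1}))}"

definition trivial_motions ::
    "'v set \<Rightarrow> ('v \<Rightarrow>\<^sub>0 'y::real_normed_vector) \<Rightarrow> ('v \<Rightarrow>\<^sub>0 'y) set" where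
  "trivial_motions V p =
     {u \<in> families V. \<exists>\<eta>\<in>infinitesimal_rigid_motions.
        \<forall>v\<in>V. Poly_Mapping.lookup u v = \<eta> (Poly_Mapping.lookup p v)}"

definition infinitesimally_rigid ::
    "'v set \<Rightarrow> 'v set set \<Rightarrow> ('v \<Rightarrow>\<^sub>0 'y::real_normed_vector) \<Rightarrow> bool" where
  "infinitesimally_rigid V E p \<longleftrightarrow> well_positioned V E p \<and>
     {u \<in> families V. rigidity_deriv V E p u = 0} = trivial_motions V p"

definition minimally_infinitesimally_rigid ::
    "'v set \<Rightarrow> 'v set set \<Rightarrow> ('v \<Rightarrow>\<^sub>0 'y::real_normed_vector) \<Rightarrow> bool" where
  "minimally_infinitesimally_rigid V E p \<longleftrightarrow>
     infinitesimally_rigid V E p \<and> independent_framework V E p"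

section \<open>Rigidity of graphs in a normed space\<close>

definition rigid_graph ::
    "'y::real_normed_vector itself \<Rightarrow> 'v set \<Rightarrow> 'v set set \<Rightarrow> bool" where
  "rigid_graph Y V E \<longleftrightarrow> (\<exists>p :: 'v \<Rightarrow>\<^sub>0 'y. infinitesimally_rigid V E p)"

definition minimally_rigid_graph ::
    "'y::real_normed_vector itself \<Rightarrow> 'v set \<Rightarrow> 'v set set \<Rightarrow> bool" where
  "minimally_rigid_graph Y V E \<longleftrightarrow> (\<exists>p :: 'v \<Rightarrow>\<^sub>0 'y. minimally_infinitesimally_rigid V E p)"

definition independent_graph ::
    "'y::real_normed_vector itself \<Rightarrow> 'v set \<Rightarrow> 'v set set \<Rightarrow> bool" where
  "independent_graph Y V E \<longleftrightarrow> (\<exists>p :: 'v \<Rightarrow>\<^sub>0 'y. independent_framework V E p)"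

text \<open>
  A definition cannot quantify over vertex types; every finite graph is isomorphic to one whose
  vertices are natural numbers.
\<close>

definition generic_space :: "'y::real_normed_vector itself \<Rightarrow> bool" where
  "generic_space Y \<longleftrightarrow>
     (\<forall>(V :: nat set) E. simple_graph V E \<longrightarrow>
        families V \<subseteq> closure {p :: nat \<Rightarrow>\<^sub>0 'y. regular_framework V E p})"

end

theory Submission
  imports Defs
begin

text \<open>
  Away from the cone on which the norm of the base equals the height, the norm of the cylinder is
  locally either the norm of the base or the modulus of the height. Hence a well-positioned
  placement splits the edges into a set \<open>H\<close>, on which the rigidity matrix is that of the base
  placement, and a set \<open>T\<close>, on which it is the incidence matrix of a graph. By the Mazur--Ulam
  theorem rigid motions of the cylinder act on base and height separately, so kernel, image and
  trivial motions all decompose, which yields the subgraphs.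

  Conversely, a forest \<open>T\<close> is realised exactly as the set of edges along which the height
  dominates, on a nonempty open set of base placements. The space of trivial motions and the rank
  of the rigidity map are lower semicontinuous, so in this open set a placement that is regular
  for the remaining edges inherits rigidity and independence from the given placement of \<open>H\<close>.
\<close>

section \<open>Finite-dimensional linear algebra\<close>

text \<open>The given placement of \<open>H\<close> may lie far from the open set in which the
  forest is realised, so semicontinuity at that placement does not suffice. For the rank, genericity
  supplies a placement near the given one that is regular for the larger edge set, and the rank at a
  regular placement is a global maximum, so any other regular placement attains it. The dimension of
  the trivial motions also depends on the placement but has no such maximality; here one starts in
  the open set and moves slightly along the line towards the given placement. A kernel no larger
  than the original one, containing at least as many trivial motions, must then consist of them.

  A connected \<open>T\<close> may have too many edges to be realised by heights. Only a spanning
  forest of it is kept, and the surplus edges join \<open>H\<close>: this preserves rigidity, but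
  independence can be carried over only when nothing was moved. The dimension bound on the base
  gives room for the forest: one direction separates levels, and another separates the vertices
  within a level.\<close>

text \<open>Finite dimension is a property of sets here, because the families over a finite
  \<open>V\<close> live in a type that is infinite-dimensional when the vertex type is
  infinite.\<close>

definition finite_spanned :: "'a::real_vector set \<Rightarrow> bool" where
  "finite_spanned S \<longleftrightarrow> (\<exists>B. finite B \<and> S \<subseteq> span B)"

lemma finite_spanned_subset: "finite_spanned T \<Longrightarrow> S \<subseteq> T \<Longrightarrow> finite_spanned S"
  unfolding finite_spanned_def by blast

lemma finite_spanned_basis:
  assumes "finite_spanned S"
  obtains B where "B \<subseteq> S" "finite B" "independent B" "S \<subseteq> span B" "card B = dim S"
proof -
  obtain C where C: "finite C" "S \<subseteq> span C"
    using assms by (auto simp: finite_spanned_def)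
  obtain B where B: "B \<subseteq> S" "independent B" "S \<subseteq> span B" "card B = dim S"
    using basis_exists[of S] by auto
  have "finite B"
    using independent_span_bound[OF C(1) B(2)] B(1) C(2) by blast
  then show ?thesis using B that by blast
qed

lemma independent_card_le_dim_finite_spanned:
  assumes "finite_spanned S" "A \<subseteq> S" "independent A"
  shows "finite A" "card A \<le> dim S"
proof -
  obtain B where B: "B \<subseteq> S" "finite B" "independent B" "S \<subseteq> span B" "card B = dim S"
    using finite_spanned_basis[OF assms(1)] by blast
  then show "finite A" "card A \<le> dim S"
    using independent_span_bound[OF B(2) assms(3)] assms(2) by auto
qed

lemma finite_spanned_extend_basis:
  assumes "finite_spanned S" "A \<subseteq> S" "independent A"
  obtains B where "A \<subseteq> B" "B \<subseteq> S" "finite B" "independent B" "S \<subseteq> span B" "card B = dim S"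
proof -
  obtain B where B: "A \<subseteq> B" "B \<subseteq> S" "independent B" "S \<subseteq> span B"
    using maximal_independent_subset_extend[OF assms(2,3)] by blast
  then show ?thesis
    using that independent_card_le_dim_finite_spanned[OF assms(1) B(2,3)] basis_card_eq_dim[OF B(2,4,3)]
    by blast
qed

lemma subspace_eq_if_dim_le:
  assumes "subspace S" "S \<subseteq> T" "finite_spanned T" "dim T \<le> dim S"
  shows "S = T"
proof -
  have fS: "finite_spanned S" using finite_spanned_subset assms by blast
  obtain B where B: "B \<subseteq> S" "finite B" "independent B" "S \<subseteq> span B" "card B = dim S"
    using finite_spanned_basis[OF fS] by blast
  have "B \<subseteq> T" using B assms by blast
  then obtain C where C: "B \<subseteq> C" "C \<subseteq> T" "finite C" "independent C" "T \<subseteq> span C" "card C = dim T"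
    using finite_spanned_extend_basis[OF assms(3) _ B(3)] by blast
  have "B = C" using C B assms(4) by (metis card_seteq)
  then have "T \<subseteq> span B" using C by blast
  also have "span B \<subseteq> S" using B assms by (simp add: span_minimal)
  finally show ?thesis using assms by blast
qed

lemma dim_mono_finite_spanned:
  assumes "S \<subseteq> T" "finite_spanned T"
  shows "dim S \<le> dim T"
proof -
  obtain B where B: "B \<subseteq> S" "finite B" "independent B" "S \<subseteq> span B" "card B = dim S"
    using finite_spanned_basis[OF finite_spanned_subset[OF assms(2,1)]] by blast
  then show ?thesis
    using independent_card_le_dim_finite_spanned(2)[OF assms(2), of B] assms(1) by auto
qed

text \<open>Rank and nullity relative to a subspace: a basis \<open>A\<close> of the kernel is
  extended to a basis \<open>B\<close> of \<open>S\<close>, and \<open>f\<close> is injective on the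
  span of \<open>B - A\<close>.\<close>

lemma dim_kernel_plus_dim_image:
  assumes f: "linear f" and S: "subspace S" "finite_spanned S"
  shows "dim S = dim {x\<in>S. f x = 0} + dim (f ` S)"
proof -
  let ?K = "{x\<in>S. f x = 0}"
  obtain A where A: "A \<subseteq> ?K" "finite A" "independent A" "?K \<subseteq> span A" "card A = dim ?K"
    using finite_spanned_basis[OF finite_spanned_subset[OF S(2), of ?K]] by blast
  obtain B where B: "A \<subseteq> B" "B \<subseteq> S" "finite B" "independent B" "S \<subseteq> span B" "card B = dim S"
    using finite_spanned_extend_basis[OF S(2) _ A(3)] A(1) by blast
  let ?C = "B - A"
  \<comment> \<open>The coefficients of \<open>x\<close> over \<open>B\<close> are supported both in
    \<open>A\<close> and in \<open>B - A\<close>, so they all vanish.\<close>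
  have disj: "x = 0" if x: "x \<in> span A" "x \<in> span ?C" for x
  proof -
    have "real_vector.representation B x = real_vector.representation A x"
      "real_vector.representation B x = real_vector.representation ?C x"
      using x B by (auto intro!: real_vector.representation_extend)
    then have "real_vector.representation B x b = 0" for b
      by (metis Diff_iff real_vector.representation_ne_zero)
    moreover have "x \<in> span B" using x B(1) span_mono by blast
    ultimately show "x = 0"
      using real_vector.sum_nonzero_representation_eq[OF B(4), of x] by simp
  qed
  have sC: "span ?C \<subseteq> S"
    using B S by (meson Diff_subset order_trans span_minimal)
  have inj: "inj_on f (span ?C)"
  proof -
    have "x = 0" if "x \<in> span ?C" "f x = 0" for x
      using that sC A(4) disj by blast
    then show ?thesis
      using linear_injective_on_subspace_0[OF f, of "span ?C"] by auto
  qed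
  have indep: "independent (f ` ?C)"
    using linear_independent_injective_image[OF f _ inj] B(4) independent_mono by blast
  have "f ` S \<subseteq> span (f ` ?C)"
  proof
    fix y assume "y \<in> f ` S"
    then obtain x where x: "x \<in> S" "y = f x" by blast
    have "x \<in> span (A \<union> ?C)" using x B by (simp add: Un_absorb1 subset_iff)
    then obtain a c where ac: "x = a + c" "a \<in> span A" "c \<in> span ?C"
      unfolding span_Un by blast
    have "span A \<subseteq> ?K"
    proof (rule span_minimal[OF A(1)])
      show "subspace ?K"
        using S(1) by (auto simp: subspace_def linear_add[OF f] linear_0[OF f] linear_scale[OF f])
    qed
    then have "f a = 0" using ac by blast
    then have "y = f c" using x ac by (simp add: linear_add[OF f])
    then show "y \<in> span (f ` ?C)" using ac by (simp add: linear_span_image f)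
  qed
  moreover have "f ` ?C \<subseteq> f ` S" using B by blast
  ultimately have "card (f ` ?C) = dim (f ` S)" using indep by (simp add: basis_card_eq_dim)
  moreover have "card (f ` ?C) = card ?C"
    using inj by (meson card_image inj_on_subset span_superset)
  ultimately show ?thesis using A B by (metis card_Diff_subset card_mono le_add_diff_inverse)
qed

text \<open>Independence is indexed because the members will be moved: in a set, two members that
  come to coincide would merge unnoticed.\<close>

definition independent_family :: "'i set \<Rightarrow> ('i \<Rightarrow> 'a::real_vector) \<Rightarrow> bool" where
  "independent_family I y \<longleftrightarrow> (\<forall>c. (\<Sum>i\<in>I. c i *\<^sub>R y i) = 0 \<longrightarrow> (\<forall>i\<in>I. c i = 0))"

lemma independent_family_imp:
  assumes "finite I" "independent_family I y"
  shows "inj_on y I" "independent (y ` I)"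
proof -
  show inj: "inj_on y I"
  proof (rule inj_onI, rule ccontr)
    fix i j assume ij: "i \<in> I" "j \<in> I" "y i = y j" "i \<noteq> j"
    let ?c = "\<lambda>k. if k = i then 1 else if k = j then -1 else (0::real)"
    have "(\<Sum>k\<in>I. ?c k *\<^sub>R y k) = (\<Sum>k\<in>{i,j}. ?c k *\<^sub>R y k)"
      using ij assms(1) by (intro sum.mono_neutral_right) auto
    also have "\<dots> = 0" using ij by simp
    finally show False using assms(2) ij unfolding independent_family_def by (auto dest!: spec[of _ ?c])
  qed
  show "independent (y ` I)"
  proof (rule independent_if_scalars_zero)
    show "finite (y ` I)" using assms by simp
    fix f x assume f: "(\<Sum>x\<in>y ` I. f x *\<^sub>R x) = 0" and x: "x \<in> y ` I"
    have "(\<Sum>i\<in>I. f (y i) *\<^sub>R y i) = 0" using f by (simp add: sum.reindex[OF inj])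
    then show "f x = 0" using assms(2) x unfolding independent_family_def
      by (auto dest!: spec[of _ "\<lambda>i. f (y i)"])
  qed
qed

lemma independent_imp_independent_family:
  assumes "finite B" "independent B"
  shows "independent_family B (\<lambda>b. b)"
  using assms independentD unfolding independent_family_def by blast

lemma card_le_dim_if_independent_family:
  assumes "finite I" "independent_family I y" "y ` I \<subseteq> S" "finite_spanned S"
  shows "card I \<le> dim S"
  using independent_card_le_dim_finite_spanned(2)[OF assms(4,3)] independent_family_imp[OF assms(1,2)]
  by (simp add: card_image)

text \<open>Tychonoff. The coefficients are functions on the whole type, so the coordinates outside
  \<open>B\<close> are pinned to 0 to obtain a product of compact sets.\<close>

lemma compact_coordinate_box:
  fixes B :: "'a set" and r :: real
  shows "compact {f :: 'a \<Rightarrow> real. (\<forall>b\<in>B. \<bar>f b\<bar> \<le> r) \<and> (\<forall>b. b \<notin> B \<longrightarrow> f b = 0)}"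
proof -
  have eq: "{f :: 'a \<Rightarrow> real. (\<forall>b\<in>B. \<bar>f b\<bar> \<le> r) \<and> (\<forall>b. b \<notin> B \<longrightarrow> f b = 0)} =
      PiE UNIV (\<lambda>b. if b \<in> B then {-r..r} else {0})"
  proof -
    have abs_iff: "\<bar>x\<bar> \<le> r \<longleftrightarrow> x \<in> {-r..r}" for x :: real by auto
    show ?thesis unfolding PiE_UNIV_domain Pi_def abs_iff by (intro Collect_cong) (metis singleton_iff UNIV_I)
  qed
  have "compact_space (product_topology (\<lambda>b. top_of_set (if b \<in> B then {-r..r} else {0})) UNIV)"
    by (rule compact_space_product_topology[THEN iffD2]) (auto simp: compact_space_subtopology)
  then have "compactin (product_topology (\<lambda>b::'a. euclidean) UNIV)
      (PiE UNIV (\<lambda>b. if b \<in> B then {-r..r} else {0}))"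
    by (subst compactin_PiE) auto
  then show ?thesis unfolding eq by (simp add: euclidean_product_topology)
qed

lemma continuous_on_combination:
  fixes y :: "'i \<Rightarrow> 'a::real_normed_vector"
  shows "continuous_on UNIV (\<lambda>c :: 'i \<Rightarrow> real. \<Sum>i\<in>I. c i *\<^sub>R y i)"
  by (intro continuous_intros continuous_on_product_coordinates)

text \<open>The norm of a combination is continuous and nonzero on the compact set of coefficient
  vectors with largest modulus 1; \<open>m\<close> is its minimum there, and homogeneity does the
  rest. Compactness of balls and boundedness of linear maps are both derived from this
  bound.\<close>

lemma independent_family_bounded_below:
  fixes y :: "'i \<Rightarrow> 'a::real_normed_vector"
  assumes I: "finite I" and y: "independent_family I y"
  obtains m where "m > 0" "\<And>c i. i \<in> I \<Longrightarrow> m * \<bar>c i\<bar> \<le> norm (\<Sum>i\<in>I. c i *\<^sub>R y i)"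
proof (cases "I = {}")
  case True
  then show ?thesis using that[of 1] by simp
next
  case False
  define K where "K = (\<Union>j\<in>I. {f. (\<forall>b\<in>I. \<bar>f b\<bar> \<le> 1) \<and> (\<forall>b. b \<notin> I \<longrightarrow> f b = 0)} \<inter> {f :: 'i \<Rightarrow> real. \<bar>f j\<bar> = 1})"
  have K_iff: "c \<in> K \<longleftrightarrow> (\<forall>b\<in>I. \<bar>c b\<bar> \<le> 1) \<and> (\<forall>b. b \<notin> I \<longrightarrow> c b = 0) \<and> (\<exists>j\<in>I. \<bar>c j\<bar> = 1)" for c
    unfolding K_def by blast
  have "closed {f :: 'i \<Rightarrow> real. \<bar>f j\<bar> = 1}" for j
  proof -
    have "continuous_on UNIV (\<lambda>f :: 'i \<Rightarrow> real. \<bar>f j\<bar>)"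
      by (intro continuous_intros continuous_on_product_coordinates)
    then show ?thesis using closed_Collect_eq[of "\<lambda>f. \<bar>f j\<bar>" "\<lambda>f. 1"] by simp
  qed
  then have K: "compact K"
    unfolding K_def using I by (intro compact_UN ballI compact_Int_closed compact_coordinate_box) auto
  have "(\<lambda>i. if i \<in> I then 1 else 0) \<in> K" using False unfolding K_iff by auto
  then have ne: "K \<noteq> {}" by blast
  have cont: "continuous_on K (\<lambda>c. norm (\<Sum>i\<in>I. c i *\<^sub>R y i))"
    by (intro continuous_on_norm continuous_on_subset[OF continuous_on_combination]) auto
  obtain c0 where c0: "c0 \<in> K" "\<And>c. c \<in> K \<Longrightarrow> norm (\<Sum>i\<in>I. c0 i *\<^sub>R y i) \<le> norm (\<Sum>i\<in>I. c i *\<^sub>R y i)"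
    using continuous_attains_inf[OF K ne cont] by blast
  define m where "m = norm (\<Sum>i\<in>I. c0 i *\<^sub>R y i)"
  have "m \<noteq> 0"
  proof
    assume "m = 0"
    then have "\<forall>i\<in>I. c0 i = 0" using y unfolding m_def independent_family_def by simp
    then show False using c0(1) unfolding K_iff by force
  qed
  then have m: "m > 0" unfolding m_def by simp
  show ?thesis
  proof (rule that[OF m])
    fix c :: "'i \<Rightarrow> real" and i assume i: "i \<in> I"
    define M where "M = Max ((\<lambda>j. \<bar>c j\<bar>) ` I)"
    have Mge: "\<bar>c j\<bar> \<le> M" if "j \<in> I" for j using that I unfolding M_def by auto
    have "M \<in> (\<lambda>j. \<bar>c j\<bar>) ` I" unfolding M_def using I False by (intro Max_in) auto
    then obtain j where j: "j \<in> I" "M = \<bar>c j\<bar>" by blast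
    show "m * \<bar>c i\<bar> \<le> norm (\<Sum>i\<in>I. c i *\<^sub>R y i)"
    proof (cases "M = 0")
      case True
      then show ?thesis using Mge[OF i] by simp
    next
      case M0: False
      then have Mp: "M > 0" using j by auto
      \<comment> \<open>Rescaled so that the largest modulus is 1, and set to 0 off
        \<open>I\<close>, as membership in \<open>K\<close> demands.\<close>
      let ?d = "\<lambda>k. if k \<in> I then c k / M else 0"
      have "\<bar>?d j\<bar> = 1" using j Mp by simp
      then have "?d \<in> K" using j(1) Mp Mge unfolding K_iff by (intro conjI) (auto simp: divide_le_eq)
      then have "m \<le> norm (\<Sum>k\<in>I. ?d k *\<^sub>R y k)" using c0(2) unfolding m_def by blast
      also have "(\<Sum>k\<in>I. ?d k *\<^sub>R y k) = (\<Sum>k\<in>I. (1/M) *\<^sub>R (c k *\<^sub>R y k))"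
        by (intro sum.cong) auto
      also have "\<dots> = (1/M) *\<^sub>R (\<Sum>k\<in>I. c k *\<^sub>R y k)" by (simp add: scaleR_sum_right)
      finally have "m * M \<le> norm (\<Sum>k\<in>I. c k *\<^sub>R y k)" using Mp by (simp add: field_simps)
      moreover have "m * \<bar>c i\<bar> \<le> m * M" using Mge[OF i] m by simp
      ultimately show ?thesis by linarith
    qed
  qed
qed

text \<open>A dependence of \<open>z\<close> whose largest coefficient is \<open>M\<close> would
  give \<open>m * M \<le> card I * M * d\<close>. The choice \<open>d = m / (2 * card I)\<close>
  makes the right side \<open>m * M / 2\<close>, which forces \<open>M = 0\<close>.\<close>

lemma independent_family_perturb:
  fixes y :: "'i \<Rightarrow> 'a::real_normed_vector"
  assumes I: "finite I" and y: "independent_family I y"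
  obtains d where "d > 0" "\<And>z. (\<And>i. i \<in> I \<Longrightarrow> norm (z i - y i) < d) \<Longrightarrow> independent_family I z"
proof (cases "I = {}")
  case True
  then show ?thesis using that[of 1] by (simp add: independent_family_def)
next
  case False
  obtain m where m: "m > 0" "\<And>c i. i \<in> I \<Longrightarrow> m * \<bar>c i\<bar> \<le> norm (\<Sum>i\<in>I. c i *\<^sub>R y i)"
    using independent_family_bounded_below[OF assms] by blast
  define d where "d = m / (2 * card I)"
  have cI: "card I > 0" using I False by (simp add: card_gt_0_iff)
  have d: "d > 0" using m cI by (simp add: d_def)
  show ?thesis
  proof (rule that[OF d])
    fix z assume z: "\<And>i. i \<in> I \<Longrightarrow> norm (z i - y i) < d"
    show "independent_family I z"
      unfolding independent_family_def
    proof (intro allI impI)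
      fix c assume c0: "(\<Sum>i\<in>I. c i *\<^sub>R z i) = 0"
      define M where "M = Max ((\<lambda>j. \<bar>c j\<bar>) ` I)"
      have Mge: "\<bar>c j\<bar> \<le> M" if "j \<in> I" for j using that I unfolding M_def by auto
      have "M \<in> (\<lambda>j. \<bar>c j\<bar>) ` I" unfolding M_def using I False by (intro Max_in) auto
      then obtain j where j: "j \<in> I" "M = \<bar>c j\<bar>" by blast
      have "(\<Sum>i\<in>I. c i *\<^sub>R y i) = - (\<Sum>i\<in>I. c i *\<^sub>R (z i - y i))"
        using c0 by (simp add: algebra_simps sum_subtractf)
      then have "m * M \<le> norm (\<Sum>i\<in>I. c i *\<^sub>R (z i - y i))"
        using m(2)[OF j(1), of c] j(2) by simp
      also have "\<dots> \<le> (\<Sum>i\<in>I. M * d)"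
      proof (intro sum_norm_le)
        fix i assume "i \<in> I"
        then show "norm (c i *\<^sub>R (z i - y i)) \<le> M * d"
          using Mge[of i] z[of i] by (auto intro!: mult_mono)
      qed
      also have "\<dots> = m * M / 2" using cI by (simp add: d_def)
      finally have "M \<le> 0" using m(1) by simp
      then show "\<forall>i\<in>I. c i = 0" using Mge by fastforce
    qed
  qed
qed

text \<open>In a basis the coordinates of the points of the ball are at most \<open>r / m\<close>,
  so the ball is a closed subset of the continuous image of a coordinate box.\<close>

lemma compact_cball_finite_dim:
  fixes B :: "'a::real_normed_vector set"
  assumes "finite B" "span B = UNIV"
  shows "compact (cball (0::'a) r)"
proof -
  have "finite_spanned (UNIV :: 'a set)" using assms unfolding finite_spanned_def by blast
  then obtain C :: "'a set" where C: "finite C" "independent C" "UNIV \<subseteq> span C"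
    by (elim finite_spanned_basis)
  obtain m where m: "m > 0" "\<And>c i. i \<in> C \<Longrightarrow> m * \<bar>c i\<bar> \<le> norm (\<Sum>i\<in>C. c i *\<^sub>R i)"
    using independent_family_bounded_below[OF C(1) independent_imp_independent_family[OF C(1,2)]] by metis
  let ?K = "{f :: 'a \<Rightarrow> real. (\<forall>b\<in>C. \<bar>f b\<bar> \<le> r / m) \<and> (\<forall>b. b \<notin> C \<longrightarrow> f b = 0)}"
  let ?g = "\<lambda>c. \<Sum>i\<in>C. c i *\<^sub>R i"
  have comp: "compact (?g ` ?K)"
    by (intro compact_continuous_image compact_coordinate_box continuous_on_subset[OF continuous_on_combination]) auto
  have sub: "cball 0 r \<subseteq> ?g ` ?K"
  proof
    fix x :: 'a assume x: "x \<in> cball 0 r"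
    have "x \<in> span C" using C by blast
    then obtain u where u: "x = ?g u" unfolding span_finite[OF C(1)] by blast
    let ?v = "\<lambda>b. if b \<in> C then u b else 0"
    have "\<bar>?v b\<bar> \<le> r / m" if "b \<in> C" for b
    proof -
      have "m * \<bar>u b\<bar> \<le> r" using m(2)[OF that, of u] x u by simp
      then show ?thesis using m(1) that by (simp add: field_simps)
    qed
    moreover have "x = ?g ?v" unfolding u by (intro sum.cong) auto
    moreover have "\<forall>b. b \<notin> C \<longrightarrow> ?v b = 0" by simp
    ultimately show "x \<in> ?g ` ?K" by (intro image_eqI[of _ _ ?v]) blast+
  qed
  show ?thesis using compact_Int_closed[OF comp closed_cball[of 0 r]] sub by (simp only: inf.absorb2)
qed

text \<open>Eigenvectors for distinct eigenvalues are independent, so more than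
  \<open>card B\<close> eigenvalues would put too many independent vectors into
  \<open>span B\<close>.\<close>

lemma finite_eigenvalues:
  fixes N :: "'a::real_vector \<Rightarrow> 'a"
  assumes N: "linear N" and B: "finite B"
  shows "finite {l. \<exists>x\<in>span B. x \<noteq> 0 \<and> N x = l *\<^sub>R x}" (is "finite ?L")
proof (rule ccontr)
  assume "infinite ?L"
  from infinite_arbitrarily_large[OF this, of "Suc (card B)"]
  obtain F where F: "finite F" "card F = Suc (card B)" "F \<subseteq> ?L" by blast
  have "\<forall>l\<in>F. \<exists>x. x \<in> span B \<and> x \<noteq> 0 \<and> N x = l *\<^sub>R x" using F(3) by blast
  then obtain e where e: "\<And>l. l \<in> F \<Longrightarrow> e l \<in> span B \<and> e l \<noteq> 0 \<and> N (e l) = l *\<^sub>R e l"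
    unfolding bchoice_iff by blast
  have "independent_family F e" using F(1) e
  proof (induction F rule: finite_induct)
    case empty
    then show ?case by (simp add: independent_family_def)
  next
    case (insert k F)
    then have IH: "independent_family F e" by blast
    show ?case unfolding independent_family_def
    proof (intro allI impI)
      fix c assume "(\<Sum>i\<in>insert k F. c i *\<^sub>R e i) = 0"
      then have s: "c k *\<^sub>R e k + (\<Sum>i\<in>F. c i *\<^sub>R e i) = 0" using insert by simp
      \<comment> \<open>Applying \<open>N\<close> minus \<open>k\<close> times the identity removes
        the new eigenvector and multiplies the coefficient of \<open>e i\<close> by the nonzero
        number \<open>i - k\<close>.\<close>
      then have "N (c k *\<^sub>R e k + (\<Sum>i\<in>F. c i *\<^sub>R e i)) - k *\<^sub>R (c k *\<^sub>R e k + (\<Sum>i\<in>F. c i *\<^sub>R e i)) = 0"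
        by (simp add: linear_0[OF N])
      moreover have "N (c k *\<^sub>R e k + (\<Sum>i\<in>F. c i *\<^sub>R e i)) = c k *\<^sub>R k *\<^sub>R e k + (\<Sum>i\<in>F. c i *\<^sub>R i *\<^sub>R e i)"
        using insert.prems by (simp add: linear_add[OF N] linear_sum[OF N] linear_scale[OF N])
      ultimately have "(\<Sum>i\<in>F. c i *\<^sub>R i *\<^sub>R e i) - k *\<^sub>R (\<Sum>i\<in>F. c i *\<^sub>R e i) = 0"
        by (simp add: scaleR_add_right mult.commute)
      then have "(\<Sum>i\<in>F. (c i * (i - k)) *\<^sub>R e i) = 0"
        by (simp add: scaleR_sum_right sum_subtractf[symmetric] algebra_simps)
      then have "\<forall>i\<in>F. c i * (i - k) = 0" using IH[unfolded independent_family_def, rule_format, of "\<lambda>i. c i * (i - k)"] by blast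
      then have z: "\<forall>i\<in>F. c i = 0" using insert.hyps by auto
      then have "c k *\<^sub>R e k = 0" using s by simp
      then show "\<forall>i\<in>insert k F. c i = 0" using z insert.prems by auto
    qed
  qed
  then have "inj_on e F" "independent (e ` F)" using independent_family_imp F by blast+
  moreover have "e ` F \<subseteq> span B" using e by blast
  ultimately have "card F \<le> card B" using independent_span_bound[OF B] by (metis card_image)
  then show False using F by simp
qed

text \<open>
  Writing \<open>a i + s *\<^sub>R b i = w i + (s - 1) *\<^sub>R N (w i)\<close> with \<open>w i = a i + b i\<close> and \<open>N\<close> linear, a
  dependence at the parameter \<open>s\<close> yields the eigenvalue \<open>1 / (1 - s)\<close> of \<open>N\<close>.
\<close>

lemma independent_family_pencil:
  fixes a b :: "'i \<Rightarrow> 'a::real_vector"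
  assumes I: "finite I" and ind: "independent_family I (\<lambda>i. a i + b i)"
  obtains s0 where "s0 > (0::real)" "\<And>s. 0 < s \<Longrightarrow> s < s0 \<Longrightarrow> independent_family I (\<lambda>i. a i + s *\<^sub>R b i)"
proof -
  define w where "w i = a i + b i" for i
  have w: "inj_on w I" "independent (w ` I)"
    using independent_family_imp[OF I ind] unfolding w_def by auto
  obtain N where N: "linear N" "\<And>x. x \<in> w ` I \<Longrightarrow> N x = b (inv_into I w x)"
    using linear_independent_extend[OF w(2), of "\<lambda>x. b (inv_into I w x)"] by blast
  have Nw: "N (w i) = b i" if "i \<in> I" for i using N(2)[of "w i"] that w(1) by simp
  define L where "L = {l. \<exists>x\<in>span (w ` I). x \<noteq> 0 \<and> N x = l *\<^sub>R x}"
  have "finite L" unfolding L_def using finite_eigenvalues[OF N(1), of "w ` I"] I by simp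
  \<comment> \<open>Solving \<open>l = 1 / (1 - s)\<close> for \<open>s\<close> gives the finitely
    many bad parameters. The parameter 0 may be among them; once it is removed, the others keep a
    positive distance from 0.\<close>
  then have "open (- ((\<lambda>l. 1 - 1 / l) ` L - {0}))"
    by (intro open_Compl finite_imp_closed) simp
  then obtain s1 where s1: "s1 > 0" "\<And>s. dist s 0 < s1 \<Longrightarrow> s \<in> - ((\<lambda>l. 1 - 1 / l) ` L - {0})"
    unfolding open_dist by (metis Compl_iff Diff_iff singletonI)
  show ?thesis
  proof (rule that[of "min s1 1"])
    fix s :: real assume s: "0 < s" "s < min s1 1"
    then have sL: "s \<notin> (\<lambda>l. 1 - 1 / l) ` L" using s1(2)[of s] by auto
    show "independent_family I (\<lambda>i. a i + s *\<^sub>R b i)" unfolding independent_family_def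
    proof (intro allI impI)
      fix c assume c: "(\<Sum>i\<in>I. c i *\<^sub>R (a i + s *\<^sub>R b i)) = 0"
      define x where "x = (\<Sum>i\<in>I. c i *\<^sub>R w i)"
      have Nx: "N x = (\<Sum>i\<in>I. c i *\<^sub>R b i)"
        unfolding x_def using Nw by (simp add: linear_sum[OF N(1)] linear_scale[OF N(1)])
      have "x + (s - 1) *\<^sub>R N x = (\<Sum>i\<in>I. c i *\<^sub>R (a i + s *\<^sub>R b i))"
        unfolding Nx unfolding x_def w_def
        by (simp add: scaleR_sum_right sum.distrib[symmetric] algebra_simps)
      then have "(1 - s) *\<^sub>R N x = x" using c by (simp add: algebra_simps)
      then have "(1 / (1 - s)) *\<^sub>R x = (1 / (1 - s)) *\<^sub>R (1 - s) *\<^sub>R N x" by simp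
      then have "N x = (1 / (1 - s)) *\<^sub>R x" using s by simp
      moreover have "x \<in> span (w ` I)" unfolding x_def by (auto intro: span_sum span_scale span_base)
      ultimately have "1 / (1 - s) \<in> L" if "x \<noteq> 0" using that unfolding L_def by blast
      then have "x \<noteq> 0 \<Longrightarrow> s \<in> (\<lambda>l. 1 - 1 / l) ` L"
        using s by (intro image_eqI[of _ _ "1 / (1 - s)"]) auto
      then have "x = 0" using sL by blast
      then show "\<forall>i\<in>I. c i = 0" using ind unfolding x_def w_def independent_family_def by blast
    qed
  qed (use s1 in auto)
qed

section \<open>The Mazur--Ulam theorem\<close>

definition norm_isometry :: "('a::real_normed_vector \<Rightarrow> 'b::real_normed_vector) \<Rightarrow> bool" where
  "norm_isometry f \<longleftrightarrow> (\<forall>x y. norm (f x - f y) = norm (x - y))"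

lemma norm_isometry_inj: "norm_isometry f \<Longrightarrow> inj f"
  unfolding norm_isometry_def inj_def by (metis eq_iff_diff_eq_0 norm_eq_zero)

lemma norm_isometry_continuous: "norm_isometry f \<Longrightarrow> continuous_on S f"
  unfolding norm_isometry_def continuous_on_iff dist_norm by metis

text \<open>Normalise the isometry to fix 0. A point \<open>x\<close> outside its range has distance
  at least some \<open>d > 0\<close> from the compact image of the ball through \<open>x\<close>.
  The orbit of \<open>x\<close> then stays in that ball with all its members at mutual distance at
  least \<open>d\<close>, so it has no Cauchy subsequence.\<close>

lemma norm_isometry_finite_dim_surj:
  fixes B :: "'a::real_normed_vector set" and f :: "'a \<Rightarrow> 'a"
  assumes B: "finite B" "span B = UNIV" and f: "norm_isometry f"
  shows "surj f"
proof -
  define g where "g x = f x - f 0" for x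
  have g: "norm (g x - g y) = norm (x - y)" for x y
    using f unfolding norm_isometry_def g_def by simp
  have g0: "norm (g x) = norm x" for x
    using g[of x 0] by (simp add: g_def)
  have "x \<in> range g" for x
  proof (rule ccontr)
    assume x: "x \<notin> range g"
    define K where "K = cball (0::'a) (norm x)"
    have K: "compact K" unfolding K_def by (rule compact_cball_finite_dim[OF B])
    have "continuous_on K g"
      by (rule norm_isometry_continuous) (simp add: norm_isometry_def g)
    then have "closed (g ` K)" using K by (intro compact_imp_closed compact_continuous_image)
    then have "open (- (g ` K))" "x \<in> - (g ` K)" using x by auto
    then obtain d where d: "d > 0" "\<And>y. dist y x < d \<Longrightarrow> y \<notin> g ` K"
      unfolding open_dist by blast
    define s where "s n = (g ^^ n) x" for n
    have sn: "norm (s n) = norm x" for n by (induction n) (auto simp: s_def g0)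
    have diff: "norm (s (n + k) - s n) = norm (s k - x)" for n k
      by (induction n) (auto simp: s_def g)
    have apart: "d \<le> norm (s (Suc k) - x)" for k
    proof -
      have "s (Suc k) \<in> g ` K" using sn[of k] by (auto simp: s_def K_def)
      then show ?thesis using d(2)[of "s (Suc k)"] by (force simp: dist_norm)
    qed
    have "\<forall>n. s n \<in> K" using sn by (simp add: K_def)
    then obtain l r where lr: "strict_mono (r :: nat \<Rightarrow> nat)" "(s \<circ> r) \<longlonglongrightarrow> l"
      using K unfolding compact_eq_seq_compact_metric seq_compact_def by metis
    then have "Cauchy (s \<circ> r)" by (intro LIMSEQ_imp_Cauchy)
    then obtain N where N: "\<And>m n. m \<ge> N \<Longrightarrow> n \<ge> N \<Longrightarrow> norm ((s \<circ> r) m - (s \<circ> r) n) < d"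
      using d(1) unfolding Cauchy_iff by blast
    have "r N < r (Suc N)" using lr(1) by (simp add: strict_mono_Suc_iff)
    then obtain k where "r (Suc N) = r N + Suc k" by (metis less_iff_Suc_add add_Suc_right)
    then have "norm (s (Suc k) - x) < d" using N[of "Suc N" N] diff[of "r N" "Suc k"] by simp
    then show False using apart[of k] by simp
  qed
  then have "\<exists>z. y - f 0 = g z" for y by blast
  then show ?thesis unfolding g_def surj_def by (metis diff_add_cancel)
qed

text \<open>
  Vaisala's proof of the Mazur--Ulam theorem: conjugating with the point reflection in the
  midpoint doubles the displacement of the midpoint.
\<close>

lemma surj_isometry_fixes_midpoint:
  fixes g :: "'a::real_normed_vector \<Rightarrow> 'a"
  assumes "norm_isometry g" "surj g" "g a = a" "g b = b"
  shows "g ((1/2) *\<^sub>R (a + b)) = (1/2) *\<^sub>R (a + b)"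
proof -
  define z where "z = (1/2) *\<^sub>R (a + b)"
  define \<psi> where "\<psi> x = a + b - x" for x
  have \<psi>: "\<psi> (\<psi> x) = x" "norm (\<psi> x - \<psi> y) = norm (x - y)" for x y
    by (auto simp: \<psi>_def norm_minus_commute)
  have z2: "a + b = 2 *\<^sub>R z" by (simp add: z_def)
  have \<psi>z: "\<psi> z = z" unfolding \<psi>_def z2 by (simp add: scaleR_2)
  have \<psi>ab: "\<psi> a = b" "\<psi> b = a" by (auto simp: \<psi>_def)
  have "2 ^ n * norm (g z - z) \<le> 2 * norm (a - z)"
    if "norm_isometry g" "surj g" "g a = a" "g b = b" for n g
    using that
  proof (induction n arbitrary: g)
    case 0
    have "norm (g z - z) \<le> norm (g z - g a) + norm (a - z)"
      using 0 norm_triangle_ineq[of "g z - g a" "a - z"] by simp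
    also have "norm (g z - g a) = norm (a - z)"
      using 0(1) by (simp add: norm_isometry_def norm_minus_commute)
    finally show ?case by simp
  next
    case (Suc n)
    have inj: "inj g" using Suc.prems norm_isometry_inj by blast
    have invg: "g (inv g x) = x" "inv g (g x) = x" for x
      using Suc.prems(2) inj by (auto simp: surj_f_inv_f)
    have inv_iso: "norm (inv g x - inv g y) = norm (x - y)" for x y
      using Suc.prems(1) invg unfolding norm_isometry_def by metis
    define h where "h x = \<psi> (inv g (\<psi> (g x)))" for x
    have "norm_isometry h"
      using Suc.prems(1) by (simp add: norm_isometry_def h_def \<psi> inv_iso)
    moreover have "surj h"
    proof (rule surjI)
      show "h (inv g (\<psi> (g (\<psi> x)))) = x" for x by (simp add: h_def invg \<psi>)
    qed
    moreover have "h a = a" "h b = b"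
      using Suc.prems(3,4) invg(2)[of a] invg(2)[of b] by (simp_all add: h_def \<psi>ab)
    ultimately have "2 ^ n * norm (h z - z) \<le> 2 * norm (a - z)" by (rule Suc.IH)
    moreover have "norm (h z - z) = 2 * norm (g z - z)"
    proof -
      have "norm (h z - z) = norm (\<psi> (inv g (\<psi> (g z))) - \<psi> z)" by (simp add: h_def \<psi>z)
      also have "\<dots> = norm (inv g (\<psi> (g z)) - inv g (g z))" by (simp add: \<psi> invg)
      also have "\<dots> = norm (\<psi> (g z) - g z)" by (rule inv_iso)
      also have "\<psi> (g z) - g z = - 2 *\<^sub>R (g z - z)"
        unfolding \<psi>_def z2 by (simp add: scaleR_2 algebra_simps)
      finally show ?thesis by simp
    qed
    ultimately show ?case by simp
  qed
  then have le: "2 ^ n * norm (g z - z) \<le> 2 * norm (a - z)" for n using assms by blast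
  have "norm (g z - z) = 0"
  proof (rule ccontr)
    assume "norm (g z - z) \<noteq> 0"
    then have pos: "norm (g z - z) > 0" by simp
    obtain n where "2 * norm (a - z) / norm (g z - z) < 2 ^ n"
      using real_arch_pow[of 2] by auto
    then show False using le[of n] pos by (simp add: field_simps)
  qed
  then show ?thesis by (simp add: z_def)
qed

text \<open>Conjugating the reflection in the midpoint of \<open>f a\<close> and \<open>f b\<close>
  by \<open>f\<close>, and following it by the reflection in the midpoint of \<open>a\<close> and
  \<open>b\<close>, gives a surjective isometry \<open>h\<close> that fixes \<open>a\<close> and
  \<open>b\<close>, hence their midpoint.\<close>

lemma mazur_ulam_midpoint:
  fixes f :: "'a::real_normed_vector \<Rightarrow> 'b::real_normed_vector"
  assumes f: "norm_isometry f" "surj f"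
  shows "f ((1/2) *\<^sub>R (a + b)) = (1/2) *\<^sub>R (f a + f b)"
proof -
  have inj: "inj f" using f norm_isometry_inj by blast
  have invf: "f (inv f x) = x" "inv f (f y) = y" for x y
    using f(2) inj by (auto simp: surj_f_inv_f)
  have inv_iso: "norm (inv f x - inv f y) = norm (x - y)" for x y
    using f(1) invf unfolding norm_isometry_def by metis
  define z where "z = (1/2) *\<^sub>R (a + b)"
  have z2: "a + b = 2 *\<^sub>R z" by (simp add: z_def)
  define h where "h x = a + b - inv f (f a + f b - f x)" for x
  have "norm_isometry h"
    using f(1) by (simp add: norm_isometry_def h_def inv_iso norm_minus_commute)
  moreover have "surj h"
  proof (rule surjI)
    show "h (inv f (f a + f b - f (a + b - x))) = x" for x by (simp add: h_def invf)
  qed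
  moreover have "h a = a" "h b = b" by (simp_all add: h_def invf)
  ultimately have "h z = z" unfolding z_def by (rule surj_isometry_fixes_midpoint)
  then have "inv f (f a + f b - f z) = z" unfolding h_def z2 by (simp add: scaleR_2 algebra_simps)
  then have "f a + f b - f z = f z" by (metis invf(1))
  then have "f a + f b = 2 *\<^sub>R f z" by (simp add: scaleR_2 algebra_simps)
  then show ?thesis by (simp add: z_def)
qed

text \<open>Preservation of midpoints gives additivity and homogeneity over the integers. For real
  \<open>s\<close>, the number \<open>n * s\<close> differs from an integer by some \<open>e\<close>
  between 0 and 1, so \<open>n\<close> times the defect of homogeneity at \<open>s\<close> equals
  the defect at \<open>e\<close>, which is at most \<open>2 * norm x\<close>. As \<open>n\<close> is
  arbitrary, the defect is 0.\<close>

lemma mazur_ulam: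
  fixes f :: "'a::real_normed_vector \<Rightarrow> 'b::real_normed_vector"
  assumes f: "norm_isometry f" "surj f"
  shows "linear (\<lambda>x. f x - f 0)"
proof -
  define g where "g x = f x - f 0" for x
  have half: "g ((1/2) *\<^sub>R (x + y)) = (1/2) *\<^sub>R (g x + g y)" for x y
    unfolding g_def mazur_ulam_midpoint[OF f] by (simp add: algebra_simps flip: scaleR_add_left)
  have g0: "g 0 = 0" by (simp add: g_def)
  have norm_g: "norm (g x) = norm x" for x
    using f(1) by (simp add: norm_isometry_def g_def)
  have g_half: "g ((1/2) *\<^sub>R x) = (1/2) *\<^sub>R g x" for x using half[of x 0] g0 by simp
  have add: "g (x + y) = g x + g y" for x y
    using half[of x y] g_half[of "x + y"] by simp
  have neg: "g (- x) = - g x" for x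
    using add[of x "- x"] g0 by (simp add: add_eq_0_iff)
  have nat: "g (real n *\<^sub>R x) = real n *\<^sub>R g x" for n x
    by (induction n) (auto simp: g0 add scaleR_add_left)
  have int: "g (real_of_int k *\<^sub>R x) = real_of_int k *\<^sub>R g x" for k x
    by (cases k rule: int_cases2) (auto simp: nat neg)
  have scale: "g (s *\<^sub>R x) = s *\<^sub>R g x" for s x
  proof (rule ccontr)
    assume "g (s *\<^sub>R x) \<noteq> s *\<^sub>R g x"
    then have pos: "norm (g (s *\<^sub>R x) - s *\<^sub>R g x) > 0" by simp
    have le: "real n * norm (g (s *\<^sub>R x) - s *\<^sub>R g x) \<le> 2 * norm x" for n
    proof -
      define k where "k = \<lfloor>real n * s\<rfloor>"
      define e where "e = real n * s - real_of_int k"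
      have e: "0 \<le> e" "e \<le> 1" unfolding e_def k_def by linarith+
      have ns: "real n * s = real_of_int k + e" by (simp add: e_def)
      have "real n *\<^sub>R (g (s *\<^sub>R x) - s *\<^sub>R g x) = g ((real n * s) *\<^sub>R x) - (real n * s) *\<^sub>R g x"
        using nat[of n "s *\<^sub>R x"] by (simp add: scaleR_diff_right)
      also have "\<dots> = g (e *\<^sub>R x) - e *\<^sub>R g x"
        unfolding ns by (simp add: scaleR_add_left add int)
      finally have "real n * norm (g (s *\<^sub>R x) - s *\<^sub>R g x) = norm (g (e *\<^sub>R x) - e *\<^sub>R g x)"
        by (metis abs_of_nat norm_scaleR)
      also have "\<dots> \<le> norm (g (e *\<^sub>R x)) + norm (e *\<^sub>R g x)" by (rule norm_triangle_ineq4)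
      also have "\<dots> = 2 * (e * norm x)" using e by (simp add: norm_g)
      also have "\<dots> \<le> 2 * norm x" using e by (simp add: mult_left_le_one_le)
      finally show ?thesis .
    qed
    obtain n where "2 * norm x < real n * norm (g (s *\<^sub>R x) - s *\<^sub>R g x)"
      using reals_Archimedean3[OF pos] by blast
    then show False using le[of n] by simp
  qed
  show ?thesis using add scale unfolding g_def by (intro linearI) auto
qed

section \<open>Infinitesimal rigid motions\<close>

lemma cylinder_simps [simp]:
  "base (0 :: 'a::real_vector cylinder) = 0" "height (0 :: 'a cylinder) = 0"
  "base (a + b :: 'a cylinder) = base a + base b" "height (a + b :: 'a cylinder) = height a + height b"
  "base (a - b :: 'a cylinder) = base a - base b" "height (a - b :: 'a cylinder) = height a - height b"
  "base (r *\<^sub>R a :: 'a cylinder) = r *\<^sub>R base a" "height (r *\<^sub>R a :: 'a cylinder) = r * height a"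
  by (simp_all add: zero_cylinder_def plus_cylinder_def minus_cylinder_def scaleR_cylinder_def)

lemma norm_Cyl: "norm (Cyl x y) = max (norm x) \<bar>y\<bar>"
  by (simp add: norm_cylinder_def)

lemma bounded_linear_base: "bounded_linear (base :: 'a::real_normed_vector cylinder \<Rightarrow> 'a)"
  by (rule bounded_linear_intro[where K = 1]) (auto simp: norm_cylinder_def)

lemma bounded_linear_height: "bounded_linear (height :: 'a::real_normed_vector cylinder \<Rightarrow> real)"
  by (rule bounded_linear_intro[where K = 1]) (auto simp: norm_cylinder_def)

lemma bounded_linear_Cyl_base: "bounded_linear (\<lambda>x :: 'a::real_normed_vector. Cyl x 0)"
  by (rule bounded_linear_intro[where K = 1]) (auto simp: norm_Cyl intro: cylinder.expand)

lemma bounded_linear_Cyl_height: "bounded_linear (\<lambda>y. Cyl (0 :: 'a::real_normed_vector) y)"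
  by (rule bounded_linear_intro[where K = 1]) (auto simp: norm_Cyl intro: cylinder.expand)

lemma Cyl_split: "Cyl x y = Cyl x 0 + Cyl 0 (y :: real)" for x :: "'a::real_vector"
  by (rule cylinder.expand) simp

lemma has_vector_derivative_Cyl:
  fixes f :: "real \<Rightarrow> 'a::real_normed_vector"
  assumes "(f has_vector_derivative f') F" "(g has_vector_derivative g') F"
  shows "((\<lambda>t. Cyl (f t) (g t)) has_vector_derivative Cyl f' g') F"
  unfolding Cyl_split[of "f _" "g _"] Cyl_split[of f' g']
  by (intro has_vector_derivative_add bounded_linear.has_vector_derivative[OF bounded_linear_Cyl_base]
      bounded_linear.has_vector_derivative[OF bounded_linear_Cyl_height] assms)

lemma continuous_on_Cyl:
  fixes f :: "'b::topological_space \<Rightarrow> 'a::real_normed_vector"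
  assumes "continuous_on S f" "continuous_on S g"
  shows "continuous_on S (\<lambda>t. Cyl (f t) (g t))"
  unfolding Cyl_split[of "f _" "g _"]
  by (intro continuous_on_add bounded_linear.continuous_on[OF bounded_linear_Cyl_base]
      bounded_linear.continuous_on[OF bounded_linear_Cyl_height] assms)

lemma cylinder_spanning_set:
  fixes B :: "'a::real_normed_vector set"
  assumes "finite B" "span B = UNIV"
  defines "C \<equiv> insert (Cyl 0 1) ((\<lambda>b. Cyl b 0) ` B)"
  shows "finite C" "span C = UNIV"
proof -
  show "finite C" using assms by simp
  have "z \<in> span C" for z
  proof -
    have "Cyl (base z) 0 \<in> span ((\<lambda>b. Cyl b 0) ` B)"
      using linear_span_image[OF bounded_linear.linear[OF bounded_linear_Cyl_base], of B] assms(2) by auto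
    then have "Cyl (base z) 0 \<in> span C" unfolding C_def by (meson span_mono subset_insertI subsetD)
    moreover have "height z *\<^sub>R Cyl 0 1 \<in> span C"
      unfolding C_def by (intro span_scale span_base) simp
    moreover have "z = Cyl (base z) 0 + height z *\<^sub>R Cyl 0 1" by (rule cylinder.expand) simp
    ultimately show ?thesis by (metis span_add)
  qed
  then show "span C = UNIV" by blast
qed

lemma motion_isometry: "rigid_motion \<alpha> \<Longrightarrow> t \<in> {-1..1} \<Longrightarrow> norm_isometry (\<lambda>x. \<alpha> x t)"
  unfolding rigid_motion_def norm_isometry_def by blast

lemma motion_linear:
  fixes B :: "'a::real_normed_vector set"
  assumes "finite B" "span B = UNIV" "rigid_motion (\<alpha> :: 'a \<Rightarrow> real \<Rightarrow> 'a)" "t \<in> {-1..1}"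
  shows "linear (\<lambda>x. \<alpha> x t - \<alpha> 0 t)"
proof -
  have iso: "norm_isometry (\<lambda>x. \<alpha> x t)" using motion_isometry assms by blast
  show ?thesis
    by (rule mazur_ulam[OF iso norm_isometry_finite_dim_surj[OF assms(1,2) iso]])
qed

text \<open>By Mazur--Ulam every map \<open>x \<mapsto> \<alpha> x t - \<alpha> 0 t\<close> is
  linear, and differentiation at \<open>t = 0\<close> preserves the linear identities between the
  paths.\<close>

lemma infinitesimal_rigid_motion_linear:
  fixes B :: "'a::real_normed_vector set"
  assumes B: "finite B" "span B = UNIV" and \<eta>: "\<eta> \<in> infinitesimal_rigid_motions"
  shows "linear (\<lambda>x :: 'a. \<eta> x - \<eta> 0)"
proof -
  obtain \<alpha> where \<alpha>: "rigid_motion \<alpha>"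
    "\<And>x. (\<alpha> x has_vector_derivative \<eta> x) (at 0 within {-1..1})"
    using \<eta> unfolding infinitesimal_rigid_motions_def by blast
  have lin: "linear (\<lambda>x. \<alpha> x t - \<alpha> 0 t)" if "t \<in> {-1..1}" for t
    using motion_linear[OF B \<alpha>(1) that] .
  have unique: "u = v" if "(f has_vector_derivative u) (at 0 within {-1..1})"
    "(g has_vector_derivative v) (at 0 within {-1..1})" "\<And>t. t \<in> {-1..1} \<Longrightarrow> f t = g t"
    for f g :: "real \<Rightarrow> 'a" and u v
  proof -
    have "(g has_vector_derivative u) (at 0 within {-1..1})"
      by (rule has_vector_derivative_transform[OF _ _ that(1)]) (use that(3) in auto)
    then show ?thesis
      using vector_derivative_unique_within_closed_interval[of "-1" 1 0 g u v] that(2) by simp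
  qed
  show ?thesis
  proof (rule linearI)
    fix x y
    have "\<eta> (x + y) - \<eta> 0 = (\<eta> x - \<eta> 0) + (\<eta> y - \<eta> 0)"
    proof (rule unique)
      show "((\<lambda>t. \<alpha> (x + y) t - \<alpha> 0 t) has_vector_derivative \<eta> (x + y) - \<eta> 0) (at 0 within {-1..1})"
        by (intro has_vector_derivative_diff \<alpha>)
      show "((\<lambda>t. (\<alpha> x t - \<alpha> 0 t) + (\<alpha> y t - \<alpha> 0 t)) has_vector_derivative (\<eta> x - \<eta> 0) + (\<eta> y - \<eta> 0)) (at 0 within {-1..1})"
        by (intro has_vector_derivative_diff has_vector_derivative_add \<alpha>)
    qed (rule linear_add[OF lin])
    then show "\<eta> (x + y) - \<eta> 0 = (\<eta> x - \<eta> 0) + (\<eta> y - \<eta> 0)" .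
  next
    fix r x
    show "\<eta> (r *\<^sub>R x) - \<eta> 0 = r *\<^sub>R (\<eta> x - \<eta> 0)"
    proof (rule unique)
      show "((\<lambda>t. \<alpha> (r *\<^sub>R x) t - \<alpha> 0 t) has_vector_derivative \<eta> (r *\<^sub>R x) - \<eta> 0) (at 0 within {-1..1})"
        by (intro has_vector_derivative_diff \<alpha>)
      show "((\<lambda>t. r *\<^sub>R (\<alpha> x t - \<alpha> 0 t)) has_vector_derivative r *\<^sub>R (\<eta> x - \<eta> 0)) (at 0 within {-1..1})"
        by (intro bounded_linear.has_vector_derivative[OF bounded_linear_scaleR_right]
            has_vector_derivative_diff \<alpha>)
    qed (rule linear_scale[OF lin])
  qed
qed

text \<open>Only the germ at time 0 matters. This admits motions that are known to be isometric for
  short times only, as after a change of speed or after restriction to times near the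
  identity.\<close>

lemma infinitesimal_rigid_motion_if_local:
  fixes \<beta> :: "'a::real_normed_vector \<Rightarrow> real \<Rightarrow> 'a"
  assumes e: "e > 0"
    and cont: "\<And>x. continuous_on {-e..e} (\<beta> x)"
    and start: "\<And>x. \<beta> x 0 = x"
    and iso: "\<And>x y t. \<bar>t\<bar> \<le> e \<Longrightarrow> norm (\<beta> x t - \<beta> y t) = norm (x - y)"
    and deriv: "\<And>x. (\<beta> x has_vector_derivative \<eta> x) (at 0)"
  shows "\<eta> \<in> infinitesimal_rigid_motions"
proof -
  \<comment> \<open>Clamping the time freezes the motion outside \<open>{-e..e}\<close>: it stays
    continuous and isometric, and is unchanged near 0.\<close>
  define c where "c t = max (-e) (min e t)" for t :: real
  have c: "c t \<in> {-e..e}" for t using e by (auto simp: c_def)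
  have contc: "continuous_on S c" for S unfolding c_def by (intro continuous_intros)
  have derivc: "((\<lambda>t. \<beta> x (c t)) has_vector_derivative \<eta> x) (at 0 within {-1..1})" for x
  proof -
    have "((\<lambda>t. \<beta> x (c t)) has_vector_derivative \<eta> x) (at 0)"
      by (rule has_vector_derivative_transform_within_open[OF deriv, of "{-e<..<e}"]) (use e in \<open>auto simp: c_def\<close>)
    then show ?thesis by (rule has_vector_derivative_at_within)
  qed
  have "rigid_motion (\<lambda>x t. \<beta> x (c t))"
    unfolding rigid_motion_def
  proof (intro conjI allI ballI)
    fix x
    show "continuous_on {-1..1} (\<lambda>t. \<beta> x (c t))"
      by (rule continuous_on_compose2[OF cont contc]) (use c in auto)
    show "\<beta> x (c 0) = x" using e by (simp add: c_def start)
    show "(\<lambda>t. \<beta> x (c t)) differentiable at 0 within {-1..1}"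
      using derivc[of x] unfolding has_vector_derivative_def by (rule differentiableI)
  next
    fix x y t
    have "\<bar>c t\<bar> \<le> e" using c[of t] by auto
    then show "norm (\<beta> x (c t) - \<beta> y (c t)) = norm (x - y)" by (rule iso)
  qed
  then show ?thesis unfolding infinitesimal_rigid_motions_def using derivc by blast
qed

lemma infinitesimal_rigid_motionE:
  assumes "\<eta> \<in> infinitesimal_rigid_motions"
  obtains \<alpha> where "rigid_motion \<alpha>" "\<And>x. (\<alpha> x has_vector_derivative \<eta> x) (at 0)"
    "\<And>x. continuous_on {-1..1} (\<alpha> x)" "\<And>x. \<alpha> x 0 = x"
    "\<And>x y t. \<bar>t\<bar> \<le> 1 \<Longrightarrow> norm (\<alpha> x t - \<alpha> y t) = norm (x - y)"
proof -
  obtain \<alpha> where \<alpha>: "rigid_motion \<alpha>"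
    "\<And>x. (\<alpha> x has_vector_derivative \<eta> x) (at 0 within {-1..1})"
    using assms unfolding infinitesimal_rigid_motions_def by blast
  have "at (0::real) within {-1..1} = at 0" by (rule at_within_Icc_at) auto
  then have "(\<alpha> x has_vector_derivative \<eta> x) (at 0)" for x using \<alpha>(2)[of x] by simp
  then show ?thesis using that[of \<alpha>] \<alpha>(1) unfolding rigid_motion_def by (auto simp: abs_le_iff)
qed

lemma translation_infinitesimal_rigid_motion:
  "(\<lambda>x. c) \<in> (infinitesimal_rigid_motions :: ('a::real_normed_vector \<Rightarrow> 'a) set)"
proof (rule infinitesimal_rigid_motion_if_local[where e = 1 and \<beta> = "\<lambda>x t. x + t *\<^sub>R c"])
  fix x
  show "((\<lambda>t. x + t *\<^sub>R c) has_vector_derivative c) (at 0)"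
    by (auto intro!: derivative_eq_intros)
qed (auto intro!: continuous_intros)

text \<open>The motion is run at speed \<open>r\<close>, which is possible for times up to
  \<open>1 / \<bar>r\<bar>\<close>. For \<open>r = 0\<close> a constant motion takes its
  place.\<close>

lemma infinitesimal_rigid_motion_scale:
  assumes "\<eta> \<in> infinitesimal_rigid_motions"
  shows "(\<lambda>x :: 'a::real_normed_vector. r *\<^sub>R \<eta> x) \<in> infinitesimal_rigid_motions"
proof (cases "r = 0")
  case True
  then show ?thesis using translation_infinitesimal_rigid_motion[of "0 :: 'a"] by simp
next
  case False
  obtain \<alpha> where \<alpha>: "\<And>x. (\<alpha> x has_vector_derivative \<eta> x) (at 0)"
    "\<And>x. continuous_on {-1..1} (\<alpha> x)" "\<And>x. \<alpha> x 0 = x"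
    "\<And>x y t. \<bar>t\<bar> \<le> 1 \<Longrightarrow> norm (\<alpha> x t - \<alpha> y t) = norm (x - y)"
    using infinitesimal_rigid_motionE[OF assms] by metis
  have small: "\<bar>r * t\<bar> \<le> 1" if "\<bar>t\<bar> \<le> 1 / \<bar>r\<bar>" for t
    using that False by (simp add: abs_mult field_simps)
  show ?thesis
  proof (rule infinitesimal_rigid_motion_if_local[where e = "1 / \<bar>r\<bar>" and \<beta> = "\<lambda>x t. \<alpha> x (r * t)"])
    fix x
    show "continuous_on {-(1 / \<bar>r\<bar>)..1 / \<bar>r\<bar>} (\<lambda>t. \<alpha> x (r * t))"
    proof (rule continuous_on_compose2[OF \<alpha>(2)])
      show "(*) r ` {-(1 / \<bar>r\<bar>)..1 / \<bar>r\<bar>} \<subseteq> {-1..1}"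
        using small by (force simp: abs_le_iff)
    qed (intro continuous_intros)
    have "((*) r has_vector_derivative r) (at 0)"
      unfolding has_real_derivative_iff_has_vector_derivative[symmetric]
      by (auto intro!: derivative_eq_intros)
    then have "((\<lambda>t. \<alpha> x (r * t)) has_vector_derivative r *\<^sub>R \<eta> x) (at 0)"
      using vector_diff_chain_at[of "\<lambda>t. r * t" r 0 "\<alpha> x" "\<eta> x"] \<alpha>(1)[of x]
      by (simp add: o_def)
    then show "((\<lambda>t. \<alpha> x (r * t)) has_vector_derivative r *\<^sub>R \<eta> x) (at 0)" .
  qed (use False \<alpha> small in auto)
qed

text \<open>The composition \<open>\<alpha> (\<beta> x t) t\<close> has the required derivative. A
  chain rule would ask for differentiability of \<open>\<alpha>\<close> jointly in point and time;
  instead the proof uses that \<open>\<alpha>\<close> is, at each time, an affine isometry.\<close>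

lemma infinitesimal_rigid_motion_add:
  fixes B :: "'a::real_normed_vector set"
  assumes B: "finite B" "span B = UNIV"
    and \<eta>: "\<eta> \<in> infinitesimal_rigid_motions" and \<xi>: "\<xi> \<in> infinitesimal_rigid_motions"
  shows "(\<lambda>x :: 'a. \<eta> x + \<xi> x) \<in> infinitesimal_rigid_motions"
proof -
  obtain \<alpha> where \<alpha>: "rigid_motion \<alpha>" "\<And>x. (\<alpha> x has_vector_derivative \<eta> x) (at 0)"
    "\<And>x. continuous_on {-1..1} (\<alpha> x)" "\<And>x. \<alpha> x 0 = x"
    "\<And>x y t. \<bar>t\<bar> \<le> 1 \<Longrightarrow> norm (\<alpha> x t - \<alpha> y t) = norm (x - y)"
    using infinitesimal_rigid_motionE[OF \<eta>] by metis
  obtain \<beta> where \<beta>: "\<And>x. (\<beta> x has_vector_derivative \<xi> x) (at 0)"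
    "\<And>x. continuous_on {-1..1} (\<beta> x)" "\<And>x. \<beta> x 0 = x"
    "\<And>x y t. \<bar>t\<bar> \<le> 1 \<Longrightarrow> norm (\<beta> x t - \<beta> y t) = norm (x - y)"
    using infinitesimal_rigid_motionE[OF \<xi>] by metis
  show ?thesis
  proof (rule infinitesimal_rigid_motion_if_local[where e = 1 and \<beta> = "\<lambda>x t. \<alpha> (\<beta> x t) t"])
    fix x
    show "continuous_on {-1..1} (\<lambda>t. \<alpha> (\<beta> x t) t)"
      unfolding continuous_on_def
    proof
      fix s :: real assume s: "s \<in> {-1..1}"
      have lim: "((\<lambda>t. norm (\<beta> x t - \<beta> x s) + norm (\<alpha> (\<beta> x s) t - \<alpha> (\<beta> x s) s)) \<longlongrightarrow> 0) (at s within {-1..1})"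
        using \<beta>(2)[of x] \<alpha>(3)[of "\<beta> x s"] s
        by (intro tendsto_add_zero tendsto_norm_zero LIM_zero) (auto simp: continuous_on_def)
      have "((\<lambda>t. \<alpha> (\<beta> x t) t - \<alpha> (\<beta> x s) s) \<longlongrightarrow> 0) (at s within {-1..1})"
      proof (rule Lim_null_comparison[OF _ lim])
        have "norm (\<alpha> (\<beta> x t) t - \<alpha> (\<beta> x s) s) \<le> norm (\<beta> x t - \<beta> x s) + norm (\<alpha> (\<beta> x s) t - \<alpha> (\<beta> x s) s)"
          if "t \<in> {-1..1}" for t
        proof -
          have "norm (\<alpha> (\<beta> x t) t - \<alpha> (\<beta> x s) t) = norm (\<beta> x t - \<beta> x s)"
            using that by (intro \<alpha>(5)) auto
          then show ?thesis
            using norm_triangle_ineq[of "\<alpha> (\<beta> x t) t - \<alpha> (\<beta> x s) t" "\<alpha> (\<beta> x s) t - \<alpha> (\<beta> x s) s"] by simp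
        qed
        then show "\<forall>\<^sub>F t in at s within {-1..1}. norm (\<alpha> (\<beta> x t) t - \<alpha> (\<beta> x s) s) \<le> norm (\<beta> x t - \<beta> x s) + norm (\<alpha> (\<beta> x s) t - \<alpha> (\<beta> x s) s)"
          by (auto simp: eventually_at intro: exI[of _ 1])
      qed
      then show "((\<lambda>t. \<alpha> (\<beta> x t) t) \<longlongrightarrow> \<alpha> (\<beta> x s) s) (at s within {-1..1})" by (rule LIM_zero_cancel)
    qed
    show "\<alpha> (\<beta> x 0) 0 = x" by (simp add: \<alpha> \<beta>)
    define w where "w = \<xi> x"
    \<comment> \<open>By linearity \<open>f t\<close> is
      \<open>\<alpha> (x + t *\<^sub>R w) t\<close>, the composition with \<open>\<beta> x t\<close>
      replaced by its first-order approximation. The isometry \<open>\<alpha>\<close> preserves the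
      error of that approximation, so the remainder \<open>r\<close> has derivative 0.\<close>
    define f where "f t = \<alpha> x t + t *\<^sub>R (\<alpha> w t - \<alpha> 0 t)" for t
    define r where "r t = \<alpha> (\<beta> x t) t - f t" for t
    have f: "(f has_vector_derivative \<eta> x + w) (at 0)"
    proof -
      have "((\<lambda>t. t *\<^sub>R (\<alpha> w t - \<alpha> 0 t)) has_vector_derivative 0 *\<^sub>R (\<eta> w - \<eta> 0) + 1 *\<^sub>R (\<alpha> w 0 - \<alpha> 0 0)) (at 0)"
        by (intro has_vector_derivative_scaleR DERIV_ident has_vector_derivative_diff \<alpha>(2))
      from has_vector_derivative_add[OF \<alpha>(2)[of x] this] show ?thesis
        by (simp add: f_def[abs_def] \<alpha>(4))
    qed
    have nr: "norm (r t) = norm (\<beta> x t - (x + t *\<^sub>R w))" if "\<bar>t\<bar> \<le> 1" for t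
    proof -
      have "t \<in> {-1..1}" using that by (simp only: atLeastAtMost_iff) linarith
      then have "linear (\<lambda>x. \<alpha> x t - \<alpha> 0 t)" by (rule motion_linear[OF B \<alpha>(1)])
      from linear_add[OF this, of x "t *\<^sub>R w"] linear_scale[OF this, of t w]
      have "f t = \<alpha> (x + t *\<^sub>R w) t" by (simp add: f_def algebra_simps)
      then show ?thesis using \<alpha>(5)[OF that] by (simp add: r_def)
    qed
    have r0: "r 0 = 0" by (simp add: r_def f_def \<alpha> \<beta>)
    have "((\<lambda>t. \<beta> x t - (x + t *\<^sub>R w)) has_vector_derivative w - w) (at 0)"
      using \<beta>(1)[of x] unfolding w_def
      by (rule has_vector_derivative_diff) (auto intro!: derivative_eq_intros)
    then have "((\<lambda>t. norm (\<beta> x t - (x + t *\<^sub>R w)) / \<bar>t\<bar>) \<longlongrightarrow> 0) (at 0)"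
      unfolding has_vector_derivative_def has_derivative_iff_norm by (simp add: \<beta>(3))
    then have "((\<lambda>t. norm (r t) / \<bar>t\<bar>) \<longlongrightarrow> 0) (at 0)"
      by (rule Lim_transform_eventually) (auto simp: eventually_at nr dist_norm intro!: exI[of _ 1])
    then have "(r has_vector_derivative 0) (at 0)"
      unfolding has_vector_derivative_def has_derivative_iff_norm by (simp add: r0)
    then have "((\<lambda>t. f t + r t) has_vector_derivative (\<eta> x + w) + 0) (at 0)"
      by (intro has_vector_derivative_add f)
    then show "((\<lambda>t. \<alpha> (\<beta> x t) t) has_vector_derivative \<eta> x + \<xi> x) (at 0)"
      by (simp add: r_def w_def)
  qed (simp_all add: \<alpha> \<beta>)
qed

section \<open>Rigid motions of the cylinder\<close>

lemma cylinder_rigid_motion: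
  fixes \<eta> :: "'a::real_normed_vector \<Rightarrow> 'a"
  assumes "\<eta> \<in> infinitesimal_rigid_motions"
  shows "(\<lambda>z. Cyl (\<eta> (base z)) c) \<in> infinitesimal_rigid_motions"
proof -
  obtain \<alpha> where \<alpha>: "\<And>x. (\<alpha> x has_vector_derivative \<eta> x) (at 0)"
    "\<And>x. continuous_on {-1..1} (\<alpha> x)" "\<And>x. \<alpha> x 0 = x"
    "\<And>x y t. \<bar>t\<bar> \<le> 1 \<Longrightarrow> norm (\<alpha> x t - \<alpha> y t) = norm (x - y)"
    using infinitesimal_rigid_motionE[OF assms] by metis
  show ?thesis
  proof (rule infinitesimal_rigid_motion_if_local[where e = 1 and
        \<beta> = "\<lambda>z t. Cyl (\<alpha> (base z) t) (height z + t * c)"])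
    fix z
    show "continuous_on {-1..1} (\<lambda>t. Cyl (\<alpha> (base z) t) (height z + t * c))"
      by (intro continuous_on_Cyl \<alpha> continuous_intros)
    have "((\<lambda>t. height z + t * c) has_vector_derivative c) (at 0)"
      unfolding has_real_derivative_iff_has_vector_derivative[symmetric]
      by (auto intro!: derivative_eq_intros)
    then show "((\<lambda>t. Cyl (\<alpha> (base z) t) (height z + t * c)) has_vector_derivative Cyl (\<eta> (base z)) c) (at 0)"
      by (intro has_vector_derivative_Cyl \<alpha>)
  qed (simp_all add: \<alpha> norm_cylinder_def)
qed

text \<open>
  Near the identity a linear isometry \<open>L\<close> maps the cone of vectors whose norm is their height to
  itself, so it preserves heights; hence it restricts to a linear isometry \<open>A\<close> of the base.
  Surjectivity of \<open>A\<close> forces \<open>L (Cyl 0 1) = Cyl 0 1\<close>, as otherwise \<open>L\<close> would enlarge the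
  norm of a vector \<open>Cyl x 1\<close> with \<open>norm x = 1\<close>.
\<close>

lemma cylinder_isometry_near_identity:
  fixes B :: "'a::real_normed_vector set" and L :: "'a cylinder \<Rightarrow> 'a cylinder"
  defines "u \<equiv> \<lambda>b. Cyl (inverse (2 * (norm b + 1)) *\<^sub>R b) 1"
  assumes B: "finite B" "span B = UNIV"
    and L: "linear L" "\<And>z. norm (L z) = norm z"
    and near: "\<And>b. b \<in> insert 0 B \<Longrightarrow> norm (L (u b) - u b) < 1/4"
  shows "height (L z) = height z" "base (L (Cyl x y)) = base (L (Cyl x 0))"
proof -
  \<comment> \<open>The vector \<open>u b\<close> has height 1 and a base of norm below 1/2. Moving
    it by less than 1/4 keeps the base below norm 1, so the height still decides the norm and must
    be 1 or -1; closeness to 1 fixes the sign.\<close>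
  have nb: "norm (base (u b)) < 1/2" for b :: 'a
  proof -
    have "norm b < norm b + 1" "0 < norm b + 1" using norm_ge_zero[of b] by linarith+
    then show ?thesis unfolding u_def by (simp add: field_simps)
  qed
  have hu: "height (u b) = 1" for b by (simp add: u_def)
  have nu: "norm (u b) = 1" for b using nb[of b] hu[of b] by (simp add: norm_cylinder_def)
  have F: "height (L (u b)) = height (u b)" if "b \<in> insert 0 B" for b
  proof -
    have d: "norm (base (L (u b)) - base (u b)) < 1/4" "\<bar>height (L (u b)) - height (u b)\<bar> < 1/4"
      using near[OF that] le_less_trans[OF max.cobounded1] le_less_trans[OF max.cobounded2]
      unfolding norm_cylinder_def cylinder_simps by blast+
    have "norm (base (L (u b))) < 1"
      using d(1) nb[of b] norm_triangle_sub[of "base (L (u b))" "base (u b)"] by linarith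
    moreover have "max (norm (base (L (u b)))) \<bar>height (L (u b))\<bar> = 1"
      using L(2)[of "u b"] nu by (simp add: norm_cylinder_def)
    ultimately have "\<bar>height (L (u b))\<bar> = 1" by (auto simp: max_def split: if_splits)
    then show ?thesis using d(2) hu[of b] by linarith
  qed
  have lh: "linear (\<lambda>z. height (L z))" "linear (height :: 'a cylinder \<Rightarrow> real)"
    using linear_compose[OF L(1) bounded_linear.linear[OF bounded_linear_height]]
      bounded_linear.linear[OF bounded_linear_height] by (auto simp: o_def)
  have u0: "u 0 = Cyl 0 1" by (simp add: u_def)
  have "c \<in> span (u ` insert 0 B)" if c: "c \<in> insert (Cyl 0 1) ((\<lambda>b. Cyl b 0) ` B)" for c
  proof (cases "c = Cyl 0 1")
    case True
    then show ?thesis using u0 by (metis image_eqI insertI1 span_base)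
  next
    case False
    then obtain b where b: "b \<in> B" "c = Cyl b 0" using c by blast
    have "norm b + 1 \<noteq> 0" using norm_ge_zero[of b] by linarith
    then have "c = (2 * (norm b + 1)) *\<^sub>R (u b - u 0)"
      unfolding b u0 by (intro cylinder.expand) (simp add: u_def)
    moreover have "u b \<in> span (u ` insert 0 B)" "u 0 \<in> span (u ` insert 0 B)"
      using b by (auto intro: span_base)
    ultimately show ?thesis by (metis span_diff span_scale)
  qed
  then have "span (u ` insert 0 B) = UNIV"
    using cylinder_spanning_set(2)[OF B] span_minimal[OF _ subspace_span] by (metis subsetI top.extremum_unique)
  then have z: "z \<in> span (u ` insert 0 B)" for z by simp
  show h: "height (L z) = height z" for z
    using linear_eq_on[OF lh z, of z] F by blast
  define A where "A x = base (L (Cyl x 0))" for x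
  have LA: "L (Cyl x 0) = Cyl (A x) 0" for x
    by (rule cylinder.expand) (simp add: A_def h)
  have linA: "linear A"
    unfolding A_def
    using linear_compose[OF linear_compose[OF bounded_linear.linear[OF bounded_linear_Cyl_base] L(1)]
      bounded_linear.linear[OF bounded_linear_base]] by (simp add: o_def)
  have nA: "norm (A x) = norm x" for x
    using L(2)[of "Cyl x 0"] by (simp add: LA norm_Cyl)
  have "norm_isometry A"
    unfolding norm_isometry_def using nA by (metis linA linear_diff)
  then have surjA: "surj A" by (rule norm_isometry_finite_dim_surj[OF B])
  define w where "w = base (L (Cyl 0 1))"
  have w0: "w = 0"
  proof (rule ccontr)
    assume w: "w \<noteq> 0"
    obtain x where x: "A x = inverse (norm w) *\<^sub>R w" using surjA by (metis surj_def)
    have nx: "norm x = 1" using nA[of x] x w by simp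
    have "L (Cyl x 1) = L (Cyl x 0) + L (Cyl 0 1)"
      by (subst Cyl_split) (rule linear_add[OF L(1)])
    then have "base (L (Cyl x 1)) = (inverse (norm w) + 1) *\<^sub>R w"
      using x by (simp add: LA w_def scaleR_add_left)
    then have "norm (base (L (Cyl x 1))) = (inverse (norm w) + 1) * norm w"
      by (simp only: norm_scaleR abs_of_nonneg norm_ge_zero add_nonneg_nonneg inverse_nonnegative_iff_nonnegative zero_le_one)
    then have "norm (base (L (Cyl x 1))) = 1 + norm w"
      using w by (simp add: distrib_right)
    moreover have "norm (base (L (Cyl x 1))) \<le> 1"
      using L(2)[of "Cyl x 1"] nx by (simp add: norm_cylinder_def)
    ultimately show False using w by simp
  qed
  have "Cyl 0 y = y *\<^sub>R Cyl (0::'a) 1" by (rule cylinder.expand) simp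
  then have "L (Cyl x y) = L (Cyl x 0) + y *\<^sub>R L (Cyl 0 1)"
    by (subst Cyl_split) (simp add: linear_add[OF L(1)] linear_scale[OF L(1)])
  then show "base (L (Cyl x y)) = base (L (Cyl x 0))" using w0 by (simp add: w_def)
qed

text \<open>For short times the linear parts of the motion are near the identity, so they preserve
  heights and act on the base independently of the height; this splitting is differentiated at time
  0.\<close>

lemma cylinder_infinitesimal_rigid_motionE:
  fixes B :: "'a::real_normed_vector set" and \<xi> :: "'a cylinder \<Rightarrow> 'a cylinder"
  assumes B: "finite B" "span B = UNIV" and \<xi>: "\<xi> \<in> infinitesimal_rigid_motions"
  obtains \<eta> c where "\<eta> \<in> infinitesimal_rigid_motions" "\<And>z. \<xi> z = Cyl (\<eta> (base z)) c"
proof -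
  obtain \<alpha> where \<alpha>: "rigid_motion \<alpha>" "\<And>x. (\<alpha> x has_vector_derivative \<xi> x) (at 0)"
    "\<And>x. continuous_on {-1..1} (\<alpha> x)" "\<And>x. \<alpha> x 0 = x"
    "\<And>x y t. \<bar>t\<bar> \<le> 1 \<Longrightarrow> norm (\<alpha> x t - \<alpha> y t) = norm (x - y)"
    using infinitesimal_rigid_motionE[OF \<xi>] by metis
  define L where "L t z = \<alpha> z t - \<alpha> 0 t" for t z
  have L: "linear (L t)" "norm (L t z) = norm z" if "\<bar>t\<bar> \<le> 1" for t z
  proof -
    have "t \<in> {-1..1}" using that by (simp only: atLeastAtMost_iff) linarith
    then show "linear (L t)"
      unfolding L_def[abs_def] by (rule motion_linear[OF cylinder_spanning_set[OF B] \<alpha>(1)])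
    show "norm (L t z) = norm z" using \<alpha>(5)[OF that, of z 0] by (simp add: L_def)
  qed
  define u where "u = (\<lambda>b::'a. Cyl (inverse (2 * (norm b + 1)) *\<^sub>R b) 1)"
  \<comment> \<open>Closeness to the identity is tested only on finitely many vectors, so one time
    bound \<open>e\<close> serves them all.\<close>
  have "\<exists>e>0. e \<le> 1 \<and> (\<forall>b\<in>insert 0 B. \<forall>t. \<bar>t\<bar> \<le> e \<longrightarrow> norm (L t (u b) - u b) < 1/4)"
  proof -
    have "((\<lambda>t. L t z - z) \<longlongrightarrow> 0) (at 0)" for z
    proof -
      have "(\<alpha> z \<longlongrightarrow> z) (at 0)" for z
        using has_vector_derivative_continuous[OF \<alpha>(2)[of z]] by (simp add: continuous_at \<alpha>(4))
      then have "((\<lambda>t. L t z - z) \<longlongrightarrow> (z - 0) - z) (at 0)"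
        unfolding L_def by (intro tendsto_diff tendsto_const)
      then show ?thesis by simp
    qed
    then have "\<forall>b\<in>insert 0 B. \<forall>\<^sub>F t in at 0. norm (L t (u b) - u b) < 1/4"
      by (intro ballI order_tendstoD(2)[OF tendsto_norm_zero]) auto
    then have "\<forall>\<^sub>F t in at 0. \<forall>b\<in>insert 0 B. norm (L t (u b) - u b) < 1/4"
      using B(1) by (intro eventually_ball_finite) auto
    then obtain d where d: "d > 0" "\<And>t. t \<noteq> 0 \<Longrightarrow> \<bar>t\<bar> < d \<Longrightarrow> \<forall>b\<in>insert 0 B. norm (L t (u b) - u b) < 1/4"
      unfolding eventually_at dist_real_def by auto
    have "norm (L t (u b) - u b) < 1/4" if "b \<in> insert 0 B" "\<bar>t\<bar> \<le> min (d/2) 1" for b t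
      using d(1) d(2)[of t] that by (cases "t = 0") (auto simp: L_def \<alpha>(4))
    then show ?thesis using d(1) by (intro exI[of _ "min (d/2) 1"]) auto
  qed
  then obtain e where e: "e > 0" "e \<le> 1" "\<And>b t. b \<in> insert 0 B \<Longrightarrow> \<bar>t\<bar> \<le> e \<Longrightarrow> norm (L t (u b) - u b) < 1/4"
    by blast
  have hL: "height (L t z) = height z" and bL: "base (L t (Cyl x y)) = base (L t (Cyl x 0))"
    if "\<bar>t\<bar> \<le> e" for t z x y
    using cylinder_isometry_near_identity[OF B, of "L t"] L[of t] e that unfolding u_def by auto
  \<comment> \<open>The slice of height 0 serves as a copy of the base. Its height differences stay
    0, so the cylinder norm of a difference is the base norm.\<close>
  define \<beta> where "\<beta> x t = base (\<alpha> (Cyl x 0) t)" for x t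
  define \<eta> where "\<eta> x = base (\<xi> (Cyl x 0))" for x
  have \<beta>: "(\<beta> x has_vector_derivative \<eta> x) (at 0)" for x
    unfolding \<beta>_def[abs_def] \<eta>_def
    by (rule bounded_linear.has_vector_derivative[OF bounded_linear_base \<alpha>(2)])
  have "\<eta> \<in> infinitesimal_rigid_motions"
  proof (rule infinitesimal_rigid_motion_if_local[OF e(1), of \<beta>])
    fix x
    show "continuous_on {-e..e} (\<beta> x)"
      unfolding \<beta>_def[abs_def]
      by (rule bounded_linear.continuous_on[OF bounded_linear_base continuous_on_subset[OF \<alpha>(3)]]) (use e in auto)
    show "\<beta> x 0 = x" by (simp add: \<beta>_def \<alpha>(4))
    show "(\<beta> x has_vector_derivative \<eta> x) (at 0)" by (rule \<beta>)
  next
    fix x y t assume t: "\<bar>t\<bar> \<le> e"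
    have "L t (Cyl x 0) - L t (Cyl y 0) = \<alpha> (Cyl x 0) t - \<alpha> (Cyl y 0) t" by (simp add: L_def)
    then have "norm (L t (Cyl x 0) - L t (Cyl y 0)) = norm (Cyl x 0 - Cyl y 0)"
      using \<alpha>(5)[of t "Cyl x 0" "Cyl y 0"] t e(2) by simp
    then have "norm (base (L t (Cyl x 0)) - base (L t (Cyl y 0))) = norm (x - y)"
      using hL[OF t] by (simp add: norm_cylinder_def)
    then show "norm (\<beta> x t - \<beta> y t) = norm (x - y)" by (simp add: \<beta>_def L_def)
  qed
  moreover have "\<xi> z = Cyl (\<eta> (base z)) (height (\<xi> 0))" for z
  proof (rule cylinder.expand, intro conjI, simp_all)
    have open_e: "open {-e<..<e}" "(0::real) \<in> {-e<..<e}" using e by auto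
    have "((\<lambda>t. base (\<alpha> z t)) has_vector_derivative base (\<xi> z)) (at 0)"
      by (rule bounded_linear.has_vector_derivative[OF bounded_linear_base \<alpha>(2)])
    then have "(\<beta> (base z) has_vector_derivative base (\<xi> z)) (at 0)"
    proof (rule has_vector_derivative_transform_within_open[OF _ open_e])
      fix t assume "t \<in> {-e<..<e}"
      then have "\<bar>t\<bar> \<le> e" by auto
      from bL[OF this, of "base z" "height z"] show "base (\<alpha> z t) = \<beta> (base z) t"
        by (simp add: L_def \<beta>_def)
    qed
    then show "base (\<xi> z) = \<eta> (base z)" using \<beta> vector_derivative_unique_at by blast
    have "((\<lambda>t. height (\<alpha> z t)) has_vector_derivative height (\<xi> z)) (at 0)"
      by (rule bounded_linear.has_vector_derivative[OF bounded_linear_height \<alpha>(2)])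
    then have "((\<lambda>t. height z + height (\<alpha> 0 t)) has_vector_derivative height (\<xi> z)) (at 0)"
    proof (rule has_vector_derivative_transform_within_open[OF _ open_e])
      fix t assume "t \<in> {-e<..<e}"
      then have "\<bar>t\<bar> \<le> e" by auto
      from hL[OF this, of z] show "height (\<alpha> z t) = height z + height (\<alpha> 0 t)"
        by (simp add: L_def)
    qed
    moreover have "((\<lambda>t. height z + height (\<alpha> 0 t)) has_vector_derivative 0 + height (\<xi> 0)) (at 0)"
      by (intro has_vector_derivative_add has_vector_derivative_const
          bounded_linear.has_vector_derivative[OF bounded_linear_height \<alpha>(2)])
    ultimately show "height (\<xi> z) = height (\<xi> 0)" using vector_derivative_unique_at by fastforce
  qed
  ultimately show ?thesis using that by blast
qed

section \<open>Families and derivatives of norms\<close>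

abbreviation "lookup \<equiv> Poly_Mapping.lookup"

lemma lookup_scaleR [simp]: "lookup (r *\<^sub>R x) k = r *\<^sub>R lookup x k"
proof -
  have "finite {i. r *\<^sub>R lookup x i \<noteq> 0}"
    by (rule finite_subset[OF _ finite_keys[of x]]) (auto simp: in_keys_iff)
  then show ?thesis by (simp add: scaleR_poly_mapping_def Abs_poly_mapping_inverse)
qed

lemma in_families_iff: "x \<in> families S \<longleftrightarrow> (\<forall>k. k \<notin> S \<longrightarrow> lookup x k = 0)"
  by (auto simp: families_def in_keys_iff)

lemma subspace_families: "subspace (families S :: ('i \<Rightarrow>\<^sub>0 'b::real_vector) set)"
  unfolding subspace_def by (auto simp: in_families_iff lookup_add)

lemma families_eqI:
  assumes "x \<in> families S" "y \<in> families S"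
    and "\<And>k. k \<in> S \<Longrightarrow> lookup x k = lookup y k"
  shows "x = y"
  using assms by (intro poly_mapping_eqI) (metis in_families_iff)

lemma norm_lookup_le: "norm (lookup x k) \<le> norm x"
  for x :: "'i \<Rightarrow>\<^sub>0 'b::real_normed_vector"
proof (cases "k \<in> Poly_Mapping.keys x")
  case True
  then show ?thesis
    unfolding norm_poly_mapping_def dist_poly_mapping_def
    using member_le_sum[of k "Poly_Mapping.keys x" "\<lambda>n. norm (lookup x n)"] by simp
next
  case False
  then show ?thesis by (simp add: in_keys_iff)
qed

lemma norm_families:
  fixes x :: "'i \<Rightarrow>\<^sub>0 'b::real_normed_vector"
  assumes "finite S" "x \<in> families S"
  shows "norm x = (\<Sum>k\<in>S. norm (lookup x k))"
proof -
  have "norm x = (\<Sum>k\<in>Poly_Mapping.keys x. norm (lookup x k))"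
    by (simp add: norm_poly_mapping_def dist_poly_mapping_def)
  also have "\<dots> = (\<Sum>k\<in>S. norm (lookup x k))"
    using assms by (intro sum.mono_neutral_left) (auto simp: families_def in_keys_iff)
  finally show ?thesis .
qed

lemma bounded_linear_lookup:
  "bounded_linear (\<lambda>x :: 'i \<Rightarrow>\<^sub>0 'b::real_normed_vector. lookup x k)"
  by (rule bounded_linear_intro[where K = 1]) (auto simp: lookup_add norm_lookup_le)

lemma bounded_linear_single:
  "bounded_linear (\<lambda>y :: 'b::real_normed_vector. Poly_Mapping.single k y)"
proof (rule bounded_linear_intro[where K = 1])
  fix x y :: 'b and r :: real
  show "Poly_Mapping.single k (x + y) = Poly_Mapping.single k x + Poly_Mapping.single k y"
    by (rule single_add)
  show "Poly_Mapping.single k (r *\<^sub>R x) = r *\<^sub>R Poly_Mapping.single k x"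
    by (rule poly_mapping_eqI) (simp add: lookup_single when_def)
  show "norm (Poly_Mapping.single k x) \<le> norm x * 1"
    by (simp add: norm_poly_mapping_def dist_poly_mapping_def)
qed

definition family_of :: "'i set \<Rightarrow> ('i \<Rightarrow> 'b) \<Rightarrow> ('i \<Rightarrow>\<^sub>0 'b::zero)" where
  "family_of S f = Abs_poly_mapping (\<lambda>k. if k \<in> S then f k else 0)"

lemma lookup_family_of:
  assumes "finite S"
  shows "lookup (family_of S f) k = (if k \<in> S then f k else 0)"
  unfolding family_of_def by (subst Abs_poly_mapping_inverse) (auto intro: finite_subset[OF _ assms])

lemma family_of_in_families: "finite S \<Longrightarrow> family_of S f \<in> families S"
  by (simp add: in_families_iff lookup_family_of)

lemma families_eq_sum_single:
  fixes x :: "'i \<Rightarrow>\<^sub>0 'b::real_normed_vector"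
  assumes "finite S" "x \<in> families S"
  shows "x = (\<Sum>k\<in>S. Poly_Mapping.single k (lookup x k))"
  using assms by (intro poly_mapping_eqI)
    (auto simp: lookup_sum lookup_single when_def in_families_iff sum.delta')

lemma finite_spanned_families:
  fixes B :: "'b::real_normed_vector set"
  assumes B: "finite B" "span B = UNIV" and S: "finite S"
  shows "finite_spanned (families S :: ('i \<Rightarrow>\<^sub>0 'b) set)"
proof -
  let ?C = "\<Union>k\<in>S. Poly_Mapping.single k ` B :: ('i \<Rightarrow>\<^sub>0 'b) set"
  have "x \<in> span ?C" if x: "x \<in> families S" for x
  proof -
    have "Poly_Mapping.single k y \<in> span ?C" if "k \<in> S" for k y
    proof -
      have "Poly_Mapping.single k y \<in> span (Poly_Mapping.single k ` B)"
        unfolding linear_span_image[OF bounded_linear.linear[OF bounded_linear_single]] B(2) by simp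
      then show ?thesis using that span_mono[of "Poly_Mapping.single k ` B" ?C] by blast
    qed
    then have "(\<Sum>k\<in>S. Poly_Mapping.single k (lookup x k)) \<in> span ?C"
      by (intro span_sum) auto
    then show ?thesis using families_eq_sum_single[OF S x] by simp
  qed
  moreover have "finite ?C" using B S by simp
  ultimately show ?thesis unfolding finite_spanned_def by blast
qed

lemma finite_spanned_real_families:
  "finite S \<Longrightarrow> finite_spanned (families S :: ('i \<Rightarrow>\<^sub>0 real) set)"
proof (rule finite_spanned_families)
  have "r \<in> span {1}" for r :: real
    using span_scale[of 1 "{1::real}" r] by (simp add: span_base)
  then show "span {1::real} = UNIV" by blast
qed auto

section \<open>Derivatives of norms and their continuity\<close>

definition norm_deriv :: "'a::real_normed_vector \<Rightarrow> 'a \<Rightarrow> real" where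
  "norm_deriv x = frechet_derivative norm (at x)"

lemma has_derivative_norm_deriv:
  "norm differentiable at x \<Longrightarrow> (norm has_derivative norm_deriv x) (at x)"
  unfolding norm_deriv_def by (simp add: frechet_derivative_works)

lemma norm_derivI: "(norm has_derivative D) (at x) \<Longrightarrow> norm_deriv x = D"
  unfolding norm_deriv_def using frechet_derivative_at by metis

lemma norm_deriv_linear: "norm differentiable at x \<Longrightarrow> linear (norm_deriv x)"
  using has_derivative_norm_deriv has_derivative_linear by blast

lemma DERIV_norm_line:
  fixes x h :: "'a::real_normed_vector"
  assumes "norm differentiable at x"
  shows "((\<lambda>s. norm (x + s *\<^sub>R h)) has_field_derivative norm_deriv x h) (at 0)"
proof -
  have "((\<lambda>s. norm (x + s *\<^sub>R h)) has_derivative (\<lambda>s. norm_deriv x (s *\<^sub>R h))) (at 0)"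
  proof (rule has_derivative_compose[of "\<lambda>s. x + s *\<^sub>R h" "\<lambda>s. s *\<^sub>R h" 0 UNIV norm "norm_deriv x"])
    show "((\<lambda>s. x + s *\<^sub>R h) has_derivative (\<lambda>s. s *\<^sub>R h)) (at 0)"
      by (auto intro!: derivative_eq_intros)
  qed (use has_derivative_norm_deriv[OF assms] in simp)
  moreover have "(\<lambda>s. norm_deriv x (s *\<^sub>R h)) = (*) (norm_deriv x h)"
    by (rule ext) (simp add: linear_scale[OF norm_deriv_linear[OF assms]])
  ultimately show ?thesis unfolding has_field_derivative_def by simp
qed

text \<open>Convexity: along \<open>h\<close> the difference quotient at any step \<open>s\<close>
  between 0 and 1 is at most the quotient at step 1.\<close>

lemma norm_deriv_le:
  fixes x h :: "'a::real_normed_vector"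
  assumes "norm differentiable at x"
  shows "norm_deriv x h \<le> norm (x + h) - norm x"
proof -
  have "((\<lambda>s. (norm (x + s *\<^sub>R h) - norm x) / s) \<longlongrightarrow> norm_deriv x h) (at 0)"
    using DERIV_norm_line[OF assms, of h]
    by (simp add: DERIV_def)
  then have "((\<lambda>s. (norm (x + s *\<^sub>R h) - norm x) / s) \<longlongrightarrow> norm_deriv x h) (at_right 0)"
    by (rule tendsto_mono[OF at_le, rotated]) simp
  moreover have "\<forall>\<^sub>F s in at_right 0. (norm (x + s *\<^sub>R h) - norm x) / s \<le> norm (x + h) - norm x"
    unfolding eventually_at_right_field
  proof (intro exI[of _ 1] conjI allI impI)
    fix s :: real assume s: "0 < s" "s < 1"
    have "x + s *\<^sub>R h = (1 - s) *\<^sub>R x + s *\<^sub>R (x + h)" by (simp add: algebra_simps)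
    then have "norm (x + s *\<^sub>R h) \<le> norm ((1 - s) *\<^sub>R x) + norm (s *\<^sub>R (x + h))"
      by (metis norm_triangle_ineq)
    also have "\<dots> = (1 - s) * norm x + s * norm (x + h)" using s by simp
    also have "\<dots> = norm x + s * (norm (x + h) - norm x)" by (simp add: algebra_simps)
    finally show "(norm (x + s *\<^sub>R h) - norm x) / s \<le> norm (x + h) - norm x"
      using s by (simp add: field_simps)
  qed simp
  ultimately show ?thesis by (rule tendsto_upperbound) simp
qed

text \<open>The derivative at \<open>y\<close> is bounded by a difference quotient with a step
  \<open>s\<close> that does not depend on \<open>y\<close>, and this quotient is continuous in
  \<open>y\<close>. Half of \<open>e\<close> pays for replacing the derivative at \<open>x\<close>
  by its quotient, the other half for moving both end points from \<open>x\<close> to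
  \<open>y\<close>.\<close>

lemma norm_deriv_upper_semicontinuous:
  fixes x u :: "'a::real_normed_vector"
  assumes x: "norm differentiable at x" and e: "e > 0"
  obtains d where "d > 0"
    "\<And>y. norm (y - x) < d \<Longrightarrow> norm differentiable at y \<Longrightarrow> norm_deriv y u < norm_deriv x u + e"
proof -
  have "((\<lambda>s. (norm (x + s *\<^sub>R u) - norm x) / s) \<longlongrightarrow> norm_deriv x u) (at 0)"
    using DERIV_norm_line[OF x, of u]
    by (simp add: DERIV_def)
  then have "((\<lambda>s. (norm (x + s *\<^sub>R u) - norm x) / s) \<longlongrightarrow> norm_deriv x u) (at_right 0)"
    by (rule tendsto_mono[OF at_le, rotated]) simp
  then have "\<forall>\<^sub>F s in at_right 0. (norm (x + s *\<^sub>R u) - norm x) / s < norm_deriv x u + e / 2"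
    using e by (intro order_tendstoD(2)) auto
  then obtain b where b: "b > 0" "\<And>s. 0 < s \<Longrightarrow> s < b \<Longrightarrow> (norm (x + s *\<^sub>R u) - norm x) / s < norm_deriv x u + e / 2"
    unfolding eventually_at_right_field by blast
  define s where "s = b / 2"
  have s: "0 < s" "norm (x + s *\<^sub>R u) - norm x < s * (norm_deriv x u + e / 2)"
    using b(1) b(2)[of s] by (auto simp: s_def field_simps)
  show ?thesis
  proof (rule that[of "s * e / 4"])
    show "s * e / 4 > 0" using s e by simp
    fix y assume y: "norm (y - x) < s * e / 4" "norm differentiable at y"
    have "s * norm_deriv y u \<le> norm (y + s *\<^sub>R u) - norm y"
      using norm_deriv_le[OF y(2), of "s *\<^sub>R u"] by (simp add: linear_scale[OF norm_deriv_linear[OF y(2)]])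
    also have "\<dots> \<le> norm (x + s *\<^sub>R u) - norm x + 2 * norm (y - x)"
      using norm_triangle_ineq[of "x + s *\<^sub>R u" "y - x"] norm_triangle_ineq2[of x y]
      by (simp add: norm_minus_commute add.commute)
    also have "\<dots> < s * (norm_deriv x u + e / 2) + s * e / 2" using s y by simp
    also have "\<dots> = s * (norm_deriv x u + e)" by (simp add: algebra_simps)
    finally show "norm_deriv y u < norm_deriv x u + e" using s by simp
  qed
qed

text \<open>By linearity the upper bound in direction \<open>- u\<close> is a lower bound in
  direction \<open>u\<close>. The comparison is among points of differentiability only, which is all
  that well-positioned placements require.\<close>

lemma norm_deriv_continuous:
  fixes x u :: "'a::real_normed_vector"
  assumes x: "norm differentiable at x" and e: "e > 0"
  obtains d where "d > 0"
    "\<And>y. norm (y - x) < d \<Longrightarrow> norm differentiable at y \<Longrightarrow> \<bar>norm_deriv y u - norm_deriv x u\<bar> < e"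
proof -
  obtain d1 where d1: "d1 > 0"
    "\<And>y. norm (y - x) < d1 \<Longrightarrow> norm differentiable at y \<Longrightarrow> norm_deriv y u < norm_deriv x u + e"
    using norm_deriv_upper_semicontinuous[OF assms] by metis
  obtain d2 where d2: "d2 > 0"
    "\<And>y. norm (y - x) < d2 \<Longrightarrow> norm differentiable at y \<Longrightarrow> norm_deriv y (- u) < norm_deriv x (- u) + e"
    using norm_deriv_upper_semicontinuous[OF assms] by metis
  show ?thesis
  proof (rule that[of "min d1 d2"])
    fix y assume y: "norm (y - x) < min d1 d2" "norm differentiable at y"
    then show "\<bar>norm_deriv y u - norm_deriv x u\<bar> < e"
      using d1(2)[of y] d2(2)[of y]
      by (auto simp: linear_neg[OF norm_deriv_linear] x)
  qed (use d1 d2 in auto)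
qed

section \<open>The derivative of the rigidity map\<close>

lemma simple_graph_edgeE:
  assumes "simple_graph V E" "e \<in> E"
  obtains v w where "e = {v, w}" "v \<noteq> w" "v \<in> V" "w \<in> V"
proof -
  have e: "e \<subseteq> V" "card e = 2" using assms by (auto simp: simple_graph_def)
  then obtain v w where "e = {v, w}" "v \<noteq> w" unfolding card_2_iff by blast
  then show ?thesis using that e by blast
qed

lemma simple_graph_edgeD:
  assumes "simple_graph V E" "{v, w} \<in> E"
  shows "v \<in> V" "w \<in> V" "v \<noteq> w"
  using assms unfolding simple_graph_def by fastforce+

lemma simple_graph_finite: "simple_graph V E \<Longrightarrow> finite V" "simple_graph V E \<Longrightarrow> finite E"
proof -
  assume "simple_graph V E"
  then have "finite V" "E \<subseteq> Pow V" by (auto simp: simple_graph_def)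
  then show "finite V" "finite E" by (auto intro: finite_subset)
qed

lemma simple_graph_subset: "simple_graph V E \<Longrightarrow> E' \<subseteq> E \<Longrightarrow> simple_graph V E'"
  unfolding simple_graph_def by blast

lemma rigidity_map_eq_sum:
  assumes "finite E"
  shows "rigidity_map E x = (\<Sum>e\<in>E. Poly_Mapping.single e (edge_length x e))"
  using assms by (intro poly_mapping_eqI)
    (auto simp: lookup_rigidity_map lookup_sum lookup_single when_def sum.delta')

text \<open>For the converse, moving the vertex \<open>v\<close> alone lets the edge vector take
  every value while the placement stays in \<open>families V\<close>; composing the edge length with
  this affine map \<open>g\<close> recovers the norm.\<close>

lemma differentiable_edge_iff:
  fixes p :: "'v \<Rightarrow>\<^sub>0 'y::real_normed_vector"
  assumes "v \<in> V" "v \<noteq> w" "p \<in> families V"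
  shows "(\<lambda>x. norm (lookup x v - lookup x w)) differentiable (at p within families V)
    \<longleftrightarrow> norm differentiable (at (lookup p v - lookup p w))"
    (is "?f differentiable _ \<longleftrightarrow> norm differentiable (at ?d)")
proof
  assume "norm differentiable (at ?d)"
  then obtain D where D: "(norm has_derivative D) (at ?d)" by (auto simp: differentiable_def)
  have "((\<lambda>x. lookup x v - lookup x w) has_derivative
      (\<lambda>x. lookup x v - lookup x w)) (at p within families V)"
    by (intro has_derivative_diff bounded_linear_imp_has_derivative bounded_linear_lookup)
  from has_derivative_compose[OF this D] show "?f differentiable (at p within families V)"
    by (rule differentiableI)
next
  assume "?f differentiable (at p within families V)"
  then obtain D where D: "(?f has_derivative D) (at p within families V)" by (auto simp: differentiable_def)
  define g where "g z = p + Poly_Mapping.single v (z - ?d)" for z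
  have lg: "lookup (g z) v - lookup (g z) w = z" for z
    using assms(2) by (simp add: g_def lookup_add lookup_single)
  have gd: "g ?d = p" by (simp add: g_def)
  have "g z \<in> families V" for z
    using assms by (auto simp: g_def in_families_iff lookup_add lookup_single when_def)
  then have "range g \<subseteq> families V" by blast
  then have Dg: "(?f has_derivative D) (at (g ?d) within range g)"
    unfolding gd by (rule has_derivative_subset[OF D])
  have "(g has_derivative (\<lambda>h. 0 + Poly_Mapping.single v (h - 0))) (at ?d within UNIV)"
    unfolding g_def[abs_def]
    by (intro has_derivative_add has_derivative_const
        bounded_linear.has_derivative[OF bounded_linear_single] has_derivative_diff has_derivative_ident)
  from diff_chain_within[OF this Dg] have "(?f \<circ> g) differentiable (at ?d)"
    by (auto intro: differentiableI)
  moreover have "?f \<circ> g = norm" by (rule ext) (simp add: lg)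
  ultimately show "norm differentiable (at ?d)" by simp
qed

lemma well_positioned_iff:
  fixes p :: "'v \<Rightarrow>\<^sub>0 'y::real_normed_vector"
  assumes G: "simple_graph V E"
  shows "well_positioned V E p \<longleftrightarrow> p \<in> families V \<and>
    (\<forall>v w. {v, w} \<in> E \<longrightarrow> lookup p v \<noteq> lookup p w \<and>
       norm differentiable (at (lookup p v - lookup p w)))"
proof -
  have fin: "finite E" using simple_graph_finite[OF G] by blast
  have "rigidity_map E differentiable (at p within families V) \<longleftrightarrow>
    (\<forall>e\<in>E. (\<lambda>x. edge_length x e) differentiable (at p within families V))"
  proof
    assume d: "rigidity_map E differentiable (at p within families V)"
    show "\<forall>e\<in>E. (\<lambda>x. edge_length x e) differentiable (at p within families V)"
    proof
      fix e assume "e \<in> E"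
      then have eq: "(\<lambda>x :: 'v \<Rightarrow>\<^sub>0 'y. edge_length x e) = (\<lambda>x. lookup (rigidity_map E x) e)"
        by (simp add: lookup_rigidity_map[OF fin])
      show "(\<lambda>x. edge_length x e) differentiable (at p within families V)"
        using d unfolding eq differentiable_def
        by (blast intro: bounded_linear.has_derivative[OF bounded_linear_lookup])
    qed
  next
    assume "\<forall>e\<in>E. (\<lambda>x. edge_length x e) differentiable (at p within families V)"
    then have "\<forall>e\<in>E. \<exists>D. ((\<lambda>x. edge_length x e) has_derivative D) (at p within families V)"
      by (simp add: differentiable_def)
    then obtain D where "\<And>e. e \<in> E \<Longrightarrow> ((\<lambda>x. edge_length x e) has_derivative D e) (at p within families V)"
      by metis
    then have "((\<lambda>x. \<Sum>e\<in>E. Poly_Mapping.single e (edge_length x e)) has_derivative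
        (\<lambda>x. \<Sum>e\<in>E. Poly_Mapping.single e (D e x))) (at p within families V)"
      by (intro has_derivative_sum bounded_linear.has_derivative[OF bounded_linear_single])
    then show "rigidity_map E differentiable (at p within families V)"
      unfolding rigidity_map_eq_sum[OF fin, abs_def] by (rule differentiableI)
  qed
  moreover have "(\<forall>e\<in>E. (\<lambda>x. edge_length x e) differentiable (at p within families V)) \<longleftrightarrow>
      (\<forall>v w. {v, w} \<in> E \<longrightarrow> norm differentiable (at (lookup p v - lookup p w)))"
    if p: "p \<in> families V"
  proof -
    have "(\<lambda>x. edge_length x {v, w}) differentiable (at p within families V) \<longleftrightarrow>
        norm differentiable (at (lookup p v - lookup p w))"
      if "{v, w} \<in> E" for v w
      using simple_graph_edgeD[OF G that] differentiable_edge_iff[OF _ _ p] by simp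
    then show ?thesis by (metis simple_graph_edgeE[OF G])
  qed
  ultimately show ?thesis unfolding well_positioned_def framework_def by blast
qed

lemma has_derivative_rigidity_deriv:
  "well_positioned V E p \<Longrightarrow> (rigidity_map E has_derivative rigidity_deriv V E p) (at p within families V)"
  unfolding well_positioned_def rigidity_deriv_def by (simp add: frechet_derivative_works)

lemma linear_rigidity_deriv: "well_positioned V E p \<Longrightarrow> linear (rigidity_deriv V E p)"
  using has_derivative_rigidity_deriv has_derivative_linear by blast

text \<open>Derivatives within \<open>families V\<close> are compared along the line
  \<open>p + t *\<^sub>R u\<close>, which stays in that subspace; this reduces uniqueness to
  uniqueness of ordinary derivatives of one real variable.\<close>

lemma
  fixes p :: "'v \<Rightarrow>\<^sub>0 'y::real_normed_vector"
  assumes G: "simple_graph V E" and wp: "well_positioned V E p" and u: "u \<in> families V"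
  shows lookup_rigidity_deriv: "{v, w} \<in> E \<Longrightarrow> lookup (rigidity_deriv V E p u) {v, w} =
      norm_deriv (lookup p v - lookup p w) (lookup u v - lookup u w)"
    and rigidity_deriv_in_families: "rigidity_deriv V E p u \<in> families E"
proof -
  have fin: "finite E" using simple_graph_finite[OF G] by blast
  have p: "p \<in> families V" using wp well_positioned_iff[OF G] by blast
  define g where "g t = p + t *\<^sub>R u" for t :: real
  have "range g \<subseteq> families V"
    using p u by (auto simp: g_def in_families_iff lookup_add)
  then have D: "(rigidity_map E has_derivative rigidity_deriv V E p) (at (g 0) within range g)"
    using has_derivative_subset[OF has_derivative_rigidity_deriv[OF wp]] by (simp add: g_def)
  have "(g has_derivative (\<lambda>t. t *\<^sub>R u)) (at 0 within UNIV)"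
    unfolding g_def[abs_def] by (auto intro!: derivative_eq_intros)
  from diff_chain_within[OF this D]
  have D: "((\<lambda>t. rigidity_map E (g t)) has_vector_derivative rigidity_deriv V E p u) (at 0)"
    unfolding has_vector_derivative_def by (simp add: o_def linear_scale[OF linear_rigidity_deriv[OF wp]])
  have De: "((\<lambda>t. lookup (rigidity_map E (g t)) e) has_vector_derivative
      lookup (rigidity_deriv V E p u) e) (at 0)" for e
    by (rule bounded_linear.has_vector_derivative[OF bounded_linear_lookup D])
  show "rigidity_deriv V E p u \<in> families E"
    unfolding in_families_iff
  proof (intro allI impI)
    fix e assume "e \<notin> E"
    then have "((\<lambda>t. 0) has_vector_derivative lookup (rigidity_deriv V E p u) e) (at 0)"
      using De[of e] by (simp add: lookup_rigidity_map[OF fin])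
    from vector_derivative_unique_at[OF has_vector_derivative_const this]
    show "lookup (rigidity_deriv V E p u) e = 0" by simp
  qed
  show "lookup (rigidity_deriv V E p u) {v, w} =
      norm_deriv (lookup p v - lookup p w) (lookup u v - lookup u w)"
    if e: "{v, w} \<in> E"
  proof -
    let ?d = "lookup p v - lookup p w"
    let ?h = "lookup u v - lookup u w"
    have "norm differentiable (at ?d)" using wp e well_positioned_iff[OF G] by blast
    from DERIV_norm_line[OF this, of ?h]
    have "((\<lambda>t. norm (?d + t *\<^sub>R ?h)) has_vector_derivative norm_deriv ?d ?h) (at 0)"
      unfolding has_real_derivative_iff_has_vector_derivative .
    moreover have "(\<lambda>t. norm (?d + t *\<^sub>R ?h)) = (\<lambda>t. lookup (rigidity_map E (g t)) {v, w})"
      using e by (simp add: lookup_rigidity_map[OF fin] g_def lookup_add algebra_simps)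
    ultimately show ?thesis using De[of "{v, w}"] vector_derivative_unique_at by metis
  qed
qed

lemma rigidity_deriv_eq_0_iff:
  fixes p :: "'v \<Rightarrow>\<^sub>0 'y::real_normed_vector"
  assumes G: "simple_graph V E" and wp: "well_positioned V E p" and u: "u \<in> families V"
  shows "rigidity_deriv V E p u = 0 \<longleftrightarrow> (\<forall>v w. {v, w} \<in> E \<longrightarrow>
      norm_deriv (lookup p v - lookup p w) (lookup u v - lookup u w) = 0)"
proof
  assume "rigidity_deriv V E p u = 0"
  then show "\<forall>v w. {v, w} \<in> E \<longrightarrow>
      norm_deriv (lookup p v - lookup p w) (lookup u v - lookup u w) = 0"
    using lookup_rigidity_deriv[OF assms] by simp
next
  assume *: "\<forall>v w. {v, w} \<in> E \<longrightarrow>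
      norm_deriv (lookup p v - lookup p w) (lookup u v - lookup u w) = 0"
  show "rigidity_deriv V E p u = 0"
  proof (rule families_eqI[OF rigidity_deriv_in_families[OF assms]])
    fix e assume e: "e \<in> E"
    then obtain v w where "e = {v, w}" using simple_graph_edgeE[OF G] by metis
    then show "lookup (rigidity_deriv V E p u) e = lookup 0 e"
      using lookup_rigidity_deriv[OF assms] * e by simp
  qed (simp add: families_def)
qed

text \<open>Along a rigid motion the distance of two points is constant; this is its derivative at
  time 0.\<close>

lemma norm_deriv_rigid_motion:
  fixes x y :: "'a::real_normed_vector"
  assumes \<eta>: "\<eta> \<in> infinitesimal_rigid_motions" and d: "norm differentiable (at (x - y))"
  shows "norm_deriv (x - y) (\<eta> x - \<eta> y) = 0"
proof -
  obtain \<alpha> where \<alpha>: "\<And>x. (\<alpha> x has_vector_derivative \<eta> x) (at 0)" "\<And>x. \<alpha> x 0 = x"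
    "\<And>x y t. \<bar>t\<bar> \<le> 1 \<Longrightarrow> norm (\<alpha> x t - \<alpha> y t) = norm (x - y)"
    using infinitesimal_rigid_motionE[OF \<eta>] by metis
  have D: "((\<lambda>t. \<alpha> x t - \<alpha> y t) has_derivative (\<lambda>t. t *\<^sub>R (\<eta> x - \<eta> y))) (at 0)"
    using has_vector_derivative_diff[OF \<alpha>(1) \<alpha>(1)] unfolding has_vector_derivative_def .
  have Dn: "(norm has_derivative norm_deriv (x - y)) (at (\<alpha> x 0 - \<alpha> y 0))"
    using has_derivative_norm_deriv[OF d] by (simp add: \<alpha>)
  have "((\<lambda>t. norm (\<alpha> x t - \<alpha> y t)) has_vector_derivative norm_deriv (x - y) (\<eta> x - \<eta> y)) (at 0)"
    using has_derivative_compose[OF D Dn]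
    unfolding has_vector_derivative_def by (simp add: linear_scale[OF norm_deriv_linear[OF d]])
  then have "((\<lambda>t. norm (x - y)) has_vector_derivative norm_deriv (x - y) (\<eta> x - \<eta> y)) (at 0)"
    by (rule has_vector_derivative_transform_within_open[of _ _ _ "{-1<..<1}"]) (auto intro!: \<alpha>(3))
  from vector_derivative_unique_at[OF has_vector_derivative_const this] show ?thesis by simp
qed

lemma trivial_motions_subset_kernel:
  fixes p :: "'v \<Rightarrow>\<^sub>0 'y::real_normed_vector"
  assumes G: "simple_graph V E" and wp: "well_positioned V E p"
  shows "trivial_motions V p \<subseteq> {u \<in> families V. rigidity_deriv V E p u = 0}"
proof
  fix u assume "u \<in> trivial_motions V p"
  then obtain \<eta> where u: "u \<in> families V" "\<eta> \<in> infinitesimal_rigid_motions"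
    "\<And>v. v \<in> V \<Longrightarrow> lookup u v = \<eta> (lookup p v)"
    unfolding trivial_motions_def by blast
  have "norm_deriv (lookup p v - lookup p w) (lookup u v - lookup u w) = 0"
    if e: "{v, w} \<in> E" for v w
  proof -
    have "norm differentiable (at (lookup p v - lookup p w))"
      using wp e well_positioned_iff[OF G] by blast
    then show ?thesis using norm_deriv_rigid_motion[OF u(2)] u(3) simple_graph_edgeD[OF G e] by simp
  qed
  then show "u \<in> {u \<in> families V. rigidity_deriv V E p u = 0}"
    using u(1) rigidity_deriv_eq_0_iff[OF G wp u(1)] by blast
qed

section \<open>Forests\<close>

abbreviation adjacency :: "'v set set \<Rightarrow> ('v \<times> 'v) set" where
  "adjacency T \<equiv> {(a, b). {a, b} \<in> T}"

lemma sym_adjacency_rtrancl: "(a, b) \<in> (adjacency T)\<^sup>* \<Longrightarrow> (b, a) \<in> (adjacency T)\<^sup>*"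
proof -
  have "sym (adjacency T)" by (auto simp: sym_def insert_commute)
  then show "(a, b) \<in> (adjacency T)\<^sup>* \<Longrightarrow> (b, a) \<in> (adjacency T)\<^sup>*"
    using sym_rtrancl by (meson symD)
qed

text \<open>A walk is shortened to a path as it grows: when the next vertex already occurs, the list
  is cut back to that occurrence.\<close>

lemma rtrancl_adjacency_path:
  assumes "(a, b) \<in> (adjacency T)\<^sup>*"
  shows "\<exists>vs. distinct vs \<and> vs \<noteq> [] \<and> hd vs = a \<and> last vs = b \<and>
    (\<forall>i. Suc i < length vs \<longrightarrow> {vs ! i, vs ! Suc i} \<in> T)"
  using assms
proof (induction rule: rtrancl_induct)
  case base
  show ?case by (intro exI[of _ "[a]"]) simp
next
  case (step b c)
  then obtain vs where vs: "distinct vs" "vs \<noteq> []" "hd vs = a" "last vs = b"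
    "\<And>i. Suc i < length vs \<Longrightarrow> {vs ! i, vs ! Suc i} \<in> T" by blast
  show ?case
  proof (cases "c \<in> set vs")
    case True
    then obtain j where j: "j < length vs" "vs ! j = c" by (auto simp: in_set_conv_nth)
    have "last (take (Suc j) vs) = c" using j by (simp add: take_Suc_conv_app_nth)
    then show ?thesis using vs j by (intro exI[of _ "take (Suc j) vs"]) (auto simp: hd_take)
  next
    case False
    have "{(vs @ [c]) ! i, (vs @ [c]) ! Suc i} \<in> T" if i: "Suc i < length (vs @ [c])" for i
    proof (cases "Suc i = length vs")
      case True
      then have "vs ! i = b" using vs(2,4) by (metis diff_Suc_1 last_conv_nth)
      then show ?thesis using True step.hyps by (simp add: nth_append)
    next
      case False
      then show ?thesis using i vs(5)[of i] by (simp add: nth_append)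
    qed
    then show ?thesis using vs False by (intro exI[of _ "vs @ [c]"]) auto
  qed
qed

text \<open>A path from \<open>a\<close> to \<open>b\<close> that avoids the edge
  \<open>{a, b}\<close> is closed by it to a cycle. It has at least three vertices, since one would
  give \<open>a = b\<close> and two would use the edge itself.\<close>

lemma graph_forest_bridge:
  assumes F: "graph_forest T" and e: "{a, b} \<in> T" "a \<noteq> b"
  shows "(a, b) \<notin> (adjacency (T - {{a, b}}))\<^sup>*"
proof
  assume "(a, b) \<in> (adjacency (T - {{a, b}}))\<^sup>*"
  then obtain vs where vs: "distinct vs" "vs \<noteq> []" "hd vs = a" "last vs = b"
    "\<And>i. Suc i < length vs \<Longrightarrow> {vs ! i, vs ! Suc i} \<in> T - {{a, b}}"
    using rtrancl_adjacency_path by metis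
  have ends: "vs ! 0 = a" "vs ! (length vs - 1) = b"
    using vs by (auto simp: hd_conv_nth last_conv_nth)
  have "length vs \<noteq> 1" using ends e(2) by auto
  moreover have "length vs \<noteq> 2" using vs(5)[of 0] ends by auto
  moreover have "length vs \<noteq> 0" using vs(2) by simp
  ultimately have len: "length vs \<ge> 3" by linarith
  have "{vs ! i, vs ! (Suc i mod length vs)} \<in> T" if i: "i < length vs" for i
  proof (cases "Suc i = length vs")
    case True
    then have "i = length vs - 1" by simp
    then show ?thesis using True ends e(1) by (simp add: insert_commute)
  next
    case False
    then show ?thesis using i vs(5)[of i] by simp
  qed
  then have "graph_cycle T vs" using vs(1) len by (simp add: graph_cycle_def)
  then show False using F unfolding graph_forest_def by blast
qed

text \<open>A rooted forest in a form suited to recursion on levels: roots have level 0, and every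
  other vertex accounts for the edge to its parent on the level below.\<close>

definition layered_forest :: "'v set \<Rightarrow> 'v set set \<Rightarrow> ('v \<Rightarrow> nat) \<Rightarrow> ('v \<Rightarrow> 'v) \<Rightarrow> bool" where
  "layered_forest V T l par \<longleftrightarrow>
     (\<forall>v\<in>V. l v > 0 \<longrightarrow> par v \<in> V \<and> l v = Suc (l (par v))) \<and>
     T = (\<lambda>v. {v, par v}) ` {v\<in>V. l v > 0}"

text \<open>Breadth-first search in each component: the level is the distance from the root, and the
  parent is any neighbour one step closer to it.\<close>

lemma breadth_first_layered_forest:
  assumes G: "simple_graph V T"
  obtains T' l par where "T' \<subseteq> T" "layered_forest V T' l par"
    "adjacency T \<subseteq> (adjacency T')\<^sup>*"
proof -
  let ?R = "adjacency T"
  define r where "r v = (SOME u. (u, v) \<in> ?R\<^sup>*)" for v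
  define l where "l v = (LEAST n. (r v, v) \<in> ?R ^^ n)" for v
  have r: "(r v, v) \<in> ?R\<^sup>*" for v
    unfolding r_def by (rule someI[of "\<lambda>u. (u, v) \<in> ?R\<^sup>*" v]) simp
  \<comment> \<open>Adjacent vertices are reachable from the same vertices, so the choice operator
    is applied to the same predicate and returns a common root.\<close>
  have r_eq: "r v = r w" if "(v, w) \<in> ?R" for v w
  proof -
    have vw: "(v, w) \<in> ?R\<^sup>*" using that by (rule r_into_rtrancl)
    then have wv: "(w, v) \<in> ?R\<^sup>*" by (rule sym_adjacency_rtrancl)
    have "(u, v) \<in> ?R\<^sup>* \<longleftrightarrow> (u, w) \<in> ?R\<^sup>*" for u
      using rtrancl_trans[OF _ vw] rtrancl_trans[OF _ wv] by blast
    then show ?thesis unfolding r_def by simp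
  qed
  have l: "(r v, v) \<in> ?R ^^ l v" for v
  proof -
    obtain n where "(r v, v) \<in> ?R ^^ n" using r rtrancl_imp_relpow by blast
    then show ?thesis unfolding l_def by (rule LeastI)
  qed
  have l_le: "l v \<le> n" if "(r v, v) \<in> ?R ^^ n" for v n
    unfolding l_def using that by (rule Least_le)
  have "\<exists>u. {v, u} \<in> T \<and> l v = Suc (l u)" if lv: "l v > 0" for v
  proof -
    obtain n where n: "l v = Suc n" using lv gr0_implies_Suc by blast
    obtain u where u: "(r v, u) \<in> ?R ^^ n" "(u, v) \<in> ?R" using l[of v] n by auto
    have ru: "r u = r v" by (rule r_eq[OF u(2)])
    have "(r v, v) \<in> ?R ^^ Suc (l u)" using l[of u] u(2) ru by auto
    then have "l v \<le> Suc (l u)" by (rule l_le)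
    moreover have "l u \<le> n" using u(1) ru l_le by metis
    ultimately show ?thesis using n u(2) by (intro exI[of _ u]) (auto simp: insert_commute)
  qed
  then obtain par where par: "\<And>v. l v > 0 \<Longrightarrow> {v, par v} \<in> T \<and> l v = Suc (l (par v))" by metis
  define T' where "T' = (\<lambda>v. {v, par v}) ` {v\<in>V. l v > 0}"
  have sub: "T' \<subseteq> T" using par by (auto simp: T'_def)
  have "layered_forest V T' l par"
    unfolding layered_forest_def T'_def using par simple_graph_edgeD(2)[OF G] by blast
  moreover have root: "(r v, v) \<in> (adjacency T')\<^sup>*" if "v \<in> V" for v
    using that
  proof (induction "l v" arbitrary: v)
    case 0
    then show ?case using l[of v] by simp
  next
    case (Suc n)
    have p: "{v, par v} \<in> T" "l v = Suc (l (par v))" using par[of v] Suc.hyps(2) by auto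
    have pV: "par v \<in> V" using simple_graph_edgeD[OF G p(1)] by blast
    have "(v, par v) \<in> ?R" using p by simp
    then have "r (par v) = r v" using r_eq by metis
    moreover have "(r (par v), par v) \<in> (adjacency T')\<^sup>*" using Suc.hyps p pV by auto
    ultimately have rp: "(r v, par v) \<in> (adjacency T')\<^sup>*" by simp
    have "{v, par v} \<in> T'"
      unfolding T'_def using Suc.prems p(2) by (intro image_eqI[of _ _ v]) simp_all
    then have "(par v, v) \<in> adjacency T'" by (simp add: insert_commute[of "par v" v])
    with rp show ?case by (rule rtrancl.rtrancl_into_rtrancl)
  qed
  have "adjacency T \<subseteq> (adjacency T')\<^sup>*"
  proof (rule subrelI)
    fix a b assume ab: "(a, b) \<in> ?R"
    then have "a \<in> V" "b \<in> V" using simple_graph_edgeD[OF G, of a b] by auto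
    then have "(a, r a) \<in> (adjacency T')\<^sup>*" "(r b, b) \<in> (adjacency T')\<^sup>*"
      using sym_adjacency_rtrancl[OF root] root by simp_all
    then show "(a, b) \<in> (adjacency T')\<^sup>*" unfolding r_eq[OF ab] by (rule rtrancl_trans)
  qed
  ultimately show ?thesis using that sub by blast
qed

text \<open>The breadth-first forest already joins the ends of every edge of \<open>T\<close>. An
  edge left out would therefore not be a bridge of \<open>T\<close>.\<close>

lemma forest_imp_layered_forest:
  assumes G: "simple_graph V T" and F: "graph_forest T"
  obtains l par where "layered_forest V T l par"
proof -
  obtain T' l par where T': "T' \<subseteq> T" "layered_forest V T' l par" "adjacency T \<subseteq> (adjacency T')\<^sup>*"
    using breadth_first_layered_forest[OF G] .
  have "T \<subseteq> T'"
  proof (rule ccontr)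
    assume "\<not> T \<subseteq> T'"
    then obtain e where e: "e \<in> T" "e \<notin> T'" by blast
    then obtain a b where ab: "e = {a, b}" "a \<noteq> b" using simple_graph_edgeE[OF G] by metis
    then have "adjacency T' \<subseteq> adjacency (T - {{a, b}})" using e T'(1) by auto
    then have "(adjacency T')\<^sup>* \<subseteq> (adjacency (T - {{a, b}}))\<^sup>*" by (rule rtrancl_mono)
    moreover have "(a, b) \<in> (adjacency T')\<^sup>*" using T'(3) e ab by blast
    ultimately show False using graph_forest_bridge[OF F] e ab by blast
  qed
  then show ?thesis using that T' by (metis subset_antisym)
qed

lemma connected_imp_layered_forest:
  assumes G: "simple_graph V T" and C: "graph_connected V T"
  obtains T' l par where "T' \<subseteq> T" "layered_forest V T' l par" "graph_connected V T'"
proof -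
  obtain T' l par where T': "T' \<subseteq> T" "layered_forest V T' l par" "adjacency T \<subseteq> (adjacency T')\<^sup>*"
    using breadth_first_layered_forest[OF G] .
  have "(adjacency T)\<^sup>* \<subseteq> (adjacency T')\<^sup>*"
    using rtrancl_mono[OF T'(3)] by simp
  then have "graph_connected V T'" using C unfolding graph_connected_def by blast
  then show ?thesis using that T' by blast
qed

text \<open>The increments \<open>g\<close> are summed along the parent edges from the root;
  \<open>H n v\<close> is the sum over the \<open>n\<close> topmost steps upward from
  \<open>v\<close>, taken at \<open>n = l v\<close>.\<close>

lemma layered_forest_potential:
  assumes "layered_forest V T l par"
  obtains h where "\<And>v. v \<in> V \<Longrightarrow> l v > 0 \<Longrightarrow> h v = h (par v) + (g v :: real)"
proof -
  define H where "H = rec_nat (\<lambda>v. 0) (\<lambda>n f v. f (par v) + g v)"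
  have "H (l v) v = H (l (par v)) (par v) + g v" if "v \<in> V" "l v > 0" for v
  proof -
    have "l v = Suc (l (par v))" using assms that unfolding layered_forest_def by blast
    then show ?thesis by (simp add: H_def)
  qed
  then show ?thesis by (rule that)
qed

text \<open>Surjectivity of the incidence matrix characterises forests. The signs come from
  differentiating the modulus of the height difference \<open>k v - k w\<close>, and make the
  equation of an edge independent of its orientation. In a forest one solves from the roots; on a
  cycle, the right side that is 1 on one edge and 0 on the others has no solution.\<close>

lemma graph_forest_iff_surjective:
  fixes k :: "'v \<Rightarrow> real"
  assumes G: "simple_graph V T" and k: "\<And>v w. {v, w} \<in> T \<Longrightarrow> k v \<noteq> k w"
  shows "graph_forest T \<longleftrightarrow>
    (\<forall>r. \<exists>h. \<forall>v w. {v, w} \<in> T \<longrightarrow> sgn (k v - k w) * (h v - h w) = r {v, w})"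
proof
  assume F: "graph_forest T"
  obtain l par where T: "layered_forest V T l par" using forest_imp_layered_forest[OF G F] .
  show "\<forall>r. \<exists>h. \<forall>v w. {v, w} \<in> T \<longrightarrow> sgn (k v - k w) * (h v - h w) = r {v, w}"
  proof
    fix r
    obtain h where h: "\<And>v. v \<in> V \<Longrightarrow> l v > 0 \<Longrightarrow> h v = h (par v) + sgn (k v - k (par v)) * r {v, par v}"
      using layered_forest_potential[OF T, of "\<lambda>v. sgn (k v - k (par v)) * r {v, par v}"] by blast
    have "sgn (k v - k w) * (h v - h w) = r {v, w}" if e: "{v, w} \<in> T" for v w
    proof -
      obtain x where x: "x \<in> V" "l x > 0" "{v, w} = {x, par x}"
        using e T unfolding layered_forest_def by blast
      have kx: "k x \<noteq> k (par x)" using k e x by metis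
      have "sgn (k x - k (par x)) * (h x - h (par x)) = r {x, par x}"
        using h[OF x(1,2)] kx by (auto simp: sgn_if)
      moreover have "sgn (k (par x) - k x) * (h (par x) - h x) = sgn (k x - k (par x)) * (h x - h (par x))"
        using kx by (auto simp: sgn_if)
      ultimately show ?thesis using x(3) unfolding doubleton_eq_iff by (auto simp: insert_commute)
    qed
    then show "\<exists>h. \<forall>v w. {v, w} \<in> T \<longrightarrow> sgn (k v - k w) * (h v - h w) = r {v, w}" by blast
  qed
next
  assume surj: "\<forall>r. \<exists>h. \<forall>v w. {v, w} \<in> T \<longrightarrow> sgn (k v - k w) * (h v - h w) = r {v, w}"
  show "graph_forest T"
    unfolding graph_forest_def
  proof
    assume "\<exists>vs. graph_cycle T vs"
    then obtain vs where vs: "distinct vs" "length vs \<ge> 3"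
      "\<And>i. i < length vs \<Longrightarrow> {vs ! i, vs ! (Suc i mod length vs)} \<in> T"
      unfolding graph_cycle_def by blast
    obtain h where h: "\<And>v w. {v, w} \<in> T \<Longrightarrow>
        sgn (k v - k w) * (h v - h w) = (if {v, w} = {vs ! 0, vs ! 1} then 1 else 0)"
      using spec[OF surj, of "\<lambda>e. if e = {vs ! 0, vs ! 1} then 1 else 0"] by blast
    \<comment> \<open>From index 1 on, the edges of the cycle differ from the marked edge
      \<open>{vs ! 0, vs ! 1}\<close>, so \<open>h\<close> is constant along them. At index 1 this
      uses that the next vertex \<open>vs ! 2\<close> is not \<open>vs ! 0\<close>, as the cycle has
      at least three vertices.\<close>
    have step: "h (vs ! i) = h (vs ! (Suc i mod length vs))" if i: "1 \<le> i" "i < length vs" for i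
    proof -
      have "0 < length vs" "1 < length vs" using vs(2) by linarith+
      note nth_eq = nth_eq_iff_index_eq[OF vs(1) _ this(1)] nth_eq_iff_index_eq[OF vs(1) _ this(2)]
      have "vs ! i \<noteq> vs ! 0" using i nth_eq(1)[of i] by simp
      moreover have "i \<noteq> 1 \<Longrightarrow> vs ! i \<noteq> vs ! 1" using i nth_eq(2)[of i] by simp
      moreover have "i = 1 \<Longrightarrow> vs ! (Suc i mod length vs) \<noteq> vs ! 0"
        using vs(2) nth_eq(1)[of 2] by (simp add: numeral_2_eq_2)
      ultimately have "{vs ! i, vs ! (Suc i mod length vs)} \<noteq> {vs ! 0, vs ! 1}"
        unfolding doubleton_eq_iff by metis
      then show ?thesis using h[OF vs(3)[OF i(2)]] k[OF vs(3)[OF i(2)]] by (simp add: sgn_if split: if_splits)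
    qed
    have "h (vs ! Suc i) = h (vs ! 1)" if "Suc i < length vs" for i
      using that
    proof (induction i)
      case (Suc i)
      then show ?case using step[of "Suc i"] by simp
    qed simp
    moreover have "Suc (length vs - 2) = length vs - 1" "length vs - 1 < length vs" using vs(2) by auto
    ultimately have "h (vs ! (length vs - 1)) = h (vs ! 1)" by metis
    moreover have "h (vs ! (length vs - 1)) = h (vs ! 0)"
    proof -
      have "1 \<le> length vs - 1" "length vs - 1 < length vs" "Suc (length vs - 1) = length vs"
        using vs(2) by auto
      then show ?thesis using step[of "length vs - 1"] by (metis mod_self)
    qed
    moreover have "{vs ! 0, vs ! 1} \<in> T" using vs(3)[of 0] vs(2) by (cases "vs = []") auto
    ultimately show False using h[of "vs ! 0" "vs ! 1"] by simp
  qed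
qed

section \<open>Placements in the cylinder\<close>

lemma has_derivative_norm_cylinder_timelike:
  fixes z :: "'a::real_normed_vector cylinder"
  assumes "norm (base z) < \<bar>height z\<bar>"
  shows "(norm has_derivative (\<lambda>h. sgn (height z) * height h)) (at z)"
proof -
  define s where "s = sgn (height z)"
  have s: "\<bar>s\<bar> = 1" "s * height z = \<bar>height z\<bar>"
    using assms norm_ge_zero[of "base z"] by (auto simp: s_def sgn_if simp del: norm_ge_zero)
  have O: "open {u :: 'a cylinder. norm (base u) < s * height u}"
    by (intro open_Collect_less continuous_intros bounded_linear.continuous_on[OF bounded_linear_base]
        bounded_linear.continuous_on[OF bounded_linear_height])
  have D: "((\<lambda>u :: 'a cylinder. s * height u) has_derivative (\<lambda>h. s * height h)) (at z)"
    by (intro bounded_linear_imp_has_derivative bounded_linear_const_mult bounded_linear_height)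
  have Q: "s * height u = norm u" if "u \<in> {u. norm (base u) < s * height u}" for u :: "'a cylinder"
  proof -
    have u: "norm (base u) < s * height u" using that by simp
    then have "0 < s * height u" using norm_ge_zero[of "base u"] by linarith
    then have "\<bar>height u\<bar> = s * height u" using s(1) abs_mult[of s "height u"] by simp
    then show ?thesis using u by (simp add: norm_cylinder_def)
  qed
  have I: "z \<in> {u. norm (base u) < s * height u}" using assms s(2) by simp
  have "(norm has_derivative (\<lambda>h. s * height h)) (at z)"
    by (rule has_derivative_transform_within_open[OF D O I Q])
  then show ?thesis by (simp only: s_def)
qed

lemma has_derivative_norm_cylinder_spacelike:
  fixes z :: "'a::real_normed_vector cylinder"
  assumes "\<bar>height z\<bar> < norm (base z)" "norm differentiable (at (base z))"
  shows "(norm has_derivative (\<lambda>h. norm_deriv (base z) (base h))) (at z)"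
proof -
  have O: "open {u :: 'a cylinder. \<bar>height u\<bar> < norm (base u)}"
    by (intro open_Collect_less continuous_intros bounded_linear.continuous_on[OF bounded_linear_base]
        bounded_linear.continuous_on[OF bounded_linear_height])
  have D: "((\<lambda>u. norm (base u)) has_derivative (\<lambda>h. norm_deriv (base z) (base h))) (at z)"
    by (rule has_derivative_compose[OF bounded_linear_imp_has_derivative[OF bounded_linear_base]
          has_derivative_norm_deriv[OF assms(2)]])
  have I: "z \<in> {u. \<bar>height u\<bar> < norm (base u)}" using assms(1) by simp
  show ?thesis
    by (rule has_derivative_transform_within_open[OF D O I]) (simp add: norm_cylinder_def)
qed

text \<open>Stretching the height alone by the factor \<open>1 + s\<close> gives the norm
  \<open>max r (\<bar>1 + s\<bar> * r)\<close>, which has a corner at \<open>s = 0\<close>. Both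
  \<open>f s\<close> and \<open>f s - s * r\<close> have a minimum there, so the derivative would be
  both 0 and \<open>r\<close>.\<close>

lemma norm_cylinder_not_differentiable_lightlike:
  fixes z :: "'a::real_normed_vector cylinder"
  assumes "\<bar>height z\<bar> = norm (base z)" "z \<noteq> 0"
  shows "\<not> norm differentiable (at z)"
proof
  assume d: "norm differentiable (at z)"
  define r where "r = norm (base z)"
  have r: "r > 0" using assms by (auto simp: r_def intro!: cylinder.expand)
  define f where "f s = norm (z + s *\<^sub>R Cyl 0 (height z))" for s
  have D: "DERIV f 0 :> norm_deriv z (Cyl 0 (height z))"
    unfolding f_def[abs_def] by (rule DERIV_norm_line[OF d])
  have f: "f s = max r (\<bar>1 + s\<bar> * r)" for s
  proof -
    have "height z + s * height z = (1 + s) * height z" by (simp add: algebra_simps)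
    then show ?thesis by (simp add: f_def norm_cylinder_def r_def abs_mult assms(1))
  qed
  have f0: "f 0 = r" by (simp add: f)
  have "norm_deriv z (Cyl 0 (height z)) = 0"
    by (rule DERIV_local_min[OF D, of 1]) (auto simp: f)
  moreover have "norm_deriv z (Cyl 0 (height z)) - r = 0"
  proof (rule DERIV_local_min[of "\<lambda>s. f s - s * r" _ 0 1])
    show "DERIV (\<lambda>s. f s - s * r) 0 :> norm_deriv z (Cyl 0 (height z)) - r"
      by (auto intro!: derivative_eq_intros D)
    show "\<forall>y. \<bar>0 - y\<bar> < 1 \<longrightarrow> f 0 - 0 * r \<le> f y - y * r"
    proof (intro allI impI)
      fix y :: real assume "\<bar>0 - y\<bar> < 1"
      have "(1 + y) * r \<le> f y" using r unfolding f by (intro max.coboundedI2 mult_right_mono) auto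
      then show "f 0 - 0 * r \<le> f y - y * r" by (simp add: f0 algebra_simps)
    qed
  qed simp
  ultimately show False using r by simp
qed

text \<open>On the slice through \<open>z\<close> of fixed height the cylinder norm is the base norm
  near \<open>base z\<close>, so differentiability restricts to the base.\<close>

lemma norm_differentiable_base_spacelike:
  fixes z :: "'a::real_normed_vector cylinder"
  assumes "\<bar>height z\<bar> < norm (base z)" "norm differentiable (at z)"
  shows "norm differentiable (at (base z))"
proof -
  have "((\<lambda>u. Cyl u (height z)) has_derivative (\<lambda>h. Cyl h 0)) (at (base z))"
  proof -
    have "((\<lambda>u. Cyl u 0 + Cyl 0 (height z)) has_derivative (\<lambda>h. Cyl h 0 + 0)) (at (base z))"
      by (intro has_derivative_add has_derivative_const bounded_linear_imp_has_derivative[OF bounded_linear_Cyl_base])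
    then show ?thesis by (simp flip: Cyl_split)
  qed
  moreover have "(norm has_derivative norm_deriv z) (at (Cyl (base z) (height z)))"
    using has_derivative_norm_deriv[OF assms(2)] by simp
  ultimately have "((\<lambda>u. norm (Cyl u (height z))) has_derivative (\<lambda>h. norm_deriv z (Cyl h 0))) (at (base z))"
    by (rule has_derivative_compose)
  moreover have "open {u :: 'a. \<bar>height z\<bar> < norm u}"
    by (intro open_Collect_less continuous_intros)
  ultimately have "(norm has_derivative (\<lambda>h. norm_deriv z (Cyl h 0))) (at (base z))"
    by (rule has_derivative_transform_within_open) (use assms in \<open>auto simp: norm_Cyl\<close>)
  then show ?thesis by (rule differentiableI)
qed

lemma independent_framework_iff:
  fixes p :: "'v \<Rightarrow>\<^sub>0 'y::real_normed_vector"
  assumes G: "simple_graph V E"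
  shows "independent_framework V E p \<longleftrightarrow> well_positioned V E p \<and>
    (\<forall>r. \<exists>u\<in>families V. \<forall>v w. {v, w} \<in> E \<longrightarrow>
      norm_deriv (lookup p v - lookup p w)
        (lookup u v - lookup u w) = r {v, w})"
    (is "_ \<longleftrightarrow> _ \<and> ?surj")
proof (cases "well_positioned V E p")
  case wp: True
  have fin: "finite E" using simple_graph_finite[OF G] by blast
  have "rigidity_deriv V E p ` families V = families E \<longleftrightarrow> ?surj"
  proof
    assume im: "rigidity_deriv V E p ` families V = families E"
    show ?surj
    proof
      fix r
      have "family_of E r \<in> rigidity_deriv V E p ` families V"
        unfolding im by (rule family_of_in_families[OF fin])
      then obtain u where u: "u \<in> families V" "family_of E r = rigidity_deriv V E p u" by blast
      show "\<exists>u\<in>families V. \<forall>v w. {v, w} \<in> E \<longrightarrow>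
          norm_deriv (lookup p v - lookup p w)
            (lookup u v - lookup u w) = r {v, w}"
      proof (intro bexI[OF _ u(1)] allI impI)
        fix v w assume e: "{v, w} \<in> E"
        show "norm_deriv (lookup p v - lookup p w)
            (lookup u v - lookup u w) = r {v, w}"
          using e unfolding lookup_rigidity_deriv[OF G wp u(1) e, symmetric] u(2)[symmetric]
            lookup_family_of[OF fin] by simp
      qed
    qed
  next
    assume surj: ?surj
    show "rigidity_deriv V E p ` families V = families E"
    proof
      show "rigidity_deriv V E p ` families V \<subseteq> families E"
        using rigidity_deriv_in_families[OF G wp] by blast
      show "families E \<subseteq> rigidity_deriv V E p ` families V"
      proof
        fix r :: "'v set \<Rightarrow>\<^sub>0 real" assume r: "r \<in> families E"
        obtain u where u: "u \<in> families V" "\<And>v w. {v, w} \<in> E \<Longrightarrow>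
          norm_deriv (lookup p v - lookup p w)
            (lookup u v - lookup u w) = lookup r {v, w}"
          using spec[OF surj, of "lookup r"] by blast
        have "r = rigidity_deriv V E p u"
        proof (rule families_eqI[OF r rigidity_deriv_in_families[OF G wp u(1)]])
          fix e assume e: "e \<in> E"
          then obtain v w where "e = {v, w}" using simple_graph_edgeE[OF G] by metis
          then show "lookup r e = lookup (rigidity_deriv V E p u) e"
            using lookup_rigidity_deriv[OF G wp u(1)] u(2) e by simp
        qed
        then show "r \<in> rigidity_deriv V E p ` families V" using u(1) by blast
      qed
    qed
  qed
  then show ?thesis unfolding independent_framework_def by blast
qed (simp add: independent_framework_def)

definition bases :: "('v \<Rightarrow>\<^sub>0 'x::real_normed_vector cylinder) \<Rightarrow> ('v \<Rightarrow>\<^sub>0 'x)" where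
  "bases p = Poly_Mapping.map base p"

lemma lookup_bases [simp]: "lookup (bases p) v = base (lookup p v)"
  by (simp add: bases_def map.rep_eq when_def)

lemma bases_in_families: "p \<in> families V \<Longrightarrow> bases p \<in> families V"
  by (simp add: in_families_iff)

text \<open>
  The edges of \<open>T\<close> are those along which the height decides the norm, and the edges of \<open>H\<close> those
  along which the base decides it.
\<close>

definition cylindrical_splitting ::
    "'v set \<Rightarrow> 'v set set \<Rightarrow> 'v set set \<Rightarrow> ('v \<Rightarrow>\<^sub>0 'x::real_normed_vector cylinder) \<Rightarrow> bool" where
  "cylindrical_splitting V H T p \<longleftrightarrow> p \<in> families V \<and> H \<inter> T = {} \<and> well_positioned V H (bases p) \<and>
     (\<forall>v w. {v, w} \<in> H \<longrightarrow> \<bar>height (lookup p v - lookup p w)\<bar>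
        < norm (base (lookup p v - lookup p w))) \<and>
     (\<forall>v w. {v, w} \<in> T \<longrightarrow> norm (base (lookup p v - lookup p w))
        < \<bar>height (lookup p v - lookup p w)\<bar>)"

text \<open>No edge vector lies on the cone, since the norm is not differentiable there; an edge
  outside \<open>T\<close> is therefore strictly dominated by its base.\<close>

lemma well_positioned_imp_splitting:
  fixes p :: "'v \<Rightarrow>\<^sub>0 'x::real_normed_vector cylinder"
  assumes G: "simple_graph V E" and wp: "well_positioned V E p"
  obtains H T where "E = H \<union> T" "cylindrical_splitting V H T p"
proof -
  let ?d = "\<lambda>v w. lookup p v - lookup p w"
  have p: "p \<in> families V" and edge: "\<And>v w. {v, w} \<in> E \<Longrightarrow> ?d v w \<noteq> 0 \<and> norm differentiable (at (?d v w))"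
    using wp well_positioned_iff[OF G] by auto
  define T where "T = {e\<in>E. \<exists>v w. e = {v, w} \<and> norm (base (?d v w)) < \<bar>height (?d v w)\<bar>}"
  have sym: "norm (base (?d v w)) < \<bar>height (?d v w)\<bar> \<longleftrightarrow> norm (base (?d w v)) < \<bar>height (?d w v)\<bar>" for v w
    by (simp add: norm_minus_commute abs_minus_commute)
  have T: "{v, w} \<in> T \<longleftrightarrow> {v, w} \<in> E \<and> norm (base (?d v w)) < \<bar>height (?d v w)\<bar>" for v w
    unfolding T_def using sym by (fastforce simp: doubleton_eq_iff)
  have H: "\<bar>height (?d v w)\<bar> < norm (base (?d v w)) \<and> norm differentiable (at (base (?d v w)))"
    if "{v, w} \<in> E - T" for v w
  proof -
    have e: "{v, w} \<in> E" using that by blast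
    have "\<not> norm (base (?d v w)) < \<bar>height (?d v w)\<bar>" using that T by blast
    moreover have "\<bar>height (?d v w)\<bar> \<noteq> norm (base (?d v w))"
      using norm_cylinder_not_differentiable_lightlike edge[OF e] by blast
    ultimately have "\<bar>height (?d v w)\<bar> < norm (base (?d v w))" by linarith
    then show ?thesis using norm_differentiable_base_spacelike edge[OF e] by blast
  qed
  have "simple_graph V (E - T)" using simple_graph_subset[OF G] by blast
  moreover have "base (lookup p v) \<noteq> base (lookup p w)" if "{v, w} \<in> E - T" for v w
    using H[OF that] by auto
  ultimately have "well_positioned V (E - T) (bases p)"
    using H bases_in_families[OF p] by (simp add: well_positioned_iff)
  then have "cylindrical_splitting V (E - T) T p"
    unfolding cylindrical_splitting_def using p H T by blast
  moreover have "E = (E - T) \<union> T" by (auto simp: T_def)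
  ultimately show ?thesis using that by blast
qed

lemma
  fixes p :: "'v \<Rightarrow>\<^sub>0 'x::real_normed_vector cylinder"
  assumes G: "simple_graph V (H \<union> T)" and p: "cylindrical_splitting V H T p"
  shows well_positioned_splitting: "well_positioned V (H \<union> T) p"
    and norm_deriv_splitting_base: "{v, w} \<in> H \<Longrightarrow> norm_deriv (lookup p v - lookup p w) z
      = norm_deriv (lookup (bases p) v - lookup (bases p) w) (base z)"
    and norm_deriv_splitting_height: "{v, w} \<in> T \<Longrightarrow> norm_deriv (lookup p v - lookup p w) z
      = sgn (height (lookup p v) - height (lookup p w)) * height z"
proof -
  let ?d = "\<lambda>v w. lookup p v - lookup p w"
  have GH: "simple_graph V H" using simple_graph_subset[OF G] by blast
  have *: "p \<in> families V" "\<And>v w. {v, w} \<in> H \<Longrightarrow> \<bar>height (?d v w)\<bar> < norm (base (?d v w))"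
    "\<And>v w. {v, w} \<in> T \<Longrightarrow> norm (base (?d v w)) < \<bar>height (?d v w)\<bar>"
    "\<And>v w. {v, w} \<in> H \<Longrightarrow> norm differentiable (at (base (?d v w)))"
    using p unfolding cylindrical_splitting_def well_positioned_iff[OF GH] by auto
  have DH: "(norm has_derivative (\<lambda>h. norm_deriv (base (?d v w)) (base h))) (at (?d v w))" if "{v, w} \<in> H" for v w
    by (rule has_derivative_norm_cylinder_spacelike[OF *(2,4)[OF that]])
  have DT: "(norm has_derivative (\<lambda>h. sgn (height (?d v w)) * height h)) (at (?d v w))" if "{v, w} \<in> T" for v w
    by (rule has_derivative_norm_cylinder_timelike[OF *(3)[OF that]])
  have "norm differentiable (at (?d v w))" if "{v, w} \<in> H \<union> T" for v w
    using that DH[of v w] DT[of v w] unfolding differentiable_def by blast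
  moreover have "lookup p v \<noteq> lookup p w" if "{v, w} \<in> H \<union> T" for v w
    using that *(2,3)[of v w] by auto
  ultimately show "well_positioned V (H \<union> T) p"
    using *(1) unfolding well_positioned_iff[OF G] by blast
  show "norm_deriv (?d v w) z = norm_deriv (lookup (bases p) v - lookup (bases p) w) (base z)"
    if "{v, w} \<in> H"
    using norm_derivI[OF DH[OF that]] by simp
  show "norm_deriv (?d v w) z = sgn (height (lookup p v) - height (lookup p w)) * height z"
    if "{v, w} \<in> T"
    using norm_derivI[OF DT[OF that]] by simp
qed

section \<open>Splitting of rigidity and independence\<close>

definition cylinder_family :: "'v set \<Rightarrow> ('v \<Rightarrow> 'x::real_normed_vector) \<Rightarrow> ('v \<Rightarrow> real) \<Rightarrow> ('v \<Rightarrow>\<^sub>0 'x cylinder)" where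
  "cylinder_family V q h = family_of V (\<lambda>v. Cyl (q v) (h v))"

lemma lookup_cylinder_family:
  "finite V \<Longrightarrow> v \<in> V \<Longrightarrow> lookup (cylinder_family V q h) v = Cyl (q v) (h v)"
  by (simp add: cylinder_family_def lookup_family_of)

lemma cylinder_family_in_families: "finite V \<Longrightarrow> cylinder_family V q h \<in> families V"
  unfolding cylinder_family_def by (rule family_of_in_families)

lemma bases_cylinder_family:
  assumes "finite V" "q \<in> families V"
  shows "bases (cylinder_family V (lookup q) h) = q"
  using assms
  by (intro families_eqI[of _ V] bases_in_families cylinder_family_in_families)
    (simp_all add: lookup_cylinder_family)

lemma graph_connected_constant:
  assumes "graph_connected V T" "\<And>v w. {v, w} \<in> T \<Longrightarrow> h v = h w" "v \<in> V" "w \<in> V"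
  shows "h v = h w"
proof -
  have "(v, w) \<in> (adjacency T)\<^sup>*" using assms unfolding graph_connected_def by blast
  then show ?thesis by (induction rule: rtrancl_induct) (use assms(2) in auto)
qed

text \<open>A kernel element is a kernel element of the base together with heights that agree along
  \<open>T\<close>; a trivial motion is a trivial motion of the base together with constant heights.
  The two descriptions are compared on test motions that move only the base or only the
  heights.\<close>

lemma infinitesimally_rigid_splitting_iff:
  fixes p :: "'v \<Rightarrow>\<^sub>0 'x::real_normed_vector cylinder" and B :: "'x set"
  assumes B: "finite B" "span B = UNIV"
    and G: "simple_graph V (H \<union> T)" and p: "cylindrical_splitting V H T p"
  shows "infinitesimally_rigid V (H \<union> T) p \<longleftrightarrow> infinitesimally_rigid V H (bases p) \<and> graph_connected V T"
proof -
  have fin: "finite V" using simple_graph_finite[OF G] by blast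
  have GH: "simple_graph V H" and GT: "simple_graph V T" using simple_graph_subset[OF G] by blast+
  have wpH: "well_positioned V H (bases p)" using p unfolding cylindrical_splitting_def by blast
  have wp: "well_positioned V (H \<union> T) p" by (rule well_positioned_splitting[OF G p])
  have hT: "height (lookup p v) \<noteq> height (lookup p w)" if "{v, w} \<in> T" for v w
    using p that unfolding cylindrical_splitting_def by force
  define K where "K = {u \<in> families V. rigidity_deriv V (H \<union> T) p u = 0}"
  define K' where "K' = {u \<in> families V. rigidity_deriv V H (bases p) u = 0}"
  have K: "u \<in> K \<longleftrightarrow> u \<in> families V \<and> bases u \<in> K' \<and>
      (\<forall>v w. {v, w} \<in> T \<longrightarrow> height (lookup u v) = height (lookup u w))" for u
  proof (cases "u \<in> families V")
    case True
    have "u \<in> K \<longleftrightarrow>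
       (\<forall>v w. {v, w} \<in> H \<longrightarrow> norm_deriv (lookup p v - lookup p w)
          (lookup u v - lookup u w) = 0) \<and>
       (\<forall>v w. {v, w} \<in> T \<longrightarrow> norm_deriv (lookup p v - lookup p w)
          (lookup u v - lookup u w) = 0)"
      using rigidity_deriv_eq_0_iff[OF G wp True] True unfolding K_def by blast
    also have "(\<forall>v w. {v, w} \<in> H \<longrightarrow> norm_deriv (lookup p v - lookup p w)
          (lookup u v - lookup u w) = 0) \<longleftrightarrow> bases u \<in> K'"
      unfolding K'_def
      using rigidity_deriv_eq_0_iff[OF GH wpH bases_in_families[OF True]] bases_in_families[OF True]
        norm_deriv_splitting_base[OF G p] by simp
    also have "(\<forall>v w. {v, w} \<in> T \<longrightarrow> norm_deriv (lookup p v - lookup p w)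
          (lookup u v - lookup u w) = 0) \<longleftrightarrow>
        (\<forall>v w. {v, w} \<in> T \<longrightarrow> height (lookup u v) = height (lookup u w))"
      using hT norm_deriv_splitting_height[OF G p] by (simp add: sgn_zero_iff)
    finally show ?thesis using True by blast
  qed (simp add: K_def)
  have Tr: "u \<in> trivial_motions V p \<longleftrightarrow> u \<in> families V \<and> bases u \<in> trivial_motions V (bases p) \<and>
      (\<forall>v\<in>V. \<forall>w\<in>V. height (lookup u v) = height (lookup u w))" for u
  proof
    assume "u \<in> trivial_motions V p"
    then obtain \<xi> where u: "u \<in> families V" "\<xi> \<in> infinitesimal_rigid_motions"
      "\<And>v. v \<in> V \<Longrightarrow> lookup u v = \<xi> (lookup p v)"
      unfolding trivial_motions_def by blast
    obtain \<eta> c where \<eta>: "\<eta> \<in> infinitesimal_rigid_motions" "\<And>z. \<xi> z = Cyl (\<eta> (base z)) c"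
      using cylinder_infinitesimal_rigid_motionE[OF B u(2)] by metis
    then have "\<forall>v\<in>V. lookup (bases u) v = \<eta> (lookup (bases p) v)"
      using u(3) by simp
    then have "bases u \<in> trivial_motions V (bases p)"
      unfolding trivial_motions_def using bases_in_families[OF u(1)] \<eta>(1) by blast
    then show "u \<in> families V \<and> bases u \<in> trivial_motions V (bases p) \<and>
      (\<forall>v\<in>V. \<forall>w\<in>V. height (lookup u v) = height (lookup u w))"
      using u \<eta>(2) by simp
  next
    assume *: "u \<in> families V \<and> bases u \<in> trivial_motions V (bases p) \<and>
      (\<forall>v\<in>V. \<forall>w\<in>V. height (lookup u v) = height (lookup u w))"
    then obtain \<eta> where \<eta>: "\<eta> \<in> infinitesimal_rigid_motions"
      "\<And>v. v \<in> V \<Longrightarrow> base (lookup u v) = \<eta> (base (lookup p v))"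
      unfolding trivial_motions_def by auto
    obtain c where c: "\<And>v. v \<in> V \<Longrightarrow> height (lookup u v) = c"
      using * by (metis (full_types))
    have "\<forall>v\<in>V. lookup u v = Cyl (\<eta> (base (lookup p v))) c"
      using \<eta>(2) c by (auto intro: cylinder.expand)
    then show "u \<in> trivial_motions V p"
      unfolding trivial_motions_def using * cylinder_rigid_motion[OF \<eta>(1), of c]
      by (intro CollectI conjI bexI[of _ "\<lambda>z. Cyl (\<eta> (base z)) c"]) simp_all
  qed
  have sub': "trivial_motions V (bases p) \<subseteq> K'"
    unfolding K'_def by (rule trivial_motions_subset_kernel[OF GH wpH])
  have zero_trivial: "0 \<in> trivial_motions V (bases p)"
    unfolding trivial_motions_def using translation_infinitesimal_rigid_motion[of "0::'x"]
    by (intro CollectI conjI bexI[of _ "\<lambda>x. 0"]) (simp_all add: families_def)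
  have "K = trivial_motions V p \<longleftrightarrow> K' = trivial_motions V (bases p) \<and> graph_connected V T"
  proof
    assume eq: "K = trivial_motions V p"
    have "x \<in> trivial_motions V (bases p)" if x: "x \<in> K'" for x
    proof -
      have xV: "x \<in> families V" using x by (simp add: K'_def)
      \<comment> \<open>A kernel element of the base, lifted with height 0, tests the base
        alone.\<close>
      define u where "u = cylinder_family V (lookup x) (\<lambda>v. 0)"
      have bu: "bases u = x" unfolding u_def by (rule bases_cylinder_family[OF fin xV])
      have "u \<in> K" unfolding K bu
      proof (intro conjI allI impI)
        show "u \<in> families V" unfolding u_def by (rule cylinder_family_in_families[OF fin])
        fix v w assume "{v, w} \<in> T"
        then have "v \<in> V" "w \<in> V" using simple_graph_edgeD[OF GT] by blast+
        then show "height (lookup u v) = height (lookup u w)"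
          by (simp add: u_def lookup_cylinder_family[OF fin])
      qed (rule x)
      then show ?thesis using eq Tr bu by auto
    qed
    moreover have "graph_connected V T"
      unfolding graph_connected_def
    proof (intro ballI)
      fix a b assume ab: "a \<in> V" "b \<in> V"
      \<comment> \<open>The indicator of the component of \<open>a\<close> in \<open>T\<close>, with
        base 0, is a kernel element; it is trivial only if \<open>b\<close> lies in that
        component.\<close>
      define h where "h v = (if (a, v) \<in> (adjacency T)\<^sup>* then 1 else 0 :: real)" for v
      define u where "u = cylinder_family V (lookup (0 :: 'v \<Rightarrow>\<^sub>0 'x)) h"
      have bu: "bases u = 0" unfolding u_def by (rule bases_cylinder_family[OF fin]) (simp add: families_def)
      have hu: "height (lookup u v) = h v" if "v \<in> V" for v
        using that by (simp add: u_def lookup_cylinder_family[OF fin])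
      have "u \<in> K" unfolding K bu
      proof (intro conjI allI impI)
        show "u \<in> families V" unfolding u_def by (rule cylinder_family_in_families[OF fin])
        show "0 \<in> K'" using zero_trivial sub' by blast
        fix v w assume vw: "{v, w} \<in> T"
        then have V: "v \<in> V" "w \<in> V" using simple_graph_edgeD[OF GT] by blast+
        have e: "(v, w) \<in> adjacency T" "(w, v) \<in> adjacency T"
          using vw insert_commute[of v w "{}"] by auto
        have "h v = h w"
          unfolding h_def
          using rtrancl.rtrancl_into_rtrancl[OF _ e(1), of a] rtrancl.rtrancl_into_rtrancl[OF _ e(2), of a]
          by argo
        then show "height (lookup u v) = height (lookup u w)"
          using hu V by simp
      qed
      then have "height (lookup u a) = height (lookup u b)"
        using ab unfolding eq Tr by blast
      then have "h a = h b" using hu ab by simp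
      moreover have "h a = 1" by (simp add: h_def)
      ultimately show "(a, b) \<in> (adjacency T)\<^sup>*" unfolding h_def by (metis zero_neq_one)
    qed
    ultimately show "K' = trivial_motions V (bases p) \<and> graph_connected V T" using sub' by blast
  next
    assume *: "K' = trivial_motions V (bases p) \<and> graph_connected V T"
    have "u \<in> trivial_motions V p" if u: "u \<in> K" for u
    proof -
      have "height (lookup u v) = height (lookup u w)" if "v \<in> V" "w \<in> V" for v w
        using u * that unfolding K
        by (intro graph_connected_constant[of V T "\<lambda>v. height (lookup u v)" v w]) blast+
      then show ?thesis using u * unfolding Tr K by blast
    qed
    moreover have "trivial_motions V p \<subseteq> K"
      unfolding K_def by (rule trivial_motions_subset_kernel[OF G wp])
    ultimately show "K = trivial_motions V p" by blast
  qed
  then show ?thesis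
    unfolding infinitesimally_rigid_def K_def K'_def using wp wpH by blast
qed

text \<open>The equations of \<open>H\<close> involve only the bases of \<open>u\<close> and those
  of \<open>T\<close> only its heights, so solutions of the two systems for the same right side
  combine.\<close>

lemma independent_splitting_iff:
  fixes p :: "'v \<Rightarrow>\<^sub>0 'x::real_normed_vector cylinder"
  assumes G: "simple_graph V (H \<union> T)" and p: "cylindrical_splitting V H T p"
  shows "independent_framework V (H \<union> T) p \<longleftrightarrow> independent_framework V H (bases p) \<and> graph_forest T"
proof -
  have fin: "finite V" using simple_graph_finite[OF G] by blast
  have GH: "simple_graph V H" and GT: "simple_graph V T" using simple_graph_subset[OF G] by blast+
  have wpH: "well_positioned V H (bases p)" and disj: "H \<inter> T = {}"
    using p unfolding cylindrical_splitting_def by blast+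
  have wp: "well_positioned V (H \<union> T) p" by (rule well_positioned_splitting[OF G p])
  define k where "k v = height (lookup p v)" for v
  have k: "k v \<noteq> k w" if "{v, w} \<in> T" for v w
    using p that unfolding cylindrical_splitting_def k_def by force
  define P where "P u r \<longleftrightarrow> (\<forall>v w. {v, w} \<in> H \<longrightarrow>
      norm_deriv (lookup (bases p) v - lookup (bases p) w)
        (lookup u v - lookup u w) = r {v, w})" for u r
  define Q where "Q h r \<longleftrightarrow> (\<forall>v w. {v, w} \<in> T \<longrightarrow> sgn (k v - k w) * (h v - h w) = r {v, w})" for h :: "'v \<Rightarrow> real" and r
  have split: "(\<forall>v w. {v, w} \<in> H \<union> T \<longrightarrow>
      norm_deriv (lookup p v - lookup p w)
        (lookup u v - lookup u w) = r {v, w}) \<longleftrightarrow>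
      P (bases u) r \<and> Q (\<lambda>v. height (lookup u v)) r" for u r
    unfolding P_def Q_def k_def
    using norm_deriv_splitting_base[OF G p] norm_deriv_splitting_height[OF G p] by auto
  have "(\<forall>r. \<exists>u\<in>families V. P (bases u) r \<and> Q (\<lambda>v. height (lookup u v)) r) \<longleftrightarrow>
      (\<forall>r. \<exists>u\<in>families V. P u r) \<and> (\<forall>r. \<exists>h. Q h r)"
  proof
    assume "\<forall>r. \<exists>u\<in>families V. P (bases u) r \<and> Q (\<lambda>v. height (lookup u v)) r"
    then show "(\<forall>r. \<exists>u\<in>families V. P u r) \<and> (\<forall>r. \<exists>h. Q h r)"
      using bases_in_families by metis
  next
    assume *: "(\<forall>r. \<exists>u\<in>families V. P u r) \<and> (\<forall>r. \<exists>h. Q h r)"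
    show "\<forall>r. \<exists>u\<in>families V. P (bases u) r \<and> Q (\<lambda>v. height (lookup u v)) r"
    proof
      fix r
      obtain x h where x: "x \<in> families V" "P x r" and h: "Q h r" using * by metis
      let ?u = "cylinder_family V (lookup x) h"
      have "Q (\<lambda>v. height (lookup ?u v)) r"
        using h simple_graph_edgeD[OF GT] unfolding Q_def by (simp add: lookup_cylinder_family[OF fin])
      moreover have "P (bases ?u) r" using x bases_cylinder_family[OF fin x(1)] by simp
      ultimately show "\<exists>u\<in>families V. P (bases u) r \<and> Q (\<lambda>v. height (lookup u v)) r"
        using cylinder_family_in_families[OF fin] by blast
    qed
  qed
  moreover have "independent_framework V (H \<union> T) p \<longleftrightarrow>
      (\<forall>r. \<exists>u\<in>families V. P (bases u) r \<and> Q (\<lambda>v. height (lookup u v)) r)"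
    unfolding independent_framework_iff[OF G] split using wp by blast
  moreover have "independent_framework V H (bases p) \<longleftrightarrow> (\<forall>r. \<exists>u\<in>families V. P u r)"
    unfolding independent_framework_iff[OF GH] P_def using wpH by blast
  moreover have "graph_forest T \<longleftrightarrow> (\<forall>r. \<exists>h. Q h r)"
    unfolding Q_def by (rule graph_forest_iff_surjective[OF GT k])
  ultimately show ?thesis by blast
qed

section \<open>Realising a forest by heights\<close>

text \<open>
  Minimising the norm over the Euclidean unit circle of a plane yields a Euclidean norm on that
  plane that is dominated by the given norm and agrees with it at one unit vector \<open>x\<close>.
\<close>

lemma touching_euclidean_plane:
  fixes B :: "'x::real_normed_vector set"
  assumes B: "finite B" "span B = UNIV" and dim: "dim (UNIV :: 'x set) \<ge> 2"
  obtains x e :: 'x where "norm x = 1" "\<And>s t. sqrt (s\<^sup>2 + t\<^sup>2) \<le> norm (s *\<^sub>R x + t *\<^sub>R e)"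
proof -
  have "finite_spanned (UNIV :: 'x set)" using B unfolding finite_spanned_def by blast
  then obtain C :: "'x set" where C: "finite C" "independent C" "card C = dim (UNIV :: 'x set)"
    by (elim finite_spanned_basis)
  then obtain a b where ab: "a \<in> C" "b \<in> C" "a \<noteq> b"
    using dim by (metis One_nat_def card_le_Suc0_iff_eq not_less_eq_eq numeral_2_eq_2)
  have ind: "s = 0 \<and> t = 0" if "s *\<^sub>R a + t *\<^sub>R b = 0" for s t
  proof -
    have "independent {a, b}" using C(2) ab by (meson empty_subsetI independent_mono insert_subset)
    then have "independent_family {a, b} (\<lambda>b. b)" by (intro independent_imp_independent_family) auto
    note F = this[unfolded independent_family_def, THEN spec, of "\<lambda>y. if y = a then s else t", THEN mp]
    have "\<forall>y\<in>{a, b}. (if y = a then s else t) = 0" by (rule F) (use that ab in simp)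
    then show ?thesis using ab by simp
  qed
  define N where "N z = norm (fst z *\<^sub>R a + snd z *\<^sub>R b)" for z :: "real \<times> real"
  have "continuous_on (sphere 0 1) N" unfolding N_def by (intro continuous_intros)
  moreover have "sphere (0 :: real \<times> real) 1 \<noteq> {}" by simp
  ultimately obtain z where z: "z \<in> sphere 0 1" "\<And>y. y \<in> sphere 0 1 \<Longrightarrow> N z \<le> N y"
    using continuous_attains_inf[OF compact_sphere] by blast
  define m where "m = N z"
  have z1: "(fst z)\<^sup>2 + (snd z)\<^sup>2 = 1" using z(1) by (simp add: norm_prod_def)
  have m: "m > 0"
  proof -
    have "m \<noteq> 0"
    proof
      assume "m = 0"
      then have "fst z = 0 \<and> snd z = 0" using ind unfolding m_def N_def by simp
      then show False using z1 by simp
    qed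
    then show ?thesis by (simp add: m_def N_def)
  qed
  have ge: "m * norm y \<le> N y" for y
  proof (cases "y = 0")
    case False
    have "(1 / norm y) *\<^sub>R y \<in> sphere 0 1" using False by simp
    from z(2)[OF this] have "m \<le> N ((1 / norm y) *\<^sub>R y)" by (simp add: m_def)
    also have "\<dots> = norm ((1 / norm y) *\<^sub>R (fst y *\<^sub>R a + snd y *\<^sub>R b))"
      by (simp add: N_def scaleR_add_right)
    also have "\<dots> = N y / norm y" by (simp add: N_def)
    finally show ?thesis using False by (simp add: field_simps)
  qed (simp add: N_def)
  \<comment> \<open>\<open>x\<close> is the minimiser \<open>z\<close> scaled to norm 1, and
    \<open>e\<close> is \<open>z\<close> turned by a right angle in the coordinates of
    \<open>a\<close> and \<open>b\<close>, with the same scaling.\<close>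
  define x where "x = (1 / m) *\<^sub>R (fst z *\<^sub>R a + snd z *\<^sub>R b)"
  define e where "e = (1 / m) *\<^sub>R (- snd z *\<^sub>R a + fst z *\<^sub>R b)"
  have "norm x = 1" using m by (simp add: x_def m_def N_def)
  moreover have "sqrt (s\<^sup>2 + t\<^sup>2) \<le> norm (s *\<^sub>R x + t *\<^sub>R e)" for s t
  proof -
    \<comment> \<open>As complex numbers, \<open>y\<close> is the product of \<open>(s, t)\<close>
      and the unit vector \<open>z\<close>, so its Euclidean norm is that of
      \<open>(s, t)\<close>.\<close>
    define y where "y = (s * fst z - t * snd z, s * snd z + t * fst z)"
    have "(norm y)\<^sup>2 = (fst y)\<^sup>2 + (snd y)\<^sup>2" by (simp add: norm_prod_def)
    also have "\<dots> = (s\<^sup>2 + t\<^sup>2) * ((fst z)\<^sup>2 + (snd z)\<^sup>2)"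
      by (simp add: y_def power2_eq_square algebra_simps)
    finally have "(norm y)\<^sup>2 = (s\<^sup>2 + t\<^sup>2) * ((fst z)\<^sup>2 + (snd z)\<^sup>2)" .
    then have "norm y = sqrt (s\<^sup>2 + t\<^sup>2)" using z1 by (metis mult.right_neutral norm_ge_zero real_sqrt_unique)
    then have "m * sqrt (s\<^sup>2 + t\<^sup>2) \<le> N y" using ge[of y] by simp
    moreover have "s *\<^sub>R x + t *\<^sub>R e = (1 / m) *\<^sub>R (fst y *\<^sub>R a + snd y *\<^sub>R b)"
      by (simp add: x_def e_def y_def algebra_simps add_divide_distrib diff_divide_distrib)
    then have "norm (s *\<^sub>R x + t *\<^sub>R e) = N y / m" using m by (simp add: N_def)
    then have "m * norm (s *\<^sub>R x + t *\<^sub>R e) = N y" using m by simp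
    ultimately have "m * sqrt (s\<^sup>2 + t\<^sup>2) \<le> m * norm (s *\<^sub>R x + t *\<^sub>R e)" by simp
    then show ?thesis using m by simp
  qed
  ultimately show ?thesis by (rule that)
qed

text \<open>
  Level \<open>m\<close> is placed near the line parallel to \<open>e\<close> through \<open>a m *\<^sub>R x\<close>. Consecutive levels
  are a little less than \<open>1\<close> apart, so that a vertex, put very close to the point opposite to its
  parent, has distance less than \<open>1\<close> to its parent but, by the Euclidean bound, more than \<open>1\<close> to
  the other vertices of the level of the parent.
\<close>

lemma layered_forest_levels:
  fixes x e :: "'x::real_normed_vector"
  assumes V: "finite V" and F: "layered_forest V T l par"
    and x: "norm x = 1"
  shows "\<exists>(a :: nat \<Rightarrow> real) (t :: 'v \<Rightarrow> real).
    (\<forall>m<n. 1/2 < a (Suc m) - a m) \<and>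
    (\<forall>v\<in>V. \<forall>w\<in>V. l v = l w \<longrightarrow> l v \<le> n \<longrightarrow> v \<noteq> w \<longrightarrow> t v \<noteq> t w) \<and>
    (\<forall>v\<in>V. \<forall>w\<in>V. l w = Suc (l v) \<longrightarrow> l w \<le> n \<longrightarrow>
       (if v = par w then norm ((a (l w) - a (l v)) *\<^sub>R x + (t w - t v) *\<^sub>R e) < 1
        else 1 < (a (l w) - a (l v))\<^sup>2 + (t w - t v)\<^sup>2))"
proof (induction n)
  case 0
  obtain idx :: "'v \<Rightarrow> nat" where idx: "inj_on idx V"
    using V finite_imp_inj_to_nat_seg by metis
  show ?case
  proof (intro exI[of _ "\<lambda>m :: nat. 0 :: real"] exI[of _ "\<lambda>v. real (idx v)"] conjI)
    show "\<forall>v\<in>V. \<forall>w\<in>V. l v = l w \<longrightarrow> l v \<le> 0 \<longrightarrow> v \<noteq> w \<longrightarrow> real (idx v) \<noteq> real (idx w)"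
      using idx by (auto simp: inj_on_def)
  qed auto
next
  case (Suc n)
  obtain idx :: "'v \<Rightarrow> nat" where idx: "inj_on idx V"
    using V finite_imp_inj_to_nat_seg by metis
  obtain a :: "nat \<Rightarrow> real" and t where
    step: "\<And>m. m < n \<Longrightarrow> 1/2 < a (Suc m) - a m" and
    inj: "\<And>v w. v \<in> V \<Longrightarrow> w \<in> V \<Longrightarrow> l v = l w \<Longrightarrow> l v \<le> n \<Longrightarrow> v \<noteq> w \<Longrightarrow> t v \<noteq> t w" and
    near: "\<And>v w. v \<in> V \<Longrightarrow> w \<in> V \<Longrightarrow> l w = Suc (l v) \<Longrightarrow> l w \<le> n \<Longrightarrow>
       (if v = par w then norm ((a (l w) - a (l v)) *\<^sub>R x + (t w - t v) *\<^sub>R e) < 1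
        else 1 < (a (l w) - a (l v))\<^sup>2 + (t w - t v)\<^sup>2)"
    using Suc.IH by blast
  \<comment> \<open>\<open>d\<close> is half the smallest gap on level \<open>n\<close>, capped at
    1. A sideways shift of a child by less than \<open>d\<close> then leaves a gap of at least
    \<open>d\<close> to every other vertex of that level.\<close>
  define S where "S = insert 1 ((\<lambda>(v, w). \<bar>t v - t w\<bar> / 2) ` {(v, w) \<in> V \<times> V. l v = n \<and> l w = n \<and> v \<noteq> w})"
  define d where "d = Min S"
  have "finite {(v, w) \<in> V \<times> V. l v = n \<and> l w = n \<and> v \<noteq> w}"
    by (rule finite_subset[of _ "V \<times> V"]) (use V in auto)
  then have S: "finite S" "S \<noteq> {}" unfolding S_def by auto
  have "\<forall>s\<in>S. s > 0" using inj unfolding S_def by fastforce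
  then have d: "0 < d" "d \<le> 1" using S unfolding d_def by (auto simp: S_def)
  have apart: "2 * d \<le> \<bar>t v - t w\<bar>" if "v \<in> V" "w \<in> V" "l v = n" "l w = n" "v \<noteq> w" for v w
  proof -
    have "\<bar>t v - t w\<bar> / 2 \<in> S" using that unfolding S_def by force
    then have "d \<le> \<bar>t v - t w\<bar> / 2" unfolding d_def using S(1) by (rule Min_le[rotated])
    then show ?thesis by simp
  qed
  \<comment> \<open>The level distance is below 1, which leaves \<open>1 - c\<close> for the shift
    of a child from the foot of its parent, yet \<open>c\<^sup>2 > 1 - d\<^sup>2\<close> puts every
    vertex at sideways distance \<open>d\<close> beyond 1.\<close>
  define c where "c = 1 - d\<^sup>2 / 4"
  have "0 < d\<^sup>2" "d\<^sup>2 \<le> 1" using d by (simp_all add: power_le_one)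
  moreover have "c\<^sup>2 = 1 - d\<^sup>2 / 2 + (d\<^sup>2 / 4)\<^sup>2" by (simp add: c_def power2_diff)
  ultimately have c: "1/2 < c" "c < 1" "1 < c\<^sup>2 + d\<^sup>2"
    using zero_le_power2[of "d\<^sup>2 / 4"] unfolding c_def by linarith+
  define M where "M = Suc (Max (insert 0 (idx ` V)))"
  have M: "real (idx v) < real M" if "v \<in> V" for v
  proof -
    have "idx v \<le> Max (insert 0 (idx ` V))" using that V by (intro Max_ge) auto
    then show ?thesis by (simp add: M_def)
  qed
  have Mpos: "0 < real M" by (simp add: M_def)
  define k where "k = norm e + 1"
  have ne: "0 < k" using norm_ge_zero[of e] unfolding k_def by linarith
  \<comment> \<open>The unit of the shifts: shifts stay below \<open>\<eta> * real M\<close>, which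
    must be less than \<open>d\<close> and, measured by \<open>norm e\<close>, less than
    \<open>1 - c\<close>. The added 1 in \<open>k\<close> avoids dividing by a zero norm.\<close>
  define \<eta> where "\<eta> = min (d / (2 * real M)) ((1 - c) / (2 * real M * k))"
  have \<eta>: "0 < \<eta>" unfolding \<eta>_def using d c Mpos ne by simp
  have \<eta>1: "\<eta> * real M < d"
  proof -
    have "\<eta> * real M \<le> d / (2 * real M) * real M" using Mpos by (intro mult_right_mono) (auto simp: \<eta>_def)
    also have "\<dots> < d" using d Mpos by simp
    finally show ?thesis .
  qed
  have \<eta>2: "\<eta> * real M * norm e < 1 - c"
  proof -
    have "\<eta> * (real M * k) \<le> (1 - c) / (2 * real M * k) * (real M * k)"
      using Mpos ne by (intro mult_right_mono) (auto simp: \<eta>_def)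
    also have "\<dots> = (1 - c) / 2" using Mpos ne by simp
    finally have "\<eta> * real M * norm e + \<eta> * real M \<le> (1 - c) / 2" by (simp add: k_def algebra_simps)
    moreover have "\<eta> * real M * norm e < \<eta> * real M * norm e + \<eta> * real M" using \<eta> Mpos by simp
    moreover have "(1 - c) / 2 < 1 - c" using c(2) by simp
    ultimately show ?thesis by (meson le_less_trans less_le_trans less_trans)
  qed
  have small: "0 \<le> \<eta> * real (idx v)" "\<eta> * real (idx v) \<le> \<eta> * real M" if "v \<in> V" for v
    using \<eta> M[OF that] by auto
  define a' where "a' m = (if m \<le> n then a m else a n + c)" for m
  \<comment> \<open>Each child is placed opposite its parent with a shift proportional to its own
    index, so that siblings are separated too.\<close>
  define t' where "t' v = (if l v = Suc n then t (par v) + \<eta> * real (idx v) else t v)" for v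
  have par: "par v \<in> V" "l (par v) = n" if "v \<in> V" "l v = Suc n" for v
    using F that unfolding layered_forest_def by auto
  show ?case
  proof (intro exI[of _ a'] exI[of _ t'] conjI allI ballI impI)
    fix m assume "m < Suc n"
    then show "1/2 < a' (Suc m) - a' m" using step[of m] c by (auto simp: a'_def less_Suc_eq)
  next
    fix v w assume vw: "v \<in> V" "w \<in> V" "l v = l w" "l v \<le> Suc n" "v \<noteq> w"
    show "t' v \<noteq> t' w"
    proof (cases "l v = Suc n")
      case False
      then show ?thesis using vw inj[of v w] by (simp add: t'_def)
    next
      case True
      note small_vw = small[OF vw(1)] small[OF vw(2)]
      show ?thesis
      proof (cases "par v = par w")
        case True
        have "idx v \<noteq> idx w" using idx vw by (auto simp: inj_on_def)
        then show ?thesis using True \<open>l v = Suc n\<close> vw \<eta> by (simp add: t'_def)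
      next
        case False
        have "2 * d \<le> \<bar>t (par v) - t (par w)\<bar>"
          using apart[of "par v" "par w"] par[of v] par[of w] vw True False by simp
        then show ?thesis using True vw(3) small_vw \<eta>1 d by (auto simp: t'_def)
      qed
    qed
  next
    fix v w assume vw: "v \<in> V" "w \<in> V" "l w = Suc (l v)" "l w \<le> Suc n"
    show "if v = par w then norm ((a' (l w) - a' (l v)) *\<^sub>R x + (t' w - t' v) *\<^sub>R e) < 1
        else 1 < (a' (l w) - a' (l v))\<^sup>2 + (t' w - t' v)\<^sup>2"
    proof (cases "l w = Suc n")
      case False
      then have "l w \<le> n" using vw by simp
      then have "a' (l w) = a (l w)" "a' (l v) = a (l v)" "t' w = t w" "t' v = t v"
        using vw(3) by (simp_all add: a'_def t'_def)
      then show ?thesis using near[OF vw(1-3) \<open>l w \<le> n\<close>] by (simp only:)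
    next
      case True
      then have lv: "l v = n" using vw(3) by simp
      have a'c: "a' (l w) - a' (l v) = c" using True lv by (simp add: a'_def)
      have t'd: "t' w - t' v = t (par w) - t v + \<eta> * real (idx w)" using True lv by (simp add: t'_def)
      show ?thesis
      proof (cases "v = par w")
        case eq: True
        have "norm (c *\<^sub>R x + (\<eta> * real (idx w)) *\<^sub>R e) \<le> norm (c *\<^sub>R x) + norm ((\<eta> * real (idx w)) *\<^sub>R e)"
          by (rule norm_triangle_ineq)
        also have "\<dots> = c + \<eta> * real (idx w) * norm e" using x c \<eta> by simp
        also have "\<dots> \<le> c + \<eta> * real M * norm e"
          using small(2)[OF vw(2)] by (intro add_left_mono mult_right_mono) auto
        also have "\<dots> < 1" using \<eta>2 by simp
        finally show ?thesis unfolding a'c t'd using eq by simp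
      next
        case False
        have "2 * d \<le> \<bar>t (par w) - t v\<bar>"
          using apart[of "par w" v] par[OF vw(2) True] vw lv False by auto
        then have "\<bar>d\<bar> \<le> \<bar>t (par w) - t v + \<eta> * real (idx w)\<bar>"
          using small[OF vw(2)] \<eta>1 d by linarith
        then have "d\<^sup>2 \<le> (t (par w) - t v + \<eta> * real (idx w))\<^sup>2" by (simp only: abs_le_square_iff)
        then show ?thesis unfolding a'c t'd using False c(3) by simp
      qed
    qed
  qed
qed

text \<open>The height is the parity of the level. Consecutive levels differ in height by 1, and
  base distance below or above 1 tells edges from non-edges. At an even level difference the heights
  agree and distinct vertices have distinct bases; at an odd difference of at least 3, steps above
  1/2 make the base distance at least 3/2.\<close>

lemma forest_placement:
  fixes B :: "'x::real_normed_vector set" and V :: "'v set"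
  assumes B: "finite B" "span B = UNIV" and dim: "dim (UNIV :: 'x set) \<ge> 2"
    and V: "finite V" and F: "layered_forest V T l par"
  obtains q :: "'v \<Rightarrow> 'x" and h :: "'v \<Rightarrow> real" where
    "\<And>v w. v \<in> V \<Longrightarrow> w \<in> V \<Longrightarrow> {v, w} \<in> T \<Longrightarrow> norm (q v - q w) < \<bar>h v - h w\<bar>"
    "\<And>v w. v \<in> V \<Longrightarrow> w \<in> V \<Longrightarrow> v \<noteq> w \<Longrightarrow> {v, w} \<notin> T \<Longrightarrow> \<bar>h v - h w\<bar> < norm (q v - q w)"
proof -
  obtain x e :: 'x where xe: "norm x = 1" "\<And>s t. sqrt (s\<^sup>2 + t\<^sup>2) \<le> norm (s *\<^sub>R x + t *\<^sub>R e)"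
    using touching_euclidean_plane[OF B dim] by metis
  define n where "n = Max (insert 0 (l ` V))"
  have n: "l v \<le> n" if "v \<in> V" for v using that V by (simp add: n_def)
  obtain a :: "nat \<Rightarrow> real" and t where
    step: "\<And>m. m < n \<Longrightarrow> 1/2 < a (Suc m) - a m" and
    inj: "\<And>v w. v \<in> V \<Longrightarrow> w \<in> V \<Longrightarrow> l v = l w \<Longrightarrow> v \<noteq> w \<Longrightarrow> t v \<noteq> t w" and
    near: "\<And>v w. v \<in> V \<Longrightarrow> w \<in> V \<Longrightarrow> l w = Suc (l v) \<Longrightarrow>
       (if v = par w then norm ((a (l w) - a (l v)) *\<^sub>R x + (t w - t v) *\<^sub>R e) < 1
        else 1 < (a (l w) - a (l v))\<^sup>2 + (t w - t v)\<^sup>2)"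
    using layered_forest_levels[OF V F xe(1), of n e] n by blast
  define q where "q v = a (l v) *\<^sub>R x + t v *\<^sub>R e" for v
  define h where "h v = real (l v mod 2)" for v
  have q_diff: "q w - q v = (a (l w) - a (l v)) *\<^sub>R x + (t w - t v) *\<^sub>R e" for v w
    by (simp add: q_def algebra_simps)
  have sum_le: "1/2 * real k \<le> a (m + k) - a m" if "m + k \<le> n" for m k
    using that
  proof (induction k)
    case (Suc k)
    have "1/2 * real k \<le> a (m + k) - a m" using Suc by simp
    moreover have "1/2 < a (Suc (m + k)) - a (m + k)" using step[of "m + k"] Suc.prems by simp
    ultimately show ?case by (simp add: field_simps)
  qed simp
  have levels: "1/2 * real k \<le> norm (q w - q v)" if "v \<in> V" "w \<in> V" "l w = l v + k" for v w k
  proof -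
    have "1/2 * real k \<le> a (l w) - a (l v)" using sum_le[of "l v" k] n[OF that(2)] that(3) by simp
    also have "\<dots> \<le> sqrt ((a (l w) - a (l v))\<^sup>2)" by simp
    also have "\<dots> \<le> sqrt ((a (l w) - a (l v))\<^sup>2 + (t w - t v)\<^sup>2)" by (intro real_sqrt_le_mono) simp
    also have "\<dots> \<le> norm (q w - q v)" unfolding q_diff by (rule xe(2))
    finally show ?thesis .
  qed
  have T_iff: "{v, w} \<in> T \<longleftrightarrow> l w = Suc (l v) \<and> v = par w" if "v \<in> V" "w \<in> V" "l v \<le> l w" for v w
  proof
    assume "{v, w} \<in> T"
    then obtain y where y: "y \<in> V" "l y > 0" "{v, w} = {y, par y}"
      using F unfolding layered_forest_def by blast
    have "l y = Suc (l (par y))" using F y unfolding layered_forest_def by blast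
    then show "l w = Suc (l v) \<and> v = par w" using y(3) that(3) unfolding doubleton_eq_iff by auto
  next
    assume *: "l w = Suc (l v) \<and> v = par w"
    have "T = (\<lambda>v. {v, par v}) ` {v \<in> V. l v > 0}" using F unfolding layered_forest_def by blast
    moreover have "w \<in> {v \<in> V. l v > 0}" using * that(2) by simp
    ultimately have "{w, par w} \<in> T" by blast
    moreover have "{v, w} = {w, par w}" using * by blast
    ultimately show "{v, w} \<in> T" by simp
  qed
  have main: "if {v, w} \<in> T then norm (q w - q v) < \<bar>h w - h v\<bar> else \<bar>h w - h v\<bar> < norm (q w - q v)"
    if vw: "v \<in> V" "w \<in> V" "v \<noteq> w" "l v \<le> l w" for v w
  proof -
    obtain k where k: "l w = l v + k" using vw(4) le_iff_add by blast
    have "k = 0 \<or> k = 1 \<or> (k \<ge> 2 \<and> even k) \<or> (k \<ge> 3 \<and> odd k)" by presburger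
    then consider "k = 0" | "k = 1" | "k \<ge> 2" "even k" | "k \<ge> 3" "odd k" by blast
    then show ?thesis
    proof cases
      case 1
      then have "t v \<noteq> t w" using inj vw k by simp
      then have "0 < sqrt ((a (l w) - a (l v))\<^sup>2 + (t w - t v)\<^sup>2)" by (simp add: add_nonneg_pos)
      also have "\<dots> \<le> norm (q w - q v)" unfolding q_diff by (rule xe(2))
      finally show ?thesis using T_iff[OF vw(1,2,4)] k 1 by (simp add: h_def)
    next
      case 2
      have hd: "\<bar>h w - h v\<bar> = 1" using k 2 by (cases "even (l v)") (auto simp: h_def mod_Suc even_iff_mod_2_eq_zero odd_iff_mod_2_eq_one)
      show ?thesis
      proof (cases "v = par w")
        case True
        then show ?thesis using T_iff[OF vw(1,2,4)] near[OF vw(1,2)] k 2 hd by (simp add: q_diff)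
      next
        case False
        then have "1 < (a (l w) - a (l v))\<^sup>2 + (t w - t v)\<^sup>2" using near[OF vw(1,2)] k 2 by simp
        then have "1 < sqrt ((a (l w) - a (l v))\<^sup>2 + (t w - t v)\<^sup>2)" by simp
        also have "\<dots> \<le> norm (q w - q v)" unfolding q_diff by (rule xe(2))
        finally show ?thesis using T_iff[OF vw(1,2,4)] False hd by simp
      qed
    next
      case 3
      then have "h w = h v" using k by (simp add: h_def mod_add_eq[symmetric] even_iff_mod_2_eq_zero)
      moreover have "0 < norm (q w - q v)" using levels[OF vw(1,2) k] 3(1) by linarith
      ultimately show ?thesis using T_iff[OF vw(1,2,4)] k 3 by simp
    next
      case 4
      have "l v mod 2 < 2" "l w mod 2 < 2" by simp_all
      then have "\<bar>h w - h v\<bar> \<le> 1" unfolding h_def by linarith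
      moreover have "1 < norm (q w - q v)" using levels[OF vw(1,2) k] 4(1) by linarith
      ultimately show ?thesis using T_iff[OF vw(1,2,4)] k 4 by auto
    qed
  qed
  show ?thesis
  proof (rule that[of q h])
    fix v w assume vw: "v \<in> V" "w \<in> V" "{v, w} \<in> T"
    have "v \<noteq> w"
    proof
      assume "v = w"
      then show False using T_iff[of v v] vw by simp
    qed
    then show "norm (q v - q w) < \<bar>h v - h w\<bar>"
      using main[of v w] main[of w v] vw
      by (cases "l v \<le> l w") (auto simp: norm_minus_commute abs_minus_commute insert_commute)
  next
    fix v w assume vw: "v \<in> V" "w \<in> V" "v \<noteq> w" "{v, w} \<notin> T"
    then show "\<bar>h v - h w\<bar> < norm (q v - q w)"
      using main[of v w] main[of w v] vw
      by (cases "l v \<le> l w") (auto simp: norm_minus_commute abs_minus_commute insert_commute)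
  qed
qed

section \<open>Regular placements\<close>

lemma dim_linear_image_inj:
  assumes f: "linear f" and S: "subspace S" "finite_spanned S"
    and inj: "\<And>x. x \<in> S \<Longrightarrow> f x = 0 \<Longrightarrow> x = 0"
  shows "dim (f ` S) = dim S"
proof -
  have "{x \<in> S. f x = 0} = {0}"
    using inj S(1) by (auto simp: linear_0[OF f] subspace_0)
  moreover have "dim {0 :: 'a} = 0"
    using basis_card_eq_dim[of "{}" "{0 :: 'a}"] by (simp add: independent_empty)
  ultimately show ?thesis using dim_kernel_plus_dim_image[OF f S] by simp
qed

lemma subspace_rigidity_kernel:
  assumes "well_positioned V E p"
  shows "subspace {u \<in> families V. rigidity_deriv V E p u = 0}"
  using subspace_inter[OF subspace_families[of V] linear_subspace_kernel[OF linear_rigidity_deriv[OF assms]]]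
  by (simp add: Int_def)

lemma rigidity_rank_nullity:
  fixes p :: "'v \<Rightarrow>\<^sub>0 'y::real_normed_vector" and B :: "'y set"
  assumes B: "finite B" "span B = UNIV" and G: "simple_graph V E" and wp: "well_positioned V E p"
  shows "dim (families V :: ('v \<Rightarrow>\<^sub>0 'y) set) = dim {u \<in> families V. rigidity_deriv V E p u = 0} + rigidity_rank V E p"
  unfolding rigidity_rank_def
  by (rule dim_kernel_plus_dim_image[OF linear_rigidity_deriv[OF wp] subspace_families
        finite_spanned_families[OF B]]) (rule simple_graph_finite[OF G])

section \<open>Change of the vertex type\<close>

lemma image_vertices_edge_iff:
  assumes "inj_on f V" "simple_graph V E" "v \<in> V" "w \<in> V"
  shows "{f v, f w} \<in> (`) f ` E \<longleftrightarrow> {v, w} \<in> E"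
proof
  assume "{f v, f w} \<in> (`) f ` E"
  then obtain e where e: "e \<in> E" "f ` e = f ` {v, w}" by auto
  then have "e = {v, w}"
    using inj_on_image_eq_iff[OF assms(1), of e "{v, w}"] assms(2-4) unfolding simple_graph_def by auto
  then show "{v, w} \<in> E" using e by simp
qed (force intro: image_eqI[of _ _ "{v, w}"])

lemma image_simple_graph:
  assumes "inj_on f V" "simple_graph V E"
  shows "simple_graph (f ` V) ((`) f ` E)"
  unfolding simple_graph_def
proof (intro conjI ballI)
  show "finite (f ` V)" using simple_graph_finite[OF assms(2)] by simp
  fix e assume "e \<in> (`) f ` E"
  then obtain e' where e': "e' \<in> E" "e = f ` e'" by blast
  then have "e' \<subseteq> V" "card e' = 2" using assms(2) by (auto simp: simple_graph_def)
  then show "e \<subseteq> f ` V" "card e = 2"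
    using e'(2) card_image[OF inj_on_subset[OF assms(1)]] by auto
qed

text \<open>Genericity speaks of natural numbers as vertices. Placements of a relabelled graph are
  carried back along an injection \<open>f\<close> on \<open>V\<close>.\<close>

definition pull_back :: "('v \<Rightarrow> 'w) \<Rightarrow> 'v set \<Rightarrow> ('w \<Rightarrow>\<^sub>0 'y) \<Rightarrow> ('v \<Rightarrow>\<^sub>0 'y::zero)" where
  "pull_back f V p = family_of V (\<lambda>v. lookup p (f v))"

lemma lookup_pull_back:
  "finite V \<Longrightarrow> lookup (pull_back f V p) v = (if v \<in> V then lookup p (f v) else 0)"
  by (simp add: pull_back_def lookup_family_of)

lemma pull_back_in_families: "finite V \<Longrightarrow> pull_back f V p \<in> families V"
  unfolding pull_back_def by (rule family_of_in_families)

lemma linear_pull_back: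
  "finite V \<Longrightarrow> linear (pull_back f V :: ('w \<Rightarrow>\<^sub>0 'y::real_normed_vector) \<Rightarrow> ('v \<Rightarrow>\<^sub>0 'y))"
  by (intro linearI poly_mapping_eqI) (simp_all add: lookup_pull_back lookup_add)

lemma
  fixes f :: "'v \<Rightarrow> 'w"
  assumes V: "finite V" and f: "inj_on f V"
  shows pull_back_surj: "x \<in> families V \<Longrightarrow> \<exists>y\<in>families (f ` V). pull_back f V y = (x :: 'v \<Rightarrow>\<^sub>0 'y::real_normed_vector)"
    and pull_back_norm: "y \<in> families (f ` V) \<Longrightarrow> norm (pull_back f V y :: 'v \<Rightarrow>\<^sub>0 'y) = norm y"
proof -
  show "\<exists>y\<in>families (f ` V). pull_back f V y = x" if x: "x \<in> families V" for x :: "'v \<Rightarrow>\<^sub>0 'y"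
  proof (rule bexI[of _ "family_of (f ` V) (\<lambda>n. lookup x (inv_into V f n))"])
    show "pull_back f V (family_of (f ` V) (\<lambda>n. lookup x (inv_into V f n))) = x"
      using V f by (intro families_eqI[OF pull_back_in_families[OF V] x])
        (simp add: lookup_pull_back lookup_family_of)
  qed (use V in \<open>simp add: family_of_in_families\<close>)
  show "norm (pull_back f V y :: 'v \<Rightarrow>\<^sub>0 'y) = norm y" if y: "y \<in> families (f ` V)" for y
  proof -
    have "norm (pull_back f V y) = (\<Sum>v\<in>V. norm (lookup y (f v)))"
      unfolding norm_families[OF V pull_back_in_families[OF V]]
      by (intro sum.cong) (simp_all add: lookup_pull_back[OF V])
    also have "\<dots> = norm y"
      using norm_families[OF finite_imageI[OF V] y] by (simp add: sum.reindex[OF f] o_def)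
    finally show ?thesis .
  qed
qed

text \<open>The rank is compared through the kernels, which avoids relabelling the edge coordinates:
  pulling back is injective on families, maps one kernel onto the other, and preserves the dimension
  of the whole space.\<close>

lemma
  fixes p :: "'w \<Rightarrow>\<^sub>0 'y::real_normed_vector" and f :: "'v \<Rightarrow> 'w"
  assumes G: "simple_graph V E" and f: "inj_on f V" and p: "p \<in> families (f ` V)"
  shows well_positioned_pull_back:
      "well_positioned V E (pull_back f V p) \<longleftrightarrow> well_positioned (f ` V) ((`) f ` E) p"
    and rigidity_rank_pull_back: "finite (B :: 'y set) \<Longrightarrow> span B = UNIV \<Longrightarrow>
      well_positioned (f ` V) ((`) f ` E) p \<Longrightarrow>
      rigidity_rank V E (pull_back f V p) = rigidity_rank (f ` V) ((`) f ` E) p"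
proof -
  have V: "finite V" using simple_graph_finite[OF G] by blast
  have G': "simple_graph (f ` V) ((`) f ` E)" by (rule image_simple_graph[OF f G])
  have lk: "lookup (pull_back f V x) v = lookup x (f v)" if "v \<in> V" for v and x :: "'w \<Rightarrow>\<^sub>0 'y"
    using that by (simp add: lookup_pull_back[OF V])
  have edges: "(\<forall>v w. {v, w} \<in> (`) f ` E \<longrightarrow> P v w) \<longleftrightarrow> (\<forall>v w. {v, w} \<in> E \<longrightarrow> P (f v) (f w))" for P
  proof
    assume *: "\<forall>v w. {v, w} \<in> (`) f ` E \<longrightarrow> P v w"
    show "\<forall>v w. {v, w} \<in> E \<longrightarrow> P (f v) (f w)"
    proof (intro allI impI)
      fix v w assume e: "{v, w} \<in> E"
      then have "{f v, f w} \<in> (`) f ` E"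
        using image_vertices_edge_iff[OF f G simple_graph_edgeD(1,2)[OF G e]] by simp
      then show "P (f v) (f w)" by (rule *[rule_format])
    qed
  next
    assume *: "\<forall>v w. {v, w} \<in> E \<longrightarrow> P (f v) (f w)"
    show "\<forall>v w. {v, w} \<in> (`) f ` E \<longrightarrow> P v w"
    proof (intro allI impI)
      fix v w assume e: "{v, w} \<in> (`) f ` E"
      then obtain a b where ab: "a \<in> V" "b \<in> V" "v = f a" "w = f b"
        using simple_graph_edgeD(1,2)[OF G' e] by blast
      then have "{a, b} \<in> E" using e image_vertices_edge_iff[OF f G ab(1,2)] by simp
      then show "P v w" unfolding ab(3,4) by (rule *[rule_format])
    qed
  qed
  show wp_iff: "well_positioned V E (pull_back f V p) \<longleftrightarrow> well_positioned (f ` V) ((`) f ` E) p"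
    unfolding well_positioned_iff[OF G] well_positioned_iff[OF G'] edges
    using p pull_back_in_families[OF V, of f p] simple_graph_edgeD[OF G] lk by auto
  assume B: "finite (B :: 'y set)" "span B = UNIV" and wp': "well_positioned (f ` V) ((`) f ` E) p"
  then have wp: "well_positioned V E (pull_back f V p)" using wp_iff by blast
  define K where "K = {u \<in> families V. rigidity_deriv V E (pull_back f V p) u = 0}"
  define K' where "K' = {u \<in> families (f ` V). rigidity_deriv (f ` V) ((`) f ` E) p u = 0}"
  have fV: "finite_spanned (families (f ` V) :: ('w \<Rightarrow>\<^sub>0 'y) set)"
    by (rule finite_spanned_families[OF B finite_imageI[OF V]])
  have ker: "pull_back f V u \<in> K \<longleftrightarrow> u \<in> K'" if u: "u \<in> families (f ` V)" for u
    unfolding K_def K'_def mem_Collect_eq rigidity_deriv_eq_0_iff[OF G wp pull_back_in_families[OF V]]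
      rigidity_deriv_eq_0_iff[OF G' wp' u] edges
    using u pull_back_in_families[OF V, of f u] simple_graph_edgeD[OF G] lk by auto
  have inj: "x = 0" if "x \<in> families (f ` V)" "pull_back f V x = 0" for x :: "'w \<Rightarrow>\<^sub>0 'y"
    using pull_back_norm[OF V f that(1)] that(2) by simp
  have im: "pull_back f V ` families (f ` V) = (families V :: ('v \<Rightarrow>\<^sub>0 'y) set)"
    using pull_back_surj[OF V f] pull_back_in_families[OF V] by blast
  have imK: "pull_back f V ` K' = K"
  proof
    show "pull_back f V ` K' \<subseteq> K" using ker unfolding K'_def by blast
    show "K \<subseteq> pull_back f V ` K'"
    proof
      fix x assume x: "x \<in> K"
      then obtain y where "y \<in> families (f ` V)" "pull_back f V y = x"
        using pull_back_surj[OF V f] unfolding K_def by blast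
      then show "x \<in> pull_back f V ` K'" using ker x by blast
    qed
  qed
  have sK': "subspace K'"
    unfolding K'_def by (rule subspace_rigidity_kernel[OF wp'])
  have "dim (families V :: ('v \<Rightarrow>\<^sub>0 'y) set) = dim (families (f ` V) :: ('w \<Rightarrow>\<^sub>0 'y) set)"
    using dim_linear_image_inj[OF linear_pull_back[OF V, of f] subspace_families fV inj] im by simp
  moreover have "dim K = dim K'"
  proof -
    have "K' \<subseteq> families (f ` V)" by (auto simp: K'_def)
    then show ?thesis
      using dim_linear_image_inj[OF linear_pull_back[OF V, of f] sK' finite_spanned_subset[OF fV]] inj imK
      by blast
  qed
  ultimately show "rigidity_rank V E (pull_back f V p) = rigidity_rank (f ` V) ((`) f ` E) p"
    using rigidity_rank_nullity[OF B G wp] rigidity_rank_nullity[OF B G' wp']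
    unfolding K_def K'_def by simp
qed

text \<open>Pulling back preserves well-positionedness, rank and norm, hence regularity and
  closeness, so density holds for every vertex type.\<close>

lemma generic_space_regular_dense:
  fixes q :: "'v \<Rightarrow>\<^sub>0 'x::real_normed_vector" and B :: "'x set"
  assumes B: "finite B" "span B = UNIV" and gen: "generic_space TYPE('x)"
    and G: "simple_graph V E" and q: "q \<in> families V" and r: "r > 0"
  obtains p where "regular_framework V E p" "norm (p - q) < r"
proof -
  have V: "finite V" using simple_graph_finite[OF G] by blast
  obtain f :: "'v \<Rightarrow> nat" where f: "inj_on f V" using V finite_imp_inj_to_nat_seg by metis
  have G': "simple_graph (f ` V) ((`) f ` E)" by (rule image_simple_graph[OF f G])
  obtain q' where q': "q' \<in> families (f ` V)" "pull_back f V q' = q" using pull_back_surj[OF V f q] by blast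
  have "q' \<in> closure {p :: nat \<Rightarrow>\<^sub>0 'x. regular_framework (f ` V) ((`) f ` E) p}"
    using gen G' q'(1) unfolding generic_space_def by blast
  then obtain p' where p': "regular_framework (f ` V) ((`) f ` E) p'" "dist p' q' < r"
    using r unfolding closure_approachable by blast
  have wp': "well_positioned (f ` V) ((`) f ` E) p'" using p'(1) unfolding regular_framework_def by blast
  then have pV: "p' \<in> families (f ` V)" using well_positioned_iff[OF G'] by blast
  show ?thesis
  proof (rule that[of "pull_back f V p'"])
    have "pull_back f V p' - q = pull_back f V (p' - q')"
      using linear_diff[OF linear_pull_back[OF V]] q'(2) by metis
    moreover have "p' - q' \<in> families (f ` V)"
      using subspace_diff[OF subspace_families pV q'(1)] .
    ultimately show "norm (pull_back f V p' - q) < r"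
      using p'(2) by (simp add: dist_norm pull_back_norm[OF V f])
    show "regular_framework V E (pull_back f V p')"
      unfolding regular_framework_def
    proof (intro conjI allI impI)
      show "well_positioned V E (pull_back f V p')" using well_positioned_pull_back[OF G f pV] wp' by blast
      fix x :: "'v \<Rightarrow>\<^sub>0 'x" assume x: "well_positioned V E x"
      then have "x \<in> families V" using well_positioned_iff[OF G] by blast
      then obtain y where y: "y \<in> families (f ` V)" "pull_back f V y = x" using pull_back_surj[OF V f] by blast
      then have wy: "well_positioned (f ` V) ((`) f ` E) y" using well_positioned_pull_back[OF G f y(1)] x by simp
      have "rigidity_rank V E x = rigidity_rank (f ` V) ((`) f ` E) y"
        using rigidity_rank_pull_back[OF G f y(1) B wy] y(2) by simp
      also have "\<dots> \<le> rigidity_rank (f ` V) ((`) f ` E) p'"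
        using p'(1) wy unfolding regular_framework_def by blast
      also have "\<dots> = rigidity_rank V E (pull_back f V p')"
        using rigidity_rank_pull_back[OF G f pV B wp'] by simp
      finally show "rigidity_rank V E x \<le> rigidity_rank V E (pull_back f V p')" .
    qed
  qed
qed

section \<open>Semicontinuity of trivial motions and rank\<close>

lemma subspace_trivial_motions:
  fixes p :: "'v \<Rightarrow>\<^sub>0 'x::real_normed_vector" and B :: "'x set"
  assumes B: "finite B" "span B = UNIV"
  shows "subspace (trivial_motions V p)"
  unfolding subspace_def
proof (intro conjI ballI allI)
  show "0 \<in> trivial_motions V p"
    unfolding trivial_motions_def using translation_infinitesimal_rigid_motion[of "0::'x"]
    by (intro CollectI conjI bexI[of _ "\<lambda>x. 0"]) (simp_all add: families_def)
next
  fix u w assume "u \<in> trivial_motions V p" "w \<in> trivial_motions V p"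
  then obtain \<eta> \<xi> where *: "u \<in> families V" "w \<in> families V"
    "\<eta> \<in> infinitesimal_rigid_motions" "\<xi> \<in> infinitesimal_rigid_motions"
    "\<forall>v\<in>V. lookup u v = \<eta> (lookup p v)"
    "\<forall>v\<in>V. lookup w v = \<xi> (lookup p v)"
    unfolding trivial_motions_def by blast
  have "u + w \<in> families V" using subspace_add[OF subspace_families *(1,2)] .
  moreover have "\<forall>v\<in>V. lookup (u + w) v = \<eta> (lookup p v) + \<xi> (lookup p v)"
    using *(5,6) by (simp add: lookup_add)
  ultimately show "u + w \<in> trivial_motions V p"
    unfolding trivial_motions_def using infinitesimal_rigid_motion_add[OF B *(3,4)]
    by (intro CollectI conjI bexI[of _ "\<lambda>x. \<eta> x + \<xi> x"])
next
  fix c u assume "u \<in> trivial_motions V p"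
  then obtain \<eta> where *: "u \<in> families V" "\<eta> \<in> infinitesimal_rigid_motions"
    "\<forall>v\<in>V. lookup u v = \<eta> (lookup p v)"
    unfolding trivial_motions_def by blast
  have "c *\<^sub>R u \<in> families V" using subspace_scale[OF subspace_families *(1)] .
  moreover have "\<forall>v\<in>V. lookup (c *\<^sub>R u) v = c *\<^sub>R \<eta> (lookup p v)"
    using *(3) by simp
  ultimately show "c *\<^sub>R u \<in> trivial_motions V p"
    unfolding trivial_motions_def using infinitesimal_rigid_motion_scale[OF *(2), of c]
    by (intro CollectI conjI bexI[of _ "\<lambda>x. c *\<^sub>R \<eta> x"])
qed

lemma linear_finite_dim_bounded:
  fixes f :: "'a::real_normed_vector \<Rightarrow> 'b::real_normed_vector" and B :: "'a set"
  assumes B: "finite B" "span B = UNIV" and f: "linear f"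
  obtains K where "0 \<le> K" "\<And>x. norm (f x) \<le> K * norm x"
proof -
  have "finite_spanned (UNIV :: 'a set)" using B unfolding finite_spanned_def by blast
  then obtain C :: "'a set" where C: "finite C" "independent C" "UNIV \<subseteq> span C"
    by (elim finite_spanned_basis)
  obtain m where m: "m > 0" "\<And>c i. i \<in> C \<Longrightarrow> m * \<bar>c i\<bar> \<le> norm (\<Sum>i\<in>C. c i *\<^sub>R i)"
    using independent_family_bounded_below[OF C(1) independent_imp_independent_family[OF C(1,2)]] by metis
  show ?thesis
  proof (rule that[of "\<Sum>b\<in>C. norm (f b) / m"])
    show "0 \<le> (\<Sum>b\<in>C. norm (f b) / m)" using m(1) by (intro sum_nonneg) simp
    fix x
    have "x \<in> span C" using C by blast
    then obtain u where u: "x = (\<Sum>b\<in>C. u b *\<^sub>R b)" unfolding span_finite[OF C(1)] by blast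
    have "norm (f x) = norm (\<Sum>b\<in>C. u b *\<^sub>R f b)"
      unfolding u by (simp add: linear_sum[OF f] linear_scale[OF f])
    also have "\<dots> \<le> (\<Sum>b\<in>C. (norm (f b) / m) * norm x)"
    proof (rule sum_norm_le)
      fix b assume b: "b \<in> C"
      have "\<bar>u b\<bar> \<le> norm x / m" using m(2)[OF b, of u] m(1) u by (simp add: field_simps)
      then have "\<bar>u b\<bar> * norm (f b) \<le> norm x / m * norm (f b)" by (rule mult_right_mono) simp
      then show "norm (u b *\<^sub>R f b) \<le> (norm (f b) / m) * norm x" by (simp add: mult.commute)
    qed
    finally show "norm (f x) \<le> (\<Sum>b\<in>C. norm (f b) / m) * norm x" by (simp add: sum_distrib_right)
  qed
qed

text \<open>
  Infinitesimal rigid motions are affine, so along the line through \<open>q\<close> and \<open>p\<close> their values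
  form a linear pencil; independence at \<open>p\<close> persists at placements arbitrarily close to \<open>q\<close>.
\<close>

lemma trivial_motions_dim_le_near:
  fixes p q :: "'v \<Rightarrow>\<^sub>0 'x::real_normed_vector" and B :: "'x set"
  assumes B: "finite B" "span B = UNIV" and V: "finite V"
    and p: "p \<in> families V" and q: "q \<in> families V" and r: "r > 0"
  obtains q' d where "q' \<in> families V" "norm (q' - q) < r" "d > 0"
    "\<And>x. x \<in> families V \<Longrightarrow> norm (x - q') < d \<Longrightarrow> dim (trivial_motions V p) \<le> dim (trivial_motions V x)"
proof -
  have fV: "finite_spanned (families V :: ('v \<Rightarrow>\<^sub>0 'x) set)" by (rule finite_spanned_families[OF B V])
  have tf: "trivial_motions V x \<subseteq> families V" for x :: "'v \<Rightarrow>\<^sub>0 'x" by (auto simp: trivial_motions_def)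
  have ft: "finite_spanned (trivial_motions V x)" for x :: "'v \<Rightarrow>\<^sub>0 'x" by (rule finite_spanned_subset[OF fV tf])
  obtain C where C: "C \<subseteq> trivial_motions V p" "finite C" "independent C" "card C = dim (trivial_motions V p)"
    by (rule finite_spanned_basis[OF ft])
  have "\<forall>c\<in>C. \<exists>\<eta>. \<eta> \<in> infinitesimal_rigid_motions \<and> (\<forall>v\<in>V. lookup c v = \<eta> (lookup p v))"
    using C(1) unfolding trivial_motions_def by blast
  then obtain \<eta> where "\<forall>c\<in>C. \<eta> c \<in> infinitesimal_rigid_motions \<and>
      (\<forall>v\<in>V. lookup c v = \<eta> c (lookup p v))"
    unfolding bchoice_iff by blast
  then have \<eta>: "\<And>c. c \<in> C \<Longrightarrow> \<eta> c \<in> infinitesimal_rigid_motions"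
    "\<And>c v. c \<in> C \<Longrightarrow> v \<in> V \<Longrightarrow> lookup c v = \<eta> c (lookup p v)" by blast+
  \<comment> \<open>The rigid motion behind the basis vector \<open>c\<close> at \<open>p\<close>,
    evaluated at another placement \<open>x\<close>; it is again trivial there.\<close>
  define ev where "ev c x = family_of V (\<lambda>v. \<eta> c (lookup x v))" for c and x :: "'v \<Rightarrow>\<^sub>0 'x"
  have ev_fam: "ev c x \<in> families V" for c x unfolding ev_def by (rule family_of_in_families[OF V])
  have ev_lookup: "lookup (ev c x) v = \<eta> c (lookup x v)" if "v \<in> V" for c x v
    using that by (simp add: ev_def lookup_family_of[OF V])
  have ev_trivial: "ev c x \<in> trivial_motions V x" if "c \<in> C" for c x
    unfolding trivial_motions_def using ev_fam \<eta>(1)[OF that] ev_lookup by blast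
  have ev_p: "ev c p = c" if "c \<in> C" for c
    using that C(1) tf by (intro families_eqI[OF ev_fam]) (auto simp: ev_lookup \<eta>(2))
  have lin: "linear (\<lambda>y. \<eta> c y - \<eta> c 0)" if "c \<in> C" for c
    by (rule infinitesimal_rigid_motion_linear[OF B \<eta>(1)[OF that]])
  have ev_line: "ev c (q + s *\<^sub>R (p - q)) = ev c q + s *\<^sub>R (ev c p - ev c q)" if c: "c \<in> C" for c s
  proof (rule families_eqI[OF ev_fam])
    show "ev c q + s *\<^sub>R (ev c p - ev c q) \<in> families V"
      by (intro subspace_add subspace_scale subspace_diff subspace_families ev_fam)
    fix v assume v: "v \<in> V"
    have "\<eta> c (x + s *\<^sub>R (y - x)) = \<eta> c x + s *\<^sub>R (\<eta> c y - \<eta> c x)" for x y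
    proof -
      have 1: "\<eta> c (x + s *\<^sub>R (y - x)) - \<eta> c 0 = (\<eta> c x - \<eta> c 0) + (\<eta> c (s *\<^sub>R (y - x)) - \<eta> c 0)"
        by (rule linear_add[OF lin[OF c]])
      have 2: "\<eta> c (s *\<^sub>R (y - x)) - \<eta> c 0 = s *\<^sub>R (\<eta> c (y - x) - \<eta> c 0)"
        by (rule linear_scale[OF lin[OF c]])
      have 3: "\<eta> c (y - x) - \<eta> c 0 = (\<eta> c y - \<eta> c 0) - (\<eta> c x - \<eta> c 0)"
        by (rule linear_diff[OF lin[OF c]])
      have "\<eta> c (x + s *\<^sub>R (y - x)) = \<eta> c 0 + ((\<eta> c x - \<eta> c 0) + s *\<^sub>R ((\<eta> c y - \<eta> c 0) - (\<eta> c x - \<eta> c 0)))"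
        using 1 unfolding 2 3 by (metis add.commute diff_add_cancel)
      then show ?thesis by simp
    qed
    then show "lookup (ev c (q + s *\<^sub>R (p - q))) v = lookup (ev c q + s *\<^sub>R (ev c p - ev c q)) v"
      using v by (simp add: ev_lookup lookup_add lookup_minus)
  qed
  have "independent_family C (\<lambda>c. ev c q + (ev c p - ev c q))"
    using independent_imp_independent_family[OF C(2,3)] ev_p unfolding independent_family_def by simp
  from independent_family_pencil[OF C(2) this] obtain s0 where s0: "s0 > (0::real)"
    "\<And>s. 0 < s \<Longrightarrow> s < s0 \<Longrightarrow> independent_family C (\<lambda>c. ev c q + s *\<^sub>R (ev c p - ev c q))"
    by blast
  define D where "D = norm (p - q) + 1"
  have D: "D > 0" "norm (p - q) < D" using norm_ge_zero[of "p - q"] unfolding D_def by linarith+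
  \<comment> \<open>\<open>s0 / 2\<close> stays within the range of the pencil, and
    \<open>r / D\<close> keeps the new placement within \<open>r\<close> of
    \<open>q\<close>.\<close>
  define s where "s = min (s0 / 2) (r / D)"
  have s: "0 < s" "s < s0" "s \<le> r / D" using s0(1) r D by (auto simp: s_def)
  define q' where "q' = q + s *\<^sub>R (p - q)"
  have q': "q' \<in> families V"
    unfolding q'_def by (intro subspace_add subspace_scale subspace_diff subspace_families p q)
  have "norm (q' - q) = s * norm (p - q)" using s by (simp add: q'_def)
  also have "\<dots> < s * D" using s D by simp
  also have "\<dots> \<le> r" using s(3) D by (simp add: field_simps)
  finally have q'r: "norm (q' - q) < r" .
  have "independent_family C (\<lambda>c. ev c q')"
    using s0(2)[OF s(1,2)] ev_line unfolding q'_def independent_family_def by simp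
  then obtain d where d: "d > 0" "\<And>z. (\<And>c. c \<in> C \<Longrightarrow> norm (z c - ev c q') < d) \<Longrightarrow> independent_family C z"
    using independent_family_perturb[OF C(2)] by metis
  have "\<forall>c\<in>C. \<exists>K. 0 \<le> K \<and> (\<forall>y. norm (\<eta> c y - \<eta> c 0) \<le> K * norm y)"
    using linear_finite_dim_bounded[OF B lin] by metis
  then obtain K where K: "\<And>c. c \<in> C \<Longrightarrow> 0 \<le> K c" "\<And>c y. c \<in> C \<Longrightarrow> norm (\<eta> c y - \<eta> c 0) \<le> K c * norm y"
    unfolding bchoice_iff by blast
  \<comment> \<open>A common Lipschitz constant of all \<open>ev c\<close>: the norm on families
    sums over \<open>V\<close>, which contributes the factor \<open>card V\<close>.\<close>
  define M where "M = real (card V) * (\<Sum>c\<in>C. K c) + 1"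
  have "0 \<le> (\<Sum>c\<in>C. K c)" using K(1) by (rule sum_nonneg)
  then have M: "M > 0" unfolding M_def by (simp add: add_nonneg_pos)
  show ?thesis
  proof (rule that[OF q' q'r, of "d / M"])
    show "d / M > 0" using d M by simp
    fix x :: "'v \<Rightarrow>\<^sub>0 'x" assume x: "x \<in> families V" "norm (x - q') < d / M"
    have "norm (ev c x - ev c q') < d" if c: "c \<in> C" for c
    proof -
      have "ev c x - ev c q' \<in> families V" by (intro subspace_diff subspace_families ev_fam)
      then have "norm (ev c x - ev c q') = (\<Sum>v\<in>V. norm (\<eta> c (lookup x v) - \<eta> c (lookup q' v)))"
        unfolding norm_families[OF V \<open>ev c x - ev c q' \<in> families V\<close>]
        by (intro sum.cong) (simp_all add: lookup_minus ev_lookup)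
      also have "\<dots> \<le> (\<Sum>v\<in>V. K c * norm (x - q'))"
      proof (rule sum_mono)
        fix v
        have "norm (\<eta> c (lookup x v) - \<eta> c (lookup q' v)) \<le> K c * norm (lookup (x - q') v)"
          using K(2)[OF c, of "lookup (x - q') v"]
            linear_diff[OF lin[OF c], of "lookup x v" "lookup q' v"]
          by (simp add: lookup_minus)
        also have "\<dots> \<le> K c * norm (x - q')" using K(1)[OF c] by (intro mult_left_mono norm_lookup_le)
        finally show "norm (\<eta> c (lookup x v) - \<eta> c (lookup q' v)) \<le> K c * norm (x - q')" .
      qed
      also have "\<dots> = real (card V) * K c * norm (x - q')" by simp
      also have "\<dots> \<le> M * norm (x - q')"
      proof (rule mult_right_mono)
        have "K c \<le> (\<Sum>c\<in>C. K c)" using C(2) c K(1) by (intro member_le_sum) auto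
        then have "real (card V) * K c \<le> real (card V) * (\<Sum>c\<in>C. K c)" by (rule mult_left_mono) simp
        then show "real (card V) * K c \<le> M" by (simp add: M_def)
      qed simp
      also have "\<dots> < d" using x(2) M by (simp add: field_simps)
      finally show ?thesis .
    qed
    then have "independent_family C (\<lambda>c. ev c x)" by (rule d(2))
    then have "card C \<le> dim (trivial_motions V x)"
      using ev_trivial by (intro card_le_dim_if_independent_family[OF C(2) _ _ ft]) auto
    then show "dim (trivial_motions V p) \<le> dim (trivial_motions V x)" using C(4) by simp
  qed
qed

text \<open>Preimages \<open>u c\<close> of a basis \<open>C\<close> of the image at
  \<open>p\<close> are kept fixed while the placement moves. The entries of their images are
  derivatives of norms, which vary continuously among well-positioned placements, so the images stay
  independent.\<close>

lemma rigidity_rank_lower_semicontinuous: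
  fixes p :: "'v \<Rightarrow>\<^sub>0 'x::real_normed_vector"
  assumes G: "simple_graph V E" and wp: "well_positioned V E p"
  obtains d where "d > 0"
    "\<And>x. well_positioned V E x \<Longrightarrow> norm (x - p) < d \<Longrightarrow> rigidity_rank V E p \<le> rigidity_rank V E x"
proof -
  have fin: "finite V" "finite E" using simple_graph_finite[OF G] by blast+
  have fE: "finite_spanned (families E :: ('v set \<Rightarrow>\<^sub>0 real) set)" by (rule finite_spanned_real_families[OF fin(2)])
  have im: "rigidity_deriv V E x ` families V \<subseteq> families E" if "well_positioned V E x" for x :: "'v \<Rightarrow>\<^sub>0 'x"
    using rigidity_deriv_in_families[OF G that] by blast
  obtain C where C: "C \<subseteq> rigidity_deriv V E p ` families V" "finite C" "independent C" "card C = rigidity_rank V E p"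
    unfolding rigidity_rank_def by (rule finite_spanned_basis[OF finite_spanned_subset[OF fE im[OF wp]]])
  have "\<forall>c\<in>C. \<exists>u. u \<in> families V \<and> rigidity_deriv V E p u = c" using C(1) by blast
  then obtain u where u: "\<And>c. c \<in> C \<Longrightarrow> u c \<in> families V" "\<And>c. c \<in> C \<Longrightarrow> rigidity_deriv V E p (u c) = c"
    unfolding bchoice_iff by blast
  obtain e where e: "e > 0" "\<And>z. (\<And>c. c \<in> C \<Longrightarrow> norm (z c - c) < e) \<Longrightarrow> independent_family C z"
    using independent_family_perturb[OF C(2) independent_imp_independent_family[OF C(2,3)]] by metis
  define \<epsilon> where "\<epsilon> = e / (real (card E) + 1)"
  have \<epsilon>: "\<epsilon> > 0" using e(1) by (simp add: \<epsilon>_def)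
  have "\<forall>\<^sub>F x in nhds p. well_positioned V E x \<longrightarrow>
      \<bar>lookup (rigidity_deriv V E x (u c)) f - lookup c f\<bar> < \<epsilon>"
    if c: "c \<in> C" and f: "f \<in> E" for c f
  proof -
    obtain v w where vw: "f = {v, w}" using simple_graph_edgeE[OF G f] by metis
    let ?d = "\<lambda>x :: 'v \<Rightarrow>\<^sub>0 'x. lookup x v - lookup x w"
    have diff: "norm differentiable (at (?d x))" if "well_positioned V E x" for x
      using that well_positioned_iff[OF G] f vw by blast
    have lk: "lookup (rigidity_deriv V E x (u c)) f = norm_deriv (?d x) (?d (u c))"
      if "well_positioned V E x" for x
      using lookup_rigidity_deriv[OF G that u(1)[OF c]] f vw by simp
    obtain \<delta> where \<delta>: "\<delta> > 0" "\<And>y. norm (y - ?d p) < \<delta> \<Longrightarrow> norm differentiable (at y) \<Longrightarrow>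
        \<bar>norm_deriv y (?d (u c)) - norm_deriv (?d p) (?d (u c))\<bar> < \<epsilon>"
      using norm_deriv_continuous[OF diff[OF wp] \<epsilon>] by metis
    have near: "norm (?d x - ?d p) < \<delta>" if "norm (x - p) < \<delta> / 2" for x
    proof -
      have "?d x - ?d p = lookup (x - p) v - lookup (x - p) w"
        by (simp add: lookup_minus)
      then have "norm (?d x - ?d p) \<le> norm (lookup (x - p) v) + norm (lookup (x - p) w)"
        by (metis norm_triangle_ineq4)
      also have "\<dots> \<le> norm (x - p) + norm (x - p)" by (intro add_mono norm_lookup_le)
      finally show ?thesis using that by simp
    qed
    have cp: "lookup c f = norm_deriv (?d p) (?d (u c))" using lk[OF wp] u(2)[OF c] by simp
    show ?thesis
      unfolding eventually_nhds_metric dist_norm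
    proof (intro exI[of _ "\<delta> / 2"] conjI allI impI)
      fix x assume "norm (x - p) < \<delta> / 2" "well_positioned V E x"
      then show "\<bar>lookup (rigidity_deriv V E x (u c)) f - lookup c f\<bar> < \<epsilon>"
        using \<delta>(2)[OF near diff] by (simp add: lk cp)
    qed (use \<delta>(1) in simp)
  qed
  then have "\<forall>\<^sub>F x in nhds p. \<forall>c\<in>C. \<forall>f\<in>E. well_positioned V E x \<longrightarrow>
      \<bar>lookup (rigidity_deriv V E x (u c)) f - lookup c f\<bar> < \<epsilon>"
    using fin(2) C(2) by (intro eventually_ball_finite ballI)
  then obtain d where d: "d > 0" "\<And>x c f. norm (x - p) < d \<Longrightarrow> c \<in> C \<Longrightarrow> f \<in> E \<Longrightarrow> well_positioned V E x \<Longrightarrow>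
      \<bar>lookup (rigidity_deriv V E x (u c)) f - lookup c f\<bar> < \<epsilon>"
    unfolding eventually_nhds_metric dist_norm by blast
  show ?thesis
  proof (rule that[OF d(1)])
    fix x assume x: "well_positioned V E x" "norm (x - p) < d"
    have "norm (rigidity_deriv V E x (u c) - c) < e" if c: "c \<in> C" for c
    proof -
      have "c \<in> families E" using C(1) im[OF wp] c by blast
      then have m: "rigidity_deriv V E x (u c) - c \<in> families E"
        using rigidity_deriv_in_families[OF G x(1) u(1)[OF c]] by (intro subspace_diff subspace_families)
      have "norm (rigidity_deriv V E x (u c) - c) \<le> (\<Sum>f\<in>E. \<epsilon>)"
        unfolding norm_families[OF fin(2) m]
        using d(2)[OF x(2) c _ x(1)] by (intro sum_mono) (force simp: lookup_minus intro: less_imp_le)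
      also have "\<dots> = e * (real (card E) / (real (card E) + 1))" by (simp add: \<epsilon>_def)
      also have "\<dots> < e" using e(1) by (simp add: field_simps)
      finally show ?thesis .
    qed
    then have "independent_family C (\<lambda>c. rigidity_deriv V E x (u c))" by (rule e(2))
    then have "card C \<le> dim (rigidity_deriv V E x ` families V)"
      using u(1) by (intro card_le_dim_if_independent_family[OF C(2) _ _ finite_spanned_subset[OF fE im[OF x(1)]]]) auto
    then show "rigidity_rank V E p \<le> rigidity_rank V E x" using C(4) by (simp add: rigidity_rank_def)
  qed
qed

section \<open>The decomposition theorem\<close>

text \<open>\<open>H\<close> may be smaller than \<open>E - T\<close> because surplus edges of a
  connected graph are added to it. More edges only shrink the kernel, so rigidity passes to
  \<open>E - T\<close>, whereas independence is asserted only without surplus edges.\<close>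

lemma cylindrical_splitting_exists:
  fixes p :: "'v \<Rightarrow>\<^sub>0 'x::real_normed_vector" and B :: "'x set"
  assumes B: "finite B" "span B = UNIV" and dim: "dim (UNIV :: 'x set) \<ge> 2"
    and gen: "generic_space TYPE('x)"
    and G: "simple_graph V E" and T: "T \<subseteq> E" "layered_forest V T l par"
    and H: "H \<subseteq> E - T" and p: "well_positioned V H p"
  obtains z :: "'v \<Rightarrow>\<^sub>0 'x cylinder" where "cylindrical_splitting V (E - T) T z"
    "infinitesimally_rigid V H p \<Longrightarrow> infinitesimally_rigid V (E - T) (bases z)"
    "H = E - T \<Longrightarrow> independent_framework V H p \<Longrightarrow> independent_framework V (E - T) (bases z)"
proof -
  let ?H' = "E - T"
  have V: "finite V" using simple_graph_finite[OF G] by blast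
  have GH: "simple_graph V H" and GH': "simple_graph V ?H'" and GT: "simple_graph V T"
    using simple_graph_subset[OF G] H T(1) by blast+
  have pV: "p \<in> families V" using p well_positioned_iff[OF GH] by blast
  obtain q0 :: "'v \<Rightarrow> 'x" and h :: "'v \<Rightarrow> real" where
    tl: "\<And>v w. v \<in> V \<Longrightarrow> w \<in> V \<Longrightarrow> {v, w} \<in> T \<Longrightarrow> norm (q0 v - q0 w) < \<bar>h v - h w\<bar>" and
    sl: "\<And>v w. v \<in> V \<Longrightarrow> w \<in> V \<Longrightarrow> v \<noteq> w \<Longrightarrow> {v, w} \<notin> T \<Longrightarrow> \<bar>h v - h w\<bar> < norm (q0 v - q0 w)"
    using forest_placement[OF B dim V T(2)] by metis
  define q where "q = family_of V q0"
  have q: "q \<in> families V" unfolding q_def by (rule family_of_in_families[OF V])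
  have lq: "lookup q v = q0 v" if "v \<in> V" for v using that by (simp add: q_def lookup_family_of[OF V])
  have "\<exists>r>0. \<forall>x. norm (x - q) < r \<longrightarrow> (\<forall>v\<in>V. \<forall>w\<in>V.
      ({v, w} \<in> T \<longrightarrow> norm (lookup x v - lookup x w) < \<bar>h v - h w\<bar>) \<and>
      ({v, w} \<in> ?H' \<longrightarrow> \<bar>h v - h w\<bar> < norm (lookup x v - lookup x w)))"
  proof -
    have cont: "((\<lambda>x. norm (lookup x v - lookup x w)) \<longlongrightarrow>
        norm (lookup q v - lookup q w)) (nhds q)" for v w
    proof -
      have "((\<lambda>x. lookup x v) \<longlongrightarrow> lookup q v) (nhds q)" for v
        using bounded_linear.tendsto[OF bounded_linear_lookup filterlim_ident] .
      then show ?thesis by (intro tendsto_norm tendsto_diff)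
    qed
    have "\<forall>\<^sub>F x in nhds q. ({v, w} \<in> T \<longrightarrow> norm (lookup x v - lookup x w) < \<bar>h v - h w\<bar>) \<and>
      ({v, w} \<in> ?H' \<longrightarrow> \<bar>h v - h w\<bar> < norm (lookup x v - lookup x w))"
      if vw: "v \<in> V" "w \<in> V" for v w
    proof (rule eventually_conj)
      show "\<forall>\<^sub>F x in nhds q. {v, w} \<in> T \<longrightarrow> norm (lookup x v - lookup x w) < \<bar>h v - h w\<bar>"
      proof (cases "{v, w} \<in> T")
        case True
        then have "norm (lookup q v - lookup q w) < \<bar>h v - h w\<bar>"
          using tl[OF vw] vw by (simp add: lq)
        from order_tendstoD(2)[OF cont this] show ?thesis by (rule eventually_mono) blast
      qed simp
      show "\<forall>\<^sub>F x in nhds q. {v, w} \<in> ?H' \<longrightarrow> \<bar>h v - h w\<bar> < norm (lookup x v - lookup x w)"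
      proof (cases "{v, w} \<in> ?H'")
        case True
        then have "v \<noteq> w" using simple_graph_edgeD[OF GH'] by blast
        then have "\<bar>h v - h w\<bar> < norm (lookup q v - lookup q w)"
          using sl[OF vw] vw True by (simp add: lq)
        from order_tendstoD(1)[OF cont this] show ?thesis by (rule eventually_mono) blast
      next
        case False
        then show ?thesis by (intro always_eventually) blast
      qed
    qed
    then have "\<forall>\<^sub>F x in nhds q. \<forall>v\<in>V. \<forall>w\<in>V.
      ({v, w} \<in> T \<longrightarrow> norm (lookup x v - lookup x w) < \<bar>h v - h w\<bar>) \<and>
      ({v, w} \<in> ?H' \<longrightarrow> \<bar>h v - h w\<bar> < norm (lookup x v - lookup x w))"
      using V by (intro eventually_ball_finite ballI)
    then show ?thesis unfolding eventually_nhds_metric dist_norm .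
  qed
  then obtain r where r: "r > 0" and U: "\<And>x v w. norm (x - q) < r \<Longrightarrow> v \<in> V \<Longrightarrow> w \<in> V \<Longrightarrow>
      ({v, w} \<in> T \<longrightarrow> norm (lookup x v - lookup x w) < \<bar>h v - h w\<bar>) \<and>
      ({v, w} \<in> ?H' \<longrightarrow> \<bar>h v - h w\<bar> < norm (lookup x v - lookup x w))"
    by blast
  have r2: "r / 2 > 0" using r by simp
  obtain q' d where q': "q' \<in> families V" "norm (q' - q) < r / 2" "d > 0"
    "\<And>x. x \<in> families V \<Longrightarrow> norm (x - q') < d \<Longrightarrow> dim (trivial_motions V p) \<le> dim (trivial_motions V x)"
    using trivial_motions_dim_le_near[OF B V pV q r2] by metis
  have "min d (r / 2) > 0" using q'(3) r by simp
  \<comment> \<open>The radius keeps \<open>x\<close> both inside the open set around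
    \<open>q\<close> where the forest is realised and close enough to \<open>q'\<close> to have at
    least as many trivial motions as \<open>p\<close>.\<close>
  then obtain x where x: "regular_framework V ?H' x" "norm (x - q') < min d (r / 2)"
    by (rule generic_space_regular_dense[OF B gen GH' q'(1)])
  have wx: "well_positioned V ?H' x" using x(1) unfolding regular_framework_def by blast
  then have xV: "x \<in> families V" using well_positioned_iff[OF GH'] by blast
  have xq: "norm (x - q) < r"
    using norm_triangle_ineq[of "x - q'" "q' - q"] x(2) q'(2) by simp
  have dim_triv: "dim (trivial_motions V p) \<le> dim (trivial_motions V x)" using q'(4)[OF xV] x(2) by simp
  \<comment> \<open>Near \<open>p\<close> there is a placement \<open>y\<close> regular for
    \<open>E - T\<close>. The rank of \<open>H\<close> does not drop at \<open>y\<close>, added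
    edges do not lower it, and the regular \<open>x\<close> attains the maximum over all
    placements.\<close>
  have rank: "rigidity_rank V H p \<le> rigidity_rank V ?H' x"
  proof -
    obtain \<delta> where \<delta>: "\<delta> > 0" "\<And>y. well_positioned V H y \<Longrightarrow> norm (y - p) < \<delta> \<Longrightarrow> rigidity_rank V H p \<le> rigidity_rank V H y"
      using rigidity_rank_lower_semicontinuous[OF GH p] by metis
    obtain y where y: "regular_framework V ?H' y" "norm (y - p) < \<delta>"
      by (rule generic_space_regular_dense[OF B gen GH' pV \<delta>(1)])
    have wy': "well_positioned V ?H' y" using y(1) unfolding regular_framework_def by blast
    then have wy: "well_positioned V H y"
      using H unfolding well_positioned_iff[OF GH'] well_positioned_iff[OF GH] by blast
    have "{u \<in> families V. rigidity_deriv V ?H' y u = 0} \<subseteq> {u \<in> families V. rigidity_deriv V H y u = 0}"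
      using rigidity_deriv_eq_0_iff[OF GH' wy'] rigidity_deriv_eq_0_iff[OF GH wy] H by blast
    then have "dim {u \<in> families V. rigidity_deriv V ?H' y u = 0} \<le> dim {u \<in> families V. rigidity_deriv V H y u = 0}"
      by (rule dim_mono_finite_spanned) (rule finite_spanned_subset[OF finite_spanned_families[OF B V]], blast)
    then have "rigidity_rank V H y \<le> rigidity_rank V ?H' y"
      using rigidity_rank_nullity[OF B GH' wy'] rigidity_rank_nullity[OF B GH wy] by simp
    also have "\<dots> \<le> rigidity_rank V ?H' x" using x(1) wy' unfolding regular_framework_def by blast
    finally show ?thesis using \<delta>(2)[OF wy y(2)] by simp
  qed
  define z where "z = cylinder_family V (lookup x) h"
  have bz: "bases z = x" unfolding z_def by (rule bases_cylinder_family[OF V xV])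
  have lz: "lookup z v = Cyl (lookup x v) (h v)" if "v \<in> V" for v
    using that by (simp add: z_def lookup_cylinder_family[OF V])
  show ?thesis
  proof (rule that[of z])
    show "cylindrical_splitting V ?H' T z"
      unfolding cylindrical_splitting_def bz
    proof (intro conjI allI impI)
      show "z \<in> families V" unfolding z_def by (rule cylinder_family_in_families[OF V])
      fix v w assume e: "{v, w} \<in> ?H'"
      then show "\<bar>height (lookup z v - lookup z w)\<bar> < norm (base (lookup z v - lookup z w))"
        using U[OF xq simple_graph_edgeD(1,2)[OF GH' e]] simple_graph_edgeD(1,2)[OF GH' e] by (simp add: lz)
    next
      fix v w assume e: "{v, w} \<in> T"
      then show "norm (base (lookup z v - lookup z w)) < \<bar>height (lookup z v - lookup z w)\<bar>"
        using U[OF xq simple_graph_edgeD(1,2)[OF GT e]] simple_graph_edgeD(1,2)[OF GT e] by (simp add: lz)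
    qed (use wx in auto)
  next
    assume rigid: "infinitesimally_rigid V H p"
    \<comment> \<open>By rank and nullity the kernel at \<open>x\<close> is no larger than the one
      at \<open>p\<close>, which is trivial by rigidity and so no larger than the trivial motions at
      \<open>x\<close>; the inclusion is therefore an equality.\<close>
    have "trivial_motions V x = {u \<in> families V. rigidity_deriv V ?H' x u = 0}"
    proof (rule subspace_eq_if_dim_le[OF subspace_trivial_motions[OF B] trivial_motions_subset_kernel[OF GH' wx]])
      show "finite_spanned {u \<in> families V. rigidity_deriv V ?H' x u = 0}"
        by (rule finite_spanned_subset[OF finite_spanned_families[OF B V]]) blast
      have "dim {u \<in> families V. rigidity_deriv V ?H' x u = 0} \<le> dim {u \<in> families V. rigidity_deriv V H p u = 0}"
        using rigidity_rank_nullity[OF B GH' wx] rigidity_rank_nullity[OF B GH p] rank by linarith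
      also have "{u \<in> families V. rigidity_deriv V H p u = 0} = trivial_motions V p"
        using rigid unfolding infinitesimally_rigid_def by blast
      finally show "dim {u \<in> families V. rigidity_deriv V ?H' x u = 0} \<le> dim (trivial_motions V x)"
        using dim_triv by simp
    qed
    then show "infinitesimally_rigid V ?H' (bases z)" unfolding infinitesimally_rigid_def bz using wx by simp
  next
    assume eq: "H = ?H'" and ind: "independent_framework V H p"
    have "finite ?H'" using simple_graph_finite[OF GH'] by blast
    note fH' = finite_spanned_real_families[OF this]
    have "rigidity_deriv V ?H' x ` families V = families ?H'"
    proof (rule subspace_eq_if_dim_le[OF _ _ fH'])
      show "subspace (rigidity_deriv V ?H' x ` families V)"
        by (rule linear_subspace_image[OF linear_rigidity_deriv[OF wx] subspace_families])
      show "rigidity_deriv V ?H' x ` families V \<subseteq> families ?H'"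
        using rigidity_deriv_in_families[OF GH' wx] by blast
      have "rigidity_rank V H p = dim (families ?H' :: ('v set \<Rightarrow>\<^sub>0 real) set)"
        using ind unfolding independent_framework_def rigidity_rank_def eq by simp
      then show "dim (families ?H' :: ('v set \<Rightarrow>\<^sub>0 real) set) \<le> dim (rigidity_deriv V ?H' x ` families V)"
        using rank by (simp add: rigidity_rank_def)
    qed
    then show "independent_framework V ?H' (bases z)" unfolding independent_framework_def bz using wx by simp
  qed
qed

theorem theorem3p7:
  fixes V :: "'v set" and E :: "'v set set"
  assumes "\<exists>B :: 'x::real_normed_vector set. finite B \<and> span B = UNIV"
    and "dim (UNIV :: 'x set) \<ge> 2"
    and "generic_space TYPE('x)"
    and "simple_graph V E"
  shows
    "(rigid_graph TYPE('x cylinder) V E \<longleftrightarrow>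
       (\<exists>H T. E = H \<union> T \<and> H \<inter> T = {} \<and> rigid_graph TYPE('x) V H \<and> graph_connected V T)) \<and>
     (minimally_rigid_graph TYPE('x cylinder) V E \<longleftrightarrow>
       (\<exists>H T. E = H \<union> T \<and> H \<inter> T = {} \<and> minimally_rigid_graph TYPE('x) V H \<and> graph_tree V T)) \<and>
     (independent_graph TYPE('x cylinder) V E \<longleftrightarrow>
       (\<exists>H T. E = H \<union> T \<and> H \<inter> T = {} \<and> independent_graph TYPE('x) V H \<and> graph_forest T))"
proof -
  obtain B :: "'x set" where B: "finite B" "span B = UNIV" using assms(1) by blast
  note dim = assms(2) and gen = assms(3) and G = assms(4)
  have split: "\<exists>H T. E = H \<union> T \<and> H \<inter> T = {} \<and>
      (infinitesimally_rigid V E p \<longrightarrow> infinitesimally_rigid V H (bases p) \<and> graph_connected V T) \<and>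
      (independent_framework V E p \<longrightarrow> independent_framework V H (bases p) \<and> graph_forest T)"
    if wp: "well_positioned V E p" for p :: "'v \<Rightarrow>\<^sub>0 'x cylinder"
  proof -
    obtain H T where HT: "E = H \<union> T" "cylindrical_splitting V H T p"
      using well_positioned_imp_splitting[OF G wp] by metis
    then show ?thesis
      using infinitesimally_rigid_splitting_iff[OF B, of V H T p] independent_splitting_iff[of V H T p] G
      unfolding cylindrical_splitting_def by blast
  qed
  have join: "\<exists>z :: 'v \<Rightarrow>\<^sub>0 'x cylinder.
      (infinitesimally_rigid V H p \<longrightarrow> graph_connected V T' \<longrightarrow> infinitesimally_rigid V E z) \<and>
      (H = E - T' \<longrightarrow> independent_framework V H p \<longrightarrow> graph_forest T' \<longrightarrow> independent_framework V E z)"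
    if T': "T' \<subseteq> E" "layered_forest V T' l par" "H \<subseteq> E - T'" "well_positioned V H p" for H T' l par and p :: "'v \<Rightarrow>\<^sub>0 'x"
  proof -
    obtain z :: "'v \<Rightarrow>\<^sub>0 'x cylinder" where z: "cylindrical_splitting V (E - T') T' z"
      "infinitesimally_rigid V H p \<Longrightarrow> infinitesimally_rigid V (E - T') (bases z)"
      "H = E - T' \<Longrightarrow> independent_framework V H p \<Longrightarrow> independent_framework V (E - T') (bases z)"
      using cylindrical_splitting_exists[OF B dim gen G T'] by metis
    have E: "E - T' \<union> T' = E" using T'(1) by blast
    then have GE: "simple_graph V (E - T' \<union> T')" using G by simp
    show ?thesis
      using infinitesimally_rigid_splitting_iff[OF B GE z(1)] independent_splitting_iff[OF GE z(1)] z(2,3)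
      unfolding E by blast
  qed
  have rigid: "rigid_graph TYPE('x cylinder) V E \<longleftrightarrow>
       (\<exists>H T. E = H \<union> T \<and> H \<inter> T = {} \<and> rigid_graph TYPE('x) V H \<and> graph_connected V T)"
  proof
    assume "rigid_graph TYPE('x cylinder) V E"
    then obtain p :: "'v \<Rightarrow>\<^sub>0 'x cylinder" where p: "infinitesimally_rigid V E p" unfolding rigid_graph_def by blast
    then have "well_positioned V E p" unfolding infinitesimally_rigid_def by blast
    from split[OF this] p show "\<exists>H T. E = H \<union> T \<and> H \<inter> T = {} \<and> rigid_graph TYPE('x) V H \<and> graph_connected V T"
      unfolding rigid_graph_def by blast
  next
    assume "\<exists>H T. E = H \<union> T \<and> H \<inter> T = {} \<and> rigid_graph TYPE('x) V H \<and> graph_connected V T"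
    then obtain H T and p :: "'v \<Rightarrow>\<^sub>0 'x" where HT: "E = H \<union> T" "H \<inter> T = {}" "infinitesimally_rigid V H p" "graph_connected V T"
      unfolding rigid_graph_def by blast
    have "simple_graph V T" using simple_graph_subset[OF G] HT(1) by blast
    \<comment> \<open>Only a spanning forest of \<open>T\<close> is realised by heights; the other
      edges of \<open>T\<close> are counted with \<open>H\<close>.\<close>
    then obtain T' l par where T': "T' \<subseteq> T" "layered_forest V T' l par" "graph_connected V T'"
      using connected_imp_layered_forest[OF _ HT(4)] by metis
    have "T' \<subseteq> E" "H \<subseteq> E - T'" using T'(1) HT by blast+
    moreover have "well_positioned V H p" using HT(3) unfolding infinitesimally_rigid_def by blast
    ultimately show "rigid_graph TYPE('x cylinder) V E"
      using join[OF _ T'(2)] HT(3) T'(3) unfolding rigid_graph_def by blast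
  qed
  \<comment> \<open>Here \<open>T\<close> itself is layered, so no edge changes sides and
    \<open>H = E - T\<close>, as the independence part of \<open>join\<close> requires.\<close>
  have forest: "\<exists>z :: 'v \<Rightarrow>\<^sub>0 'x cylinder.
      (infinitesimally_rigid V H p \<longrightarrow> graph_connected V T \<longrightarrow> infinitesimally_rigid V E z) \<and> independent_framework V E z"
    if HT: "E = H \<union> T" "H \<inter> T = {}" "independent_framework V H p" "graph_forest T" for H T and p :: "'v \<Rightarrow>\<^sub>0 'x"
  proof -
    have "simple_graph V T" using simple_graph_subset[OF G] HT(1) by blast
    then obtain l par where T: "layered_forest V T l par"
      using forest_imp_layered_forest[OF _ HT(4)] by metis
    have "T \<subseteq> E" "H = E - T" using HT(1,2) by blast+
    moreover have "well_positioned V H p" using HT(3) unfolding independent_framework_def by blast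
    ultimately show ?thesis using join[OF _ T, of H p] HT(3,4) by blast
  qed
  have minimal: "minimally_rigid_graph TYPE('x cylinder) V E \<longleftrightarrow>
       (\<exists>H T. E = H \<union> T \<and> H \<inter> T = {} \<and> minimally_rigid_graph TYPE('x) V H \<and> graph_tree V T)"
  proof
    assume "minimally_rigid_graph TYPE('x cylinder) V E"
    then obtain p :: "'v \<Rightarrow>\<^sub>0 'x cylinder" where p: "infinitesimally_rigid V E p" "independent_framework V E p"
      unfolding minimally_rigid_graph_def minimally_infinitesimally_rigid_def by blast
    then have "well_positioned V E p" unfolding infinitesimally_rigid_def by blast
    from split[OF this] p show "\<exists>H T. E = H \<union> T \<and> H \<inter> T = {} \<and> minimally_rigid_graph TYPE('x) V H \<and> graph_tree V T"
      unfolding minimally_rigid_graph_def minimally_infinitesimally_rigid_def graph_tree_def by blast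
  next
    assume "\<exists>H T. E = H \<union> T \<and> H \<inter> T = {} \<and> minimally_rigid_graph TYPE('x) V H \<and> graph_tree V T"
    then obtain H T and p :: "'v \<Rightarrow>\<^sub>0 'x" where "E = H \<union> T" "H \<inter> T = {}" "infinitesimally_rigid V H p"
      "independent_framework V H p" "graph_connected V T" "graph_forest T"
      unfolding minimally_rigid_graph_def minimally_infinitesimally_rigid_def graph_tree_def by blast
    then show "minimally_rigid_graph TYPE('x cylinder) V E"
      unfolding minimally_rigid_graph_def minimally_infinitesimally_rigid_def using forest by blast
  qed
  have "independent_graph TYPE('x cylinder) V E \<longleftrightarrow>
       (\<exists>H T. E = H \<union> T \<and> H \<inter> T = {} \<and> independent_graph TYPE('x) V H \<and> graph_forest T)"
  proof
    assume "independent_graph TYPE('x cylinder) V E"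
    then obtain p :: "'v \<Rightarrow>\<^sub>0 'x cylinder" where p: "independent_framework V E p"
      unfolding independent_graph_def by blast
    then have "well_positioned V E p" unfolding independent_framework_def by blast
    from split[OF this] p show "\<exists>H T. E = H \<union> T \<and> H \<inter> T = {} \<and> independent_graph TYPE('x) V H \<and> graph_forest T"
      unfolding independent_graph_def by blast
  next
    assume "\<exists>H T. E = H \<union> T \<and> H \<inter> T = {} \<and> independent_graph TYPE('x) V H \<and> graph_forest T"
    then show "independent_graph TYPE('x cylinder) V E"
      unfolding independent_graph_def using forest by blast
  qed
  then show ?thesis using rigid minimal by blast
qed

end
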